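(* Let $e\geq 2$ be an integer and let $\lambda$ be a partition. Then $MG\lambda = GT\lambda$ (i.e. the image under the Mullineux map of the $e$-regularisation of $\lambda$ equals the $e$-regularisation of the conjugate of $\lambda$) if and only if for every node $(i,j)\in[\lambda]$ with $e\mid h_{ij}(\lambda)$, the hook $H_{ij}(\lambda)$ is either shallow or steep.
   Context: Partitions. A partition is a sequence $\lambda=(\lambda_1,\lambda_2,\dots)$ of non-negative integers with $\lambda_1\geq\lambda_2\geq\cdots$ and finite sum $|\lambda|$; $\varnothing$ is the unique partition of $0$. With $\mathbb{N}=\{1,2,\dots\}$, its Young diagram is $[\lambda]=\{(i,j)\in\mathbb{N}^2 : j\leq\lambda_i\}$; elements of $\mathbb{N}^2$ are called nodes. The number of non-zero parts of $\lambda$ is written $l(\lambda)$. Fix an integer $e\geq2$. $\lambda$ is $e$-regular if there is no $i\geq1$ with $\lambda_i=\lambda_{i+e-1}>0$. Operators are written on the left and composed from right to left. Conjugation. $T\lambda$ is the conjugate partition: $(T\lambda)_i=|\{j\geq1:\lambda_j\geq i\}|$. Regularisation. For $l\geq1$ the $l$th ladder is the set of nodes $(i,j)\in\mathbb{N}^2$ with $i+(e-1)(j-1)=l$. The $e$-regularisation $G\lambda$ is the partition whose Young diagram is obtained from $[\lambda]$ by moving all the nodes in each ladder as high as possible within that ladder (i.e. in each ladder, if $[\lambda]$ contains $k$ nodes of that ladder, then $[G\lambda]$ contains exactly the $k$ nodes of that ladder with smallest row index $i$). This is always the Young diagram of an $e$-regular partition. Mullineux map. The rim of $\lambda$ is the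 set of nodes $(i,j)\in[\lambda]$ with $(i+1,j+1)\notin[\lambda]$. For $\lambda$ $e$-regular, the $e$-rim of $\lambda$ is the subset $\{(i_1,j_1),\dots,(i_r,j_r)\}$ of the rim constructed as follows. If $\lambda=\varnothing$, put $r=0$. Otherwise $(i_1,j_1)=(1,\lambda_1)$. For $k>1$ with $e\nmid k-1$, $(i_k,j_k)$ is the next node along the rim (from top right to bottom left) after $(i_{k-1},j_{k-1})$, i.e. $(i_{k-1}+1,j_{k-1})$ if this node lies in $[\lambda]$, and $(i_{k-1},j_{k-1}-1)$ otherwise. For $k>1$ with $e\mid k-1$, $(i_k,j_k)=(i_{k-1}+1,\lambda_{i_{k-1}+1})$. Continue until a node $(i_k,j_k)$ is reached with $i_k=l(\lambda)$ and either $j_k=1$ or $e\mid k$; then set $r=k$ and stop. The integer $r$ is the $e$-rim length of $\lambda$, and $I\lambda$ is the partition obtained by removing the $e$-rim from $[\lambda]$ (it is $e$-regular). The Mullineux map $M$ from $e$-regular partitions to $e$-regular partitions is defined recursively: $M\varnothing=\varnothing$; if $\lambda\neq\varnothing$ has $e$-rim length $r$, let $m=r-l(\lambda)$ if $e\mid r$ and $m=r-l(\lambda)+1$ if $e\nmid r$; then $M\lambda$ is the unique $e$-regular partition $\mu$ with $e$-rim length $r$, $l(\mu)=m$ and $I\mu=MI\lambda$ (such a $\mu$ is known to exist and be unique). Hooks. For $(i,j)\in[\lambda]$, the hook $H_{ij}(\lambda)$ is the set of nodes of $[\lambda]$ directly to the right of or directly below $(i,j)$, including $(i,j)$. Put $a_{ij}(\lambda)=\lambda_i-j$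 (arm length), $l_{ij}(\lambda)=(T\lambda)_j-i$ (leg length), $h_{ij}(\lambda)=a_{ij}(\lambda)+l_{ij}(\lambda)+1$ (hook length). If $e\mid h_{ij}(\lambda)$, the hook $H_{ij}(\lambda)$ is shallow if $a_{ij}(\lambda)\geq(e-1)l_{ij}(\lambda)$, and steep if $l_{ij}(\lambda)\geq(e-1)a_{ij}(\lambda)$. *)

theory Defs
  imports Main
begin

section \<open>Partitions\<close>

text \<open>
  A partition is a function whose value at \<open>i \<ge> 1\<close> is the part \<open>\<lambda>\<^sub>i\<close>.  The value at the
  meaningless index \<open>0\<close> is pinned to \<open>0\<close>, so that equality of partitions is equality of functions.
  For weakly decreasing sequences of naturals, finite sum is the same as finite support.
\<close>

type_synonym parts = "nat \<Rightarrow> nat"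

definition is_partition :: "parts \<Rightarrow> bool" where
  "is_partition lam \<longleftrightarrow>
     lam 0 = 0 \<and> (\<forall>i\<ge>1. lam (i + 1) \<le> lam i) \<and> finite {i. i \<ge> 1 \<and> lam i \<noteq> 0}"

definition empty_partition :: parts where
  "empty_partition = (\<lambda>_. 0)"

definition young :: "parts \<Rightarrow> (nat \<times> nat) set" where
  "young lam = {(i, j). i \<ge> 1 \<and> j \<ge> 1 \<and> j \<le> lam i}"

definition num_parts :: "parts \<Rightarrow> nat" where
  "num_parts lam = card {i. i \<ge> 1 \<and> lam i \<noteq> 0}"

text \<open>Row lengths of a set of nodes; by \<open>of_diagram_young\<close> below this inverts \<^const>\<open>young\<close>.\<close>

definition of_diagram :: "(nat \<times> nat) set \<Rightarrow> parts" where
  "of_diagram D = (\<lambda>i. card {j. (i, j) \<in> D})"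

definition e_regular :: "nat \<Rightarrow> parts \<Rightarrow> bool" where
  "e_regular e lam \<longleftrightarrow>
     is_partition lam \<and> \<not> (\<exists>i\<ge>1. lam i = lam (i + e - 1) \<and> lam (i + e - 1) > 0)"

definition conjugate :: "parts \<Rightarrow> parts" where
  "conjugate lam = (\<lambda>i. if i = 0 then 0 else card {j. j \<ge> 1 \<and> lam j \<ge> i})"


section \<open>Regularisation\<close>

definition ladder :: "nat \<Rightarrow> nat \<Rightarrow> (nat \<times> nat) set" where
  "ladder e l = {(i, j). i \<ge> 1 \<and> j \<ge> 1 \<and> i + (e - 1) * (j - 1) = l}"

text \<open>
  A ladder has at most one node in each row, so the \<open>k\<close> highest nodes of a ladder are those
  nodes \<open>(i, j)\<close> for which at most \<open>k\<close> nodes of the ladder lie in rows \<open>\<le> i\<close>.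
\<close>

definition top_of_ladder :: "nat \<Rightarrow> nat \<Rightarrow> nat \<Rightarrow> (nat \<times> nat) set" where
  "top_of_ladder e l k =
     {(i, j) \<in> ladder e l. card {(i', j') \<in> ladder e l. i' \<le> i} \<le> k}"

definition regularisation :: "nat \<Rightarrow> parts \<Rightarrow> parts" where
  "regularisation e lam =
     of_diagram (\<Union>l\<in>{1..}. top_of_ladder e l (card (young lam \<inter> ladder e l)))"


section \<open>The rim and the \<open>e\<close>-rim\<close>

definition rim :: "parts \<Rightarrow> (nat \<times> nat) set" where
  "rim lam = {(i, j) \<in> young lam. (i + 1, j + 1) \<notin> young lam}"

text \<open>
  \<open>erim_node e lam k\<close> is the node \<open>(i\<^sub>k, j\<^sub>k)\<close> for \<open>k \<ge> 1\<close>; the value at \<open>k = 0\<close> is a dummy, and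
  only the values up to \<open>k = erim_length e lam\<close> are meaningful.
\<close>

fun erim_node :: "nat \<Rightarrow> parts \<Rightarrow> nat \<Rightarrow> nat \<times> nat" where
  "erim_node e lam 0 = (0, 0)"
| "erim_node e lam (Suc k) =
     (if k = 0 then (1, lam 1)
      else (case erim_node e lam k of (i, j) \<Rightarrow>
        if e dvd k then (i + 1, lam (i + 1))
        else if (i + 1, j) \<in> young lam then (i + 1, j)
        else (i, j - 1)))"

definition erim_stop :: "nat \<Rightarrow> parts \<Rightarrow> nat \<Rightarrow> bool" where
  "erim_stop e lam k \<longleftrightarrow>
     (case erim_node e lam k of (i, j) \<Rightarrow> i = num_parts lam \<and> (j = 1 \<or> e dvd k))"

definition erim_length :: "nat \<Rightarrow> parts \<Rightarrow> nat" where
  "erim_length e lam =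
     (if lam = empty_partition then 0 else (LEAST k. k \<ge> 1 \<and> erim_stop e lam k))"

definition erim :: "nat \<Rightarrow> parts \<Rightarrow> (nat \<times> nat) set" where
  "erim e lam = erim_node e lam ` {1..erim_length e lam}"

definition remove_erim :: "nat \<Rightarrow> parts \<Rightarrow> parts" where
  "remove_erim e lam = of_diagram (young lam - erim e lam)"


section \<open>Well-foundedness of removing the \<open>e\<close>-rim\<close>

lemma of_diagram_young:
  assumes "is_partition lam"
  shows "of_diagram (young lam) = lam"
proof
  fix i
  show "of_diagram (young lam) i = lam i"
  proof (cases "i = 0")
    case True
    then show ?thesis using assms by (simp add: of_diagram_def young_def is_partition_def)
  next
    case False
    then have "{j. (i, j) \<in> young lam} = {1..lam i}" by (auto simp: young_def)
    then show ?thesis by (simp add: of_diagram_def)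
  qed
qed

lemma finite_young:
  assumes "is_partition lam"
  shows "finite (young lam)"
proof -
  have "young lam = (SIGMA i:{i. i \<ge> 1 \<and> lam i \<noteq> 0}. {1..lam i})"
    by (auto simp: young_def)
  then show ?thesis using assms by (simp add: is_partition_def)
qed

lemma partition_antimono:
  assumes "is_partition lam" "1 \<le> i" "i \<le> j"
  shows "lam j \<le> lam i"
  using assms(3)
proof (induction j rule: dec_induct)
  case (step n)
  then have "lam (n + 1) \<le> lam n" using assms by (auto simp: is_partition_def)
  then show ?case using step by simp
qed simp

lemma le_num_parts_iff:
  assumes "is_partition lam" "i \<ge> 1"
  shows "i \<le> num_parts lam \<longleftrightarrow> lam i \<noteq> 0"
proof
  let ?S = "{i. i \<ge> 1 \<and> lam i \<noteq> 0}"
  have fin: "finite ?S" using assms by (simp add: is_partition_def)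
  {
    assume "lam i \<noteq> 0"
    then have "{1..i} \<subseteq> ?S" using partition_antimono[OF assms(1)] by fastforce
    from card_mono[OF fin this] show "i \<le> num_parts lam" by (simp add: num_parts_def)
  next
    assume le: "i \<le> num_parts lam"
    show "lam i \<noteq> 0"
    proof
      assume 0: "lam i = 0"
      have "?S \<subseteq> {1..<i}"
      proof
        fix k assume k: "k \<in> ?S"
        then have "\<not> i \<le> k" using partition_antimono[OF assms(1) assms(2), of k] 0 by auto
        then show "k \<in> {1..<i}" using k by auto
      qed
      from card_mono[OF _ this] have "num_parts lam \<le> i - 1" by (simp add: num_parts_def)
      then show False using le assms(2) by simp
    qed
  }
qed

lemma partition_1_pos:
  assumes "is_partition lam" "lam \<noteq> empty_partition"
  shows "lam 1 > 0"
proof (rule ccontr)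
  assume "\<not> lam 1 > 0"
  then have "lam i = 0" for i
    using partition_antimono[OF assms(1), of 1 i] assms(1)
    by (cases "i = 0") (auto simp: is_partition_def)
  then show False using assms(2) by (auto simp: empty_partition_def)
qed

lemma erim_node_in_rim:
  assumes lam: "is_partition lam" "lam \<noteq> empty_partition"
    and "k \<ge> 1" "\<forall>k'. 1 \<le> k' \<and> k' < k \<longrightarrow> \<not> erim_stop e lam k'"
    and "erim_node e lam k = (i, j)"
  shows "(i, j) \<in> rim lam \<and> k + j \<le> i + lam 1"
  using assms(3-)
proof (induction k arbitrary: i j rule: nat_induct_at_least)
  case base
  then show ?case
    using partition_1_pos[OF lam] partition_antimono[OF lam(1), of 1 2]
    by (auto simp: rim_def young_def numeral_2_eq_2)
next
  case (Suc k)
  obtain a b where ab: "erim_node e lam k = (a, b)" by fastforce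
  have IH: "(a, b) \<in> rim lam" "k + b \<le> a + lam 1" using Suc ab by auto
  have a: "a \<ge> 1" "b \<ge> 1" "b \<le> lam a" and next_le: "lam (a + 1) \<le> b"
    using IH by (auto simp: rim_def young_def)
  have nn: "lam (a + 2) \<le> lam (a + 1)" using partition_antimono[OF lam(1)] by simp
  have "\<not> erim_stop e lam k" using Suc by auto
  then have ns: "\<not> (a = num_parts lam \<and> (b = 1 \<or> e dvd k))" using ab by (simp add: erim_stop_def)
  have "a \<le> num_parts lam" using le_num_parts_iff[OF lam(1) a(1)] a by simp
  then have lt: "lam (a + 1) \<ge> 1" if "b = 1 \<or> e dvd k"
    using le_num_parts_iff[OF lam(1), of "a + 1"] that ns by auto
  have k: "k \<noteq> 0" using Suc by simp
  consider (jump) "e dvd k" "i = a + 1" "j = lam (a + 1)"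
    | (down) "\<not> e dvd k" "b \<le> lam (a + 1)" "i = a + 1" "j = b"
    | (left) "\<not> e dvd k" "lam (a + 1) < b" "i = a" "j = b - 1"
    using Suc.prems(2) k ab a by (auto simp: young_def split: if_splits)
  then show ?case
  proof cases
    case jump
    then show ?thesis using lt nn next_le IH(2) by (auto simp: rim_def young_def)
  next
    case down
    then show ?thesis using nn next_le IH(2) a by (auto simp: rim_def young_def)
  next
    case left
    then have "b \<noteq> 1" using lt by auto
    then show ?thesis using left IH(2) a by (auto simp: rim_def young_def)
  qed
qed

lemma erim_stop_exists:
  assumes lam: "is_partition lam" "lam \<noteq> empty_partition"
  shows "\<exists>k\<ge>1. erim_stop e lam k"
proof (rule ccontr)
  assume no: "\<not> ?thesis"
  define k where "k = num_parts lam + lam 1 + 1"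
  obtain i j where ij: "erim_node e lam k = (i, j)" by fastforce
  have r: "(i, j) \<in> rim lam \<and> k + j \<le> i + lam 1"
    by (rule erim_node_in_rim[OF lam _ _ ij]) (use no in \<open>auto simp: k_def\<close>)
  then have "i \<le> num_parts lam"
    using le_num_parts_iff[OF lam(1), of i] by (auto simp: rim_def young_def)
  then show False using r by (simp add: k_def)
qed

lemma erim_length_stop:
  assumes "is_partition lam" "lam \<noteq> empty_partition"
  shows "erim_length e lam \<ge> 1 \<and> erim_stop e lam (erim_length e lam)"
  using LeastI_ex[OF erim_stop_exists[OF assms, of e, unfolded Bex_def]] assms(2)
  by (simp add: erim_length_def)

lemma erim_subset_rim:
  assumes "is_partition lam"
  shows "erim e lam \<subseteq> rim lam"
proof (cases "lam = empty_partition")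
  case True
  then show ?thesis by (simp add: erim_def erim_length_def)
next
  case False
  show ?thesis
  proof
    fix x assume "x \<in> erim e lam"
    then obtain k where k: "1 \<le> k" "k \<le> erim_length e lam" "x = erim_node e lam k"
      by (auto simp: erim_def)
    have "\<forall>k'. 1 \<le> k' \<and> k' < k \<longrightarrow> \<not> erim_stop e lam k'"
      using k(2) False Least_le[of "\<lambda>k. 1 \<le> k \<and> erim_stop e lam k"]
      by (fastforce simp: erim_length_def)
    then show "x \<in> rim lam"
      using erim_node_in_rim[OF assms False k(1), of e] k(3) by (metis surj_pair)
  qed
qed

lemma card_young_remove_erim:
  assumes lam: "is_partition lam" "lam \<noteq> empty_partition"
  shows "card (young (remove_erim e lam)) < card (young lam)"
proof (rule psubset_card_mono[OF finite_young[OF lam(1)]])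
  have row: "{j. (i, j) \<in> young lam - erim e lam} \<subseteq> {1..lam i}" for i
    by (auto simp: young_def)
  have le: "remove_erim e lam i \<le> lam i" for i
    using card_mono[OF _ row] by (simp add: remove_erim_def of_diagram_def)
  then have sub: "young (remove_erim e lam) \<subseteq> young lam"
    by (auto simp: young_def intro: order_trans)
  have "(1, lam 1) \<in> erim e lam"
    using erim_length_stop[OF lam, of e] by (force simp: erim_def intro: image_eqI[of _ _ 1])
  then have "{j. (1, j) \<in> young lam - erim e lam} \<subseteq> {1..<lam 1}"
    by (auto simp: young_def order.order_iff_strict)
  from card_mono[OF _ this] have "remove_erim e lam 1 \<le> lam 1 - 1"
    by (simp add: remove_erim_def of_diagram_def)
  then have "(1, lam 1) \<notin> young (remove_erim e lam)" "(1, lam 1) \<in> young lam"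
    using partition_1_pos[OF lam] by (auto simp: young_def)
  with sub show "young (remove_erim e lam) \<subset> young lam" by blast
qed


section \<open>The Mullineux map\<close>

text \<open>
  The natural subtraction does not truncate: the \<open>e\<close>-rim meets every non-empty row.
  The map is only meaningful on \<open>e\<close>-regular partitions; other arguments get a dummy value.
\<close>

definition mullineux_num_parts :: "nat \<Rightarrow> parts \<Rightarrow> nat" where
  "mullineux_num_parts e lam =
     (if e dvd erim_length e lam then erim_length e lam - num_parts lam
      else erim_length e lam - num_parts lam + 1)"

function mullineux :: "nat \<Rightarrow> parts \<Rightarrow> parts" where
  "mullineux e lam =
     (if e_regular e lam \<and> lam \<noteq> empty_partition
      then (THE mu. e_regular e mu
              \<and> erim_length e mu = erim_length e lam
              \<and> num_parts mu = mullineux_num_parts e lam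
              \<and> remove_erim e mu = mullineux e (remove_erim e lam))
      else empty_partition)"
  by auto
termination
  by (relation "measure (\<lambda>(e, lam). card (young lam))")
    (auto simp: e_regular_def intro: card_young_remove_erim)

declare mullineux.simps [simp del]


section \<open>Hooks\<close>

definition arm :: "parts \<Rightarrow> nat \<Rightarrow> nat \<Rightarrow> nat" where
  "arm lam i j = lam i - j"

definition leg :: "parts \<Rightarrow> nat \<Rightarrow> nat \<Rightarrow> nat" where
  "leg lam i j = conjugate lam j - i"

definition hook_length :: "parts \<Rightarrow> nat \<Rightarrow> nat \<Rightarrow> nat" where
  "hook_length lam i j = arm lam i j + leg lam i j + 1"

definition shallow :: "nat \<Rightarrow> parts \<Rightarrow> nat \<Rightarrow> nat \<Rightarrow> bool" where
  "shallow e lam i j \<longleftrightarrow> arm lam i j \<ge> (e - 1) * leg lam i j"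

definition steep :: "nat \<Rightarrow> parts \<Rightarrow> nat \<Rightarrow> nat \<Rightarrow> bool" where
  "steep e lam i j \<longleftrightarrow> leg lam i j \<ge> (e - 1) * arm lam i j"

end

theory Submission
  imports Defs
begin

text \<open>
  Let \<open>h\<^sub>k\<close> be the columns of \<open>\<lambda>\<close>, numbered from \<open>0\<close>.  Regularisation sorts the numbers
  \<open>h\<^sub>k + (e - 1) k\<close>, and the columns of the Mullineux image of an \<open>e\<close>-regular partition count the
  nodes lost by its columns in successive peelings, where a column, scanned from the right, loses
  a node unless a running sum is divisible by \<open>e\<close>.  The first peeling of \<open>G\<lambda>\<close> can be performed on
  \<open>\<lambda>\<close> itself: a greedily chosen chain of columns is kept and every other column loses a node, which
  gives a partition \<open>\<nu>\<close> such that \<open>G\<nu>\<close> is the peeled \<open>G\<lambda>\<close>.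

  The columns of \<open>GT\<lambda>\<close> arise by sorting the numbers \<open>\<lambda>\<^sub>i + (e - 1) (i - 1)\<close>.  Comparing them with the
  corresponding numbers of \<open>\<nu>\<close> shows by induction that the partial sums of the columns of \<open>MG\<lambda>\<close> are
  at most those of \<open>GT\<lambda>\<close>, with equality if and only if the chain is tight (an explicit
  equation holds at each of its columns) and equality holds for \<open>\<nu>\<close>.  The condition on hooks obeys
  the same recursion: a chain which is not tight exhibits a bad hook, and a tight chain removes
  \<open>e - 1\<close> nodes from some of the top rows and deletes the next one, which preserves bad hooks.
\<close>

section \<open>Restricted sequences\<close>

text \<open>A recursion of equalities alone would not settle the only-if direction: discrepancies of
  different peelings might cancel. The inequality of partial sums at every stage excludes this,
  since equality for the whole partition then forces equality at each stage.

  One integer has two meanings. Put w = \<open>lam 1\<close>. The chain starts at (e - 1) w, the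
  value of the first empty column, and gains 1 modulo e at each step, so its a-th value is congruent
  to a - w; the value of column k is congruent to h_k - k. Being a candidate after a steps is
  therefore a congruence on k + 1 + a + (e - 1) h_k - w. The same integer is the margin between k +
  1 + (e - 1) h_k, a position on the side of the rows, and w - a, a position vacated when the first
  row shrinks from w to the number of lost nodes. So congruence supports inequality: moving left,
  the integer can only fall by one, and at 0 a chain value must appear that stops the fall.

  For e = 2 every chain is tight and every hook of even length is shallow or steep; the study of
  tight chains assumes e >= 3.\<close>

text \<open>Applied to the columns of an \<open>e\<close>-regular partition, \<open>peel\<close> followed by deletion of the first
  column removes the \<open>e\<close>-rim.\<close>

fun tok :: "nat \<Rightarrow> nat list \<Rightarrow> nat" where
  "tok e [] = 0"
| "tok e (a # xs) = tok e xs + (if e dvd a + tok e xs then 0 else 1)"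

fun peel :: "nat \<Rightarrow> nat list \<Rightarrow> nat list" where
  "peel e [] = []"
| "peel e (a # xs) = (a - (if e dvd a + tok e xs then 0 else 1)) # peel e xs"

fun hd0 :: "nat list \<Rightarrow> nat" where
  "hd0 [] = 0"
| "hd0 (a # xs) = a"

fun restricted :: "nat \<Rightarrow> nat list \<Rightarrow> bool" where
  "restricted e [] \<longleftrightarrow> True"
| "restricted e (a # xs) \<longleftrightarrow> hd0 xs \<le> a \<and> a < hd0 xs + e \<and> restricted e xs"

lemma length_peel [simp]: "length (peel e xs) = length xs"
  by (induction xs) auto

lemma restricted_hd0_zero:
  assumes "restricted e xs" "hd0 xs = 0"
  shows "xs = replicate (length xs) 0"
  using assms
proof (induction xs)
  case (Cons a xs)
  then show ?case by (cases xs) auto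
qed simp

lemma tok_replicate_0 [simp]: "tok e (replicate n 0) = 0"
  by (induction n) auto

lemma peel_replicate_0 [simp]: "peel e (replicate n 0) = replicate n 0"
  by (induction n) auto

lemma tok_append_zeros [simp]: "tok e (xs @ replicate n 0) = tok e xs"
  by (induction xs) auto

lemma peel_append_zeros [simp]: "peel e (xs @ replicate n 0) = peel e xs @ replicate n 0"
  by (induction xs) auto

text \<open>A column of height 0 has only zeros to its right, so its running sum is 0 and it keeps
  its node. Hence the subtraction in \<open>peel\<close> never truncates.\<close>

lemma restricted_eps_le:
  assumes "restricted e (a # xs)" "\<not> e dvd a + tok e xs"
  shows "1 \<le> a"
proof (rule ccontr)
  assume "\<not> 1 \<le> a"
  then have "a = 0" by simp
  moreover have "hd0 xs = 0" "restricted e xs" using assms \<open>a = 0\<close> by auto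
  then have "xs = replicate (length xs) 0" by (rule restricted_hd0_zero[rotated])
  then have "tok e xs = 0" by (metis tok_replicate_0)
  ultimately show False using assms by simp
qed

text \<open>Only the extreme differences are critical. For equal heights, a right column that keeps
  its node leaves the running sum unchanged, so the left one keeps its node too; for difference e -
  1, a right column that loses a node makes the sums differ by exactly e, so the left one loses a
  node too.\<close>

lemma restricted_peel:
  assumes "e \<ge> 2" "restricted e xs"
  shows "restricted e (peel e xs)"
  using assms(2)
proof (induction xs)
  case (Cons a xs)
  then have IH: "restricted e (peel e xs)" by simp
  show ?case
  proof (cases xs)
    case Nil
    then show ?thesis using Cons.prems assms(1) by auto
  next
    case (Cons b ys)
    have ba: "b \<le> a" "a < b + e" using Cons.prems Cons by auto
    have b: "restricted e (b # ys)" using Cons.prems Cons by auto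
    let ?ea = "if e dvd a + tok e xs then 0 else 1 :: nat"
    let ?eb = "if e dvd b + tok e ys then 0 else 1 :: nat"
    have tx: "tok e xs = tok e ys + ?eb" by (simp add: Cons)
    have eb: "?eb \<le> b" using restricted_eps_le[OF b] by auto
    have 1: "b - ?eb \<le> a - ?ea"
    proof (cases "a = b")
      case True
      then show ?thesis using tx by auto
    next
      case False
      then show ?thesis using ba by auto
    qed
    have 2: "a - ?ea < b - ?eb + e"
    proof (cases "a + 1 = b + e")
      case True
      show ?thesis
      proof (cases "e dvd b + tok e ys")
        case True
        then show ?thesis using ba by auto
      next
        case False
        then have "a + tok e xs = (b + tok e ys) + e" using \<open>a + 1 = b + e\<close> tx by simp
        then have "\<not> e dvd a + tok e xs" using False by (metis dvd_add_left_iff dvd_refl)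
        then show ?thesis using ba eb False by simp
      qed
    next
      case False
      then have "a + 1 < b + e" using ba by linarith
      then have "a - x < b - y + e" if "y \<le> b" "y \<le> 1" for x y using that by linarith
      from this[OF eb] show ?thesis by auto
    qed
    have "hd0 (peel e xs) = b - ?eb" by (simp add: Cons)
    then show ?thesis using 1 2 IH by simp
  qed
qed simp

lemma sum_list_peel:
  assumes "restricted e xs"
  shows "sum_list (peel e xs) + tok e xs = sum_list xs"
  using assms
proof (induction xs)
  case (Cons a xs)
  then show ?case using restricted_eps_le[OF Cons.prems] by auto
qed simp

text \<open>The rightmost nonzero entry is below e and has running sum 0 to its right, so it always
  loses a node; this makes repeated peeling terminate.\<close>

lemma tok_pos:
  assumes "restricted e xs" "hd0 xs > 0"
  shows "tok e xs > 0"
  using assms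
proof (induction xs)
  case (Cons a xs)
  show ?case
  proof (cases "hd0 xs > 0")
    case True
    then show ?thesis using Cons by simp
  next
    case False
    then have "xs = replicate (length xs) 0" using Cons.prems restricted_hd0_zero by auto
    then have "tok e xs = 0" by (metis tok_replicate_0)
    moreover have "a < e" "a > 0" using Cons.prems False by auto
    ultimately show ?thesis by (simp add: nat_dvd_not_less)
  qed
qed simp

text \<open>The running sums before and after peeling differ by a number in 0, ..., e - 1. A kept
  column cannot push the difference below 0, nor a losing column push it above e - 1, because at the
  two extremes the two divisibility tests agree.\<close>

lemma tok_peel:
  assumes "e \<ge> 2" "restricted e xs"
  shows "tok e (peel e xs) \<le> tok e xs \<and> tok e xs < tok e (peel e xs) + e"
  using assms(2)
proof (induction xs)
  case (Cons a xs)
  then have IH: "tok e (peel e xs) \<le> tok e xs" "tok e xs < tok e (peel e xs) + e" by auto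
  let ?u = "tok e xs" and ?u' = "tok e (peel e xs)"
  show ?case
  proof (cases "e dvd a + ?u")
    case True
    show ?thesis
    proof (cases "?u = ?u'")
      case True
      then show ?thesis using \<open>e dvd a + ?u\<close> assms by simp
    next
      case False
      have "\<not> e dvd a + ?u'"
      proof
        assume "e dvd a + ?u'"
        then have "e dvd (a + ?u) - (a + ?u')" using True by (meson dvd_diff_nat)
        then have "e dvd ?u - ?u'" by simp
        moreover have "?u - ?u' > 0" "?u - ?u' < e" using False IH by auto
        ultimately show False by (simp add: nat_dvd_not_less)
      qed
      then show ?thesis using True IH False by auto
    qed
  next
    case False
    have a: "1 \<le> a" using restricted_eps_le[OF Cons.prems False] .
    show ?thesis
    proof (cases "?u + 1 = ?u' + e")
      case True
      then have "a + ?u = (a - 1 + ?u') + e" using a by simp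
      then have "\<not> e dvd (a - 1 + ?u')" using False by (metis dvd_add_left_iff dvd_refl)
      then show ?thesis using False IH True by simp
    next
      case F: False
      then show ?thesis using False IH by auto
    qed
  qed
qed (use assms in simp)

text \<open>The sum tested at the first column is the peeled height plus the total number of losses,
  so the data after peeling determine whether that column lost a node.\<close>

lemma peel_inj:
  assumes "restricted e xs" "restricted e ys" "length xs = length ys"
    and "tok e xs = tok e ys" "peel e xs = peel e ys"
  shows "xs = ys"
  using assms
proof (induction xs ys rule: list_induct2')
  case (4 a xs b ys)
  let ?ea = "if e dvd a + tok e xs then 0 else 1 :: nat"
  let ?eb = "if e dvd b + tok e ys then 0 else 1 :: nat"
  have ea: "?ea \<le> a" and eb: "?eb \<le> b"
    using restricted_eps_le[OF 4(2)] restricted_eps_le[OF 4(3)] by auto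
  have eq: "a - ?ea = b - ?eb" using 4(6) by simp
  have t: "tok e xs + ?ea = tok e ys + ?eb" using 4(5) by simp
  have "a + tok e xs = b + tok e ys"
  proof -
    have "a + tok e xs = (a - ?ea) + (tok e xs + ?ea)" using ea by linarith
    also have "\<dots> = (b - ?eb) + (tok e ys + ?eb)" using eq t by presburger
    also have "\<dots> = b + tok e ys" using eb by linarith
    finally show ?thesis .
  qed
  then have "?ea = ?eb" by presburger
  then have "tok e xs = tok e ys" "a = b" using t eq ea eb by linarith+
  then show ?case using 4 by simp
qed auto

definition tokseq :: "nat \<Rightarrow> nat list \<Rightarrow> nat \<Rightarrow> nat list" where
  "tokseq e xs N = map (\<lambda>t. tok e ((peel e ^^ t) xs)) [0..<N]"

lemma tokseq_Suc: "tokseq e xs (Suc N) = tok e xs # tokseq e (peel e xs) N"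
  unfolding tokseq_def
  by (simp add: map_upt_Suc funpow_swap1 del: upt_Suc)

text \<open>The incidence matrix of the steps of \<^const>\<open>peel\<close> obeys a rule that is symmetric in
  rows and columns, so removing its first row and removing its first column commute.\<close>

lemma tokseq_Cons:
  assumes "e \<ge> 2" "restricted e (a # xs)" "(peel e ^^ N) (a # xs) = replicate (Suc (length xs)) 0"
  shows "tok e (tokseq e (a # xs) N) = a \<and> peel e (tokseq e (a # xs) N) = tokseq e xs N"
  using assms(2,3)
proof (induction N arbitrary: a xs)
  case 0
  then show ?case by (simp add: tokseq_def)
next
  case (Suc N)
  let ?ea = "if e dvd a + tok e xs then 0 else 1 :: nat"
  have ea: "?ea \<le> a" using restricted_eps_le[OF Suc(2)] by auto
  have p: "peel e (a # xs) = (a - ?ea) # peel e xs" by simp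
  have r: "restricted e ((a - ?ea) # peel e xs)" using restricted_peel[OF assms(1) Suc(2)] p by simp
  have z: "(peel e ^^ N) ((a - ?ea) # peel e xs) = replicate (Suc (length (peel e xs))) 0"
    using Suc(3) p by (simp add: funpow_swap1)
  note IH = Suc.IH[OF r z]
  have s: "tokseq e (a # xs) (Suc N) = (tok e xs + ?ea) # tokseq e ((a - ?ea) # peel e xs) N"
    unfolding tokseq_Suc p by simp
  \<comment> \<open>The symmetry: one sum decides the corner entry of the matrix, whether it is read
    along the columns of the partition or along the list of losses.\<close>
  have "tok e xs + ?ea + (a - ?ea) = a + tok e xs" using ea by linarith
  then have d: "e dvd tok e xs + ?ea + (a - ?ea) \<longleftrightarrow> e dvd a + tok e xs" by presburger
  show ?case
    unfolding s tok.simps peel.simps tokseq_Suc[of e xs] using IH d ea by auto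
qed

lemma funpow_peel_zero:
  assumes "e \<ge> 2" "restricted e xs" "sum_list xs \<le> N"
  shows "(peel e ^^ N) xs = replicate (length xs) 0"
  using assms(2,3)
proof (induction N arbitrary: xs)
  case 0
  then have "hd0 xs = 0" by (cases xs) auto
  then show ?case using restricted_hd0_zero[OF 0(1)] by simp
next
  case (Suc N)
  show ?case
  proof (cases "hd0 xs = 0")
    case True
    then have "xs = replicate (length xs) 0" using Suc restricted_hd0_zero by blast
    then have "(peel e ^^ Suc N) (replicate (length xs) 0) = (replicate (length xs) 0 :: nat list) \<Longrightarrow> ?thesis"
      by metis
    moreover have "(peel e ^^ t) (replicate n 0) = (replicate n 0 :: nat list)" for n t
      by (induction t) auto
    ultimately show ?thesis by blast
  next
    case False
    then have "sum_list (peel e xs) \<le> N"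
      using sum_list_peel[OF Suc(2)] tok_pos[OF Suc(2)] Suc(3) by linarith
    then show ?thesis
      using Suc.IH[of "peel e xs"] restricted_peel[OF assms(1) Suc(2)] by (simp add: funpow_swap1)
  qed
qed

lemma restricted_tokseq:
  assumes "e \<ge> 2" "restricted e xs" "(peel e ^^ N) xs = replicate (length xs) 0"
  shows "restricted e (tokseq e xs N)"
  using assms(2,3)
proof (induction N arbitrary: xs)
  case 0
  then show ?case by (simp add: tokseq_def)
next
  case (Suc N)
  have "restricted e (tokseq e (peel e xs) N)"
    using Suc restricted_peel[OF assms(1)] by (simp add: funpow_swap1)
  moreover have "hd0 (tokseq e (peel e xs) N) = tok e (peel e xs)"
  proof (cases N)
    case 0
    then have "peel e xs = replicate (length xs) 0" using Suc by simp
    then show ?thesis using 0 by (simp add: tokseq_def)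
  qed (simp add: tokseq_Suc)
  ultimately show ?case using tok_peel[OF assms(1) Suc(2)] by (simp add: tokseq_Suc)
qed

section \<open>Columns of a partition\<close>

lemma partition_finite: "is_partition lam \<Longrightarrow> finite {i. i \<ge> 1 \<and> lam i \<noteq> 0}"
  by (simp add: is_partition_def)

lemma conjugate_ge_iff:
  assumes "is_partition lam" "i \<ge> 1" "j \<ge> 1"
  shows "i \<le> conjugate lam j \<longleftrightarrow> j \<le> lam i"
proof -
  let ?S = "{i. i \<ge> 1 \<and> lam i \<ge> j}"
  have fin: "finite ?S"
    by (rule finite_subset[OF _ partition_finite[OF assms(1)]]) (use assms(3) in auto)
  have c: "conjugate lam j = card ?S" using assms by (simp add: conjugate_def)
  show ?thesis
  proof
    assume "j \<le> lam i"
    have "{1..i} \<subseteq> ?S"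
    proof
      fix k assume "k \<in> {1..i}"
      then show "k \<in> ?S" using partition_antimono[OF assms(1), of k i] \<open>j \<le> lam i\<close> by simp
    qed
    from card_mono[OF fin this] show "i \<le> conjugate lam j" by (simp add: c)
  next
    assume le: "i \<le> conjugate lam j"
    show "j \<le> lam i"
    proof (rule ccontr)
      assume n: "\<not> j \<le> lam i"
      have "?S \<subseteq> {1..<i}"
      proof
        fix k assume k: "k \<in> ?S"
        then have "\<not> i \<le> k" using partition_antimono[OF assms(1,2), of k] n by auto
        then show "k \<in> {1..<i}" using k by auto
      qed
      from card_mono[OF _ this] have "conjugate lam j \<le> i - 1" by (simp add: c)
      then show False using le assms(2) by simp
    qed
  qed
qed

lemma conjugate_antimono:
  assumes "is_partition lam" "1 \<le> j" "j \<le> k"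
  shows "conjugate lam k \<le> conjugate lam j"
proof (cases "conjugate lam k = 0")
  case False
  then have "k \<le> lam (conjugate lam k)"
    using conjugate_ge_iff[OF assms(1), of "conjugate lam k" k] assms by simp
  then show ?thesis
    using conjugate_ge_iff[OF assms(1), of "conjugate lam k" j] assms False by simp
qed simp

lemma conjugate_eq_0_iff:
  assumes "is_partition lam" "j \<ge> 1"
  shows "conjugate lam j = 0 \<longleftrightarrow> lam 1 < j"
  using conjugate_ge_iff[OF assms(1), of 1 j] assms(2) by auto

lemma num_parts_conjugate: "num_parts lam = conjugate lam 1"
proof -
  have "{i. i \<ge> 1 \<and> lam i \<noteq> 0} = {j. j \<ge> 1 \<and> lam j \<ge> 1}" by auto
  then show ?thesis by (simp add: num_parts_def conjugate_def)
qed

lemma is_partition_conjugate: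
  assumes "is_partition lam"
  shows "is_partition (conjugate lam)"
  unfolding is_partition_def
proof (intro conjI allI impI)
  show "conjugate lam 0 = 0" by (simp add: conjugate_def)
  show "conjugate lam (i + 1) \<le> conjugate lam i" if "i \<ge> 1" for i
    using conjugate_antimono[OF assms, of i "i + 1"] that by simp
  show "finite {i. i \<ge> 1 \<and> conjugate lam i \<noteq> 0}"
  proof (rule finite_subset)
    show "{i. i \<ge> 1 \<and> conjugate lam i \<noteq> 0} \<subseteq> {..lam 1}"
    proof
      fix i assume "i \<in> {i. i \<ge> 1 \<and> conjugate lam i \<noteq> 0}"
      then show "i \<in> {..lam 1}" using conjugate_eq_0_iff[OF assms, of i] by simp
    qed
  qed simp
qed

lemma partition_eqI:
  assumes "is_partition lam" "is_partition mu" "\<And>i j. i \<ge> 1 \<Longrightarrow> j \<ge> 1 \<Longrightarrow> j \<le> lam i \<longleftrightarrow> j \<le> mu i"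
  shows "lam = mu"
proof
  fix i
  show "lam i = mu i"
  proof (cases "i = 0")
    case True
    then show ?thesis using assms by (simp add: is_partition_def)
  next
    case False
    then have i: "i \<ge> 1" by simp
    show ?thesis
    proof (rule antisym)
      show "lam i \<le> mu i" using assms(3)[OF i, of "lam i"] by (cases "lam i = 0") auto
      show "mu i \<le> lam i" using assms(3)[OF i, of "mu i"] by (cases "mu i = 0") auto
    qed
  qed
qed

lemma conjugate_conjugate:
  assumes "is_partition lam"
  shows "conjugate (conjugate lam) = lam"
proof (rule partition_eqI)
  show "is_partition (conjugate (conjugate lam))" using assms by (simp add: is_partition_conjugate)
  show "(j \<le> conjugate (conjugate lam) i) = (j \<le> lam i)" if "i \<ge> 1" "j \<ge> 1" for i j
    using conjugate_ge_iff[OF is_partition_conjugate[OF assms], of j i]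
      conjugate_ge_iff[OF assms, of i j] that by simp
qed (use assms in simp)

lemma conjugate_inj:
  assumes "is_partition lam" "is_partition mu" "\<And>j. j \<ge> 1 \<Longrightarrow> conjugate lam j = conjugate mu j"
  shows "lam = mu"
proof -
  have "conjugate lam = conjugate mu"
  proof
    fix j show "conjugate lam j = conjugate mu j"
      using assms(3)[of j] by (cases "j = 0") (auto simp: conjugate_def)
  qed
  then show ?thesis using conjugate_conjugate assms(1,2) by metis
qed

definition cols :: "parts \<Rightarrow> nat \<Rightarrow> nat list" where
  "cols lam K = map (\<lambda>k. conjugate lam (Suc k)) [0..<K]"

definition of_cols :: "nat list \<Rightarrow> parts" where
  "of_cols xs = (\<lambda>i. if i = 0 then 0 else card {k. k < length xs \<and> i \<le> xs ! k})"

lemma length_cols [simp]: "length (cols lam K) = K"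
  by (simp add: cols_def)

lemma nth_cols [simp]: "k < K \<Longrightarrow> cols lam K ! k = conjugate lam (Suc k)"
  by (simp add: cols_def)

lemma hd0_conv_nth: "hd0 xs = (if xs = [] then 0 else xs ! 0)"
  by (cases xs) auto

lemma restricted_iff:
  "restricted e xs \<longleftrightarrow> (\<forall>k < length xs. hd0 (drop (Suc k) xs) \<le> xs ! k \<and> xs ! k < hd0 (drop (Suc k) xs) + e)"
proof (induction xs)
  case Nil
  show ?case by simp
next
  case (Cons a xs)
  have "(\<forall>k < length (a # xs). hd0 (drop (Suc k) (a # xs)) \<le> (a # xs) ! k \<and> (a # xs) ! k < hd0 (drop (Suc k) (a # xs)) + e)
    \<longleftrightarrow> (hd0 xs \<le> a \<and> a < hd0 xs + e) \<and> (\<forall>k < length xs. hd0 (drop (Suc k) xs) \<le> xs ! k \<and> xs ! k < hd0 (drop (Suc k) xs) + e)"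
    unfolding list.size add_Suc_right add_0_right All_less_Suc2 by simp
  then show ?case using Cons.IH by simp
qed

lemma hd0_drop: "hd0 (drop k xs) = (if k < length xs then xs ! k else 0)"
  by (simp add: hd0_conv_nth hd_drop_conv_nth)

lemma restricted_antimono:
  assumes "restricted e xs" "j \<le> k" "k < length xs"
  shows "xs ! k \<le> xs ! j"
  using assms(2,3)
proof (induction k rule: dec_induct)
  case (step n)
  have "hd0 (drop (Suc n) xs) \<le> xs ! n" using assms(1) step unfolding restricted_iff by simp
  then show ?case using step by (simp add: hd0_drop)
qed simp

lemma of_cols_ge_iff:
  assumes "restricted e xs" "i \<ge> 1"
  shows "Suc k \<le> of_cols xs i \<longleftrightarrow> k < length xs \<and> i \<le> xs ! k"
proof -
  let ?S = "{k. k < length xs \<and> i \<le> xs ! k}"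
  have c: "of_cols xs i = card ?S" using assms by (simp add: of_cols_def)
  show ?thesis
  proof
    assume k: "k < length xs \<and> i \<le> xs ! k"
    have "{..k} \<subseteq> ?S"
    proof
      fix j assume "j \<in> {..k}"
      then show "j \<in> ?S" using restricted_antimono[OF assms(1), of j k] k by auto
    qed
    from card_mono[OF _ this] show "Suc k \<le> of_cols xs i" by (simp add: c)
  next
    assume le: "Suc k \<le> of_cols xs i"
    show "k < length xs \<and> i \<le> xs ! k"
    proof (rule ccontr)
      assume n: "\<not> (k < length xs \<and> i \<le> xs ! k)"
      have "?S \<subseteq> {..<k}"
      proof
        fix j assume j: "j \<in> ?S"
        show "j \<in> {..<k}"
        proof (rule ccontr)
          assume "j \<notin> {..<k}"
          then have "k \<le> j" by simp
          then show False using n j restricted_antimono[OF assms(1), of k j] by auto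
        qed
      qed
      from card_mono[OF _ this] show False using le by (simp add: c)
    qed
  qed
qed

lemma is_partition_of_cols:
  assumes "restricted e xs"
  shows "is_partition (of_cols xs)"
  unfolding is_partition_def
proof (intro conjI allI impI)
  show "of_cols xs 0 = 0" by (simp add: of_cols_def)
  show "of_cols xs (i + 1) \<le> of_cols xs i" if "i \<ge> 1" for i
    using that unfolding of_cols_def by (auto intro!: card_mono)
  have "of_cols xs i = 0" if "i > hd0 xs" for i
  proof (rule ccontr)
    assume "of_cols xs i \<noteq> 0"
    then have "Suc 0 \<le> of_cols xs i" by simp
    then show False using of_cols_ge_iff[OF assms, of i 0] that by (auto simp: hd0_conv_nth)
  qed
  then show "finite {i. i \<ge> 1 \<and> of_cols xs i \<noteq> 0}"
    by (auto intro!: finite_subset[of _ "{..hd0 xs}"] simp: not_less[symmetric])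
qed

lemma conjugate_of_cols:
  assumes "restricted e xs"
  shows "conjugate (of_cols xs) (Suc k) = (if k < length xs then xs ! k else 0)"
proof -
  have "i \<le> conjugate (of_cols xs) (Suc k) \<longleftrightarrow> k < length xs \<and> i \<le> xs ! k" if "i \<ge> 1" for i
    using conjugate_ge_iff[OF is_partition_of_cols[OF assms] that, of "Suc k"]
      of_cols_ge_iff[OF assms that] by simp
  note iff = this
  let ?y = "if k < length xs then xs ! k else 0"
  show ?thesis
  proof (rule antisym)
    show "conjugate (of_cols xs) (Suc k) \<le> ?y"
      using iff[of "conjugate (of_cols xs) (Suc k)"] by (cases "conjugate (of_cols xs) (Suc k) = 0") auto
    show "?y \<le> conjugate (of_cols xs) (Suc k)"
      using iff[of ?y] by (cases "?y = 0") auto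
  qed
qed

text \<open>The part k occurs \<open>conjugate lam k - conjugate lam (Suc k)\<close> times, so
  regularity bounds the drop between neighbouring columns.\<close>

lemma e_regular_iff_conjugate:
  assumes "e \<ge> 2" "is_partition lam"
  shows "e_regular e lam \<longleftrightarrow> (\<forall>k\<ge>1. conjugate lam k < conjugate lam (Suc k) + e)"
proof
  assume r: "e_regular e lam"
  show "\<forall>k\<ge>1. conjugate lam k < conjugate lam (Suc k) + e"
  proof (intro allI impI, rule ccontr)
    fix k :: nat assume k: "k \<ge> 1" and n: "\<not> conjugate lam k < conjugate lam (Suc k) + e"
    define i where "i = conjugate lam (Suc k) + 1"
    have "i + e - 1 \<le> conjugate lam k" using n by (simp add: i_def)
    then have 1: "k \<le> lam (i + e - 1)"
      using conjugate_ge_iff[OF assms(2), of "i + e - 1" k] k assms(1) by (simp add: i_def)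
    have "\<not> Suc k \<le> lam i"
      using conjugate_ge_iff[OF assms(2), of i "Suc k"] by (simp add: i_def)
    moreover have "lam (i + e - 1) \<le> lam i"
      using partition_antimono[OF assms(2), of i "i + e - 1"] assms(1) by (simp add: i_def)
    ultimately have "lam i = lam (i + e - 1)" "lam (i + e - 1) > 0" using 1 k by auto
    moreover have "i \<ge> 1" by (simp add: i_def)
    ultimately show False using r unfolding e_regular_def by blast
  qed
next
  assume c: "\<forall>k\<ge>1. conjugate lam k < conjugate lam (Suc k) + e"
  show "e_regular e lam"
    unfolding e_regular_def
  proof (intro conjI notI)
    assume "\<exists>i\<ge>1. lam i = lam (i + e - 1) \<and> lam (i + e - 1) > 0"
    then obtain i where i: "i \<ge> 1" "lam i = lam (i + e - 1)" "lam (i + e - 1) > 0" by blast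
    let ?k = "lam i"
    have "i + e - 1 \<le> conjugate lam ?k"
      using conjugate_ge_iff[OF assms(2), of "i + e - 1" ?k] i assms(1) by simp
    moreover have "\<not> i \<le> conjugate lam (Suc ?k)"
      using conjugate_ge_iff[OF assms(2), of i "Suc ?k"] i by simp
    ultimately show False using c[rule_format, of ?k] i assms(1) by simp
  qed (use assms in simp)
qed

lemma restricted_cols:
  assumes "e \<ge> 2" "e_regular e lam" "lam 1 \<le> K"
  shows "restricted e (cols lam K)"
proof -
  have p: "is_partition lam" using assms by (simp add: e_regular_def)
  show ?thesis
    unfolding restricted_iff hd0_drop
  proof (intro allI impI)
    fix k assume k: "k < length (cols lam K)"
    have "conjugate lam (Suc k) < conjugate lam (Suc (Suc k)) + e"
      using e_regular_iff_conjugate[OF assms(1) p] assms(2) by simp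
    moreover have "conjugate lam (Suc (Suc k)) \<le> conjugate lam (Suc k)"
      using conjugate_antimono[OF p] by simp
    moreover have "conjugate lam (Suc (Suc k)) = 0" if "\<not> Suc k < K"
      using conjugate_eq_0_iff[OF p, of "Suc (Suc k)"] that assms(3) by simp
    ultimately show "(if Suc k < length (cols lam K) then cols lam K ! Suc k else 0) \<le> cols lam K ! k \<and>
        cols lam K ! k < (if Suc k < length (cols lam K) then cols lam K ! Suc k else 0) + e"
      using k by auto
  qed
qed

lemma e_regular_of_cols:
  assumes "e \<ge> 2" "restricted e xs"
  shows "e_regular e (of_cols xs)"
proof -
  have "conjugate (of_cols xs) k < conjugate (of_cols xs) (Suc k) + e" if "k \<ge> 1" for k
  proof -
    have k: "k \<ge> 1" using that .
    obtain j where j: "k = Suc j" using k by (cases k) auto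
    show ?thesis
      using assms unfolding j conjugate_of_cols[OF assms(2)] restricted_iff hd0_drop
      by (cases "j < length xs") auto
  qed
  then show ?thesis using e_regular_iff_conjugate[OF assms(1) is_partition_of_cols[OF assms(2)]] by simp
qed

lemma of_cols_cols:
  assumes "e \<ge> 2" "e_regular e lam" "lam 1 \<le> K"
  shows "of_cols (cols lam K) = lam"
proof (rule conjugate_inj)
  note r = restricted_cols[OF assms]
  show p: "is_partition lam" using assms by (simp add: e_regular_def)
  show "is_partition (of_cols (cols lam K))" using is_partition_of_cols[OF r] .
  fix j :: nat assume "j \<ge> 1"
  then obtain k where k: "j = Suc k" by (cases j) auto
  show "conjugate (of_cols (cols lam K)) j = conjugate lam j"
  proof (cases "k < K")
    case True
    then show ?thesis unfolding k conjugate_of_cols[OF r] by simp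
  next
    case False
    then have "conjugate lam (Suc k) = 0" using conjugate_eq_0_iff[OF p, of "Suc k"] assms(3) by simp
    then show ?thesis unfolding k conjugate_of_cols[OF r] using False by simp
  qed
qed

lemma cols_of_cols:
  assumes "restricted e xs"
  shows "cols (of_cols xs) (length xs) = xs"
proof (rule nth_equalityI)
  fix k assume "k < length (cols (of_cols xs) (length xs))"
  then show "cols (of_cols xs) (length xs) ! k = xs ! k"
    using conjugate_of_cols[OF assms, of k] by simp
qed simp

lemma of_cols_first_le:
  assumes "restricted e xs"
  shows "of_cols xs 1 \<le> length xs"
  using of_cols_ge_iff[OF assms, of 1 "length xs"] by simp

lemma of_cols_append_zeros:
  "of_cols (xs @ replicate n 0) = of_cols xs"
proof -
  have "{k. k < length (xs @ replicate n 0) \<and> i \<le> (xs @ replicate n 0) ! k} = {k. k < length xs \<and> i \<le> xs ! k}"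
    if "i > 0" for i
  proof -
    have "(xs @ replicate n 0) ! k = (if k < length xs then xs ! k else 0)" if "k < length xs + n" for k
      using that by (simp add: nth_append)
    then show ?thesis using that by (auto split: if_splits)
  qed
  then show ?thesis by (auto simp: of_cols_def fun_eq_iff)
qed

lemma cols_add:
  assumes "is_partition lam" "lam 1 \<le> K"
  shows "cols lam (K + n) = cols lam K @ replicate n 0"
proof (rule nth_equalityI)
  fix k assume k: "k < length (cols lam (K + n))"
  have "conjugate lam (Suc k) = 0" if "\<not> k < K"
    using conjugate_eq_0_iff[OF assms(1), of "Suc k"] that assms(2) by simp
  then show "cols lam (K + n) ! k = (cols lam K @ replicate n 0) ! k"
    using k by (simp add: nth_append)
qed simp

section \<open>The \<open>e\<close>-rim in terms of columns\<close>

definition usum :: "nat \<Rightarrow> parts \<Rightarrow> nat \<Rightarrow> nat" where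
  "usum e lam k = tok e (drop k (cols lam (lam 1)))"

text \<open>The running sum tested at column k. By \<open>erim_node_eq\<close> it is also the number
  of nodes of the e-rim in the columns from k on.\<close>

definition rsum :: "nat \<Rightarrow> parts \<Rightarrow> nat \<Rightarrow> nat" where
  "rsum e lam k = conjugate lam (Suc k) + usum e lam (Suc k)"

lemma usum_rec:
  assumes "is_partition lam"
  shows "usum e lam k = usum e lam (Suc k) + (if e dvd rsum e lam k then 0 else 1)"
proof (cases "k < lam 1")
  case True
  then have "drop k (cols lam (lam 1)) = conjugate lam (Suc k) # drop (Suc k) (cols lam (lam 1))"
    by (metis Cons_nth_drop_Suc length_cols nth_cols)
  then show ?thesis by (simp add: usum_def rsum_def)
next
  case False
  then have "conjugate lam (Suc k) = 0" using conjugate_eq_0_iff[OF assms, of "Suc k"] by simp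
  then show ?thesis using False by (simp add: usum_def rsum_def)
qed

lemma rsum_eps_le:
  assumes "e \<ge> 2" "e_regular e lam" "\<not> e dvd rsum e lam k"
  shows "1 \<le> conjugate lam (Suc k)"
proof (cases "k < lam 1")
  case True
  have p: "is_partition lam" using assms by (simp add: e_regular_def)
  then show ?thesis using conjugate_eq_0_iff[OF p, of "Suc k"] True by simp
next
  case False
  have p: "is_partition lam" using assms by (simp add: e_regular_def)
  have "conjugate lam (Suc k) = 0" using conjugate_eq_0_iff[OF p, of "Suc k"] False by simp
  then show ?thesis using False assms by (simp add: usum_def rsum_def)
qed

lemma rsum_Suc_le:
  assumes "is_partition lam"
  shows "rsum e lam (Suc k) \<le> rsum e lam k"
  using usum_rec[OF assms, of e "Suc k"] conjugate_antimono[OF assms, of "Suc k" "Suc (Suc k)"]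
  by (simp add: rsum_def)

lemma rsum_antimono:
  assumes "is_partition lam" "j \<le> k"
  shows "rsum e lam k \<le> rsum e lam j"
  using assms(2)
  by (induction k rule: dec_induct) (use rsum_Suc_le[OF assms(1)] order_trans in blast)+

lemma rsum_eq_0:
  assumes "is_partition lam" "lam 1 \<le> k"
  shows "rsum e lam k = 0"
  using conjugate_eq_0_iff[OF assms(1), of "Suc k"] assms(2) by (simp add: rsum_def usum_def)

text \<open>A column with the same running sum as its right neighbour contains no node of the e-rim.
  This happens only between columns of equal height and where the sum is divisible by e, that is,
  where the e-rim jumps; k is the column in which the index really occurs.\<close>

lemma rsum_plateau:
  assumes "is_partition lam" "rsum e lam j > 0"
  obtains k where "j \<le> k" "rsum e lam k = rsum e lam j" "rsum e lam (Suc k) < rsum e lam k"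
    "conjugate lam (Suc k) = conjugate lam (Suc j)" "usum e lam (Suc k) = usum e lam (Suc j)"
    "k = j \<or> e dvd rsum e lam j"
proof -
  have "\<exists>k\<ge>j. rsum e lam k = rsum e lam j \<and> rsum e lam (Suc k) < rsum e lam k \<and>
    conjugate lam (Suc k) = conjugate lam (Suc j) \<and> usum e lam (Suc k) = usum e lam (Suc j) \<and>
    (k = j \<or> e dvd rsum e lam j)"
    using assms(2)
  proof (induction "lam 1 - j" arbitrary: j rule: less_induct)
    case less
    show ?case
    proof (cases "rsum e lam (Suc j) < rsum e lam j")
      case True
      then show ?thesis by blast
    next
      case False
      then have eq: "rsum e lam (Suc j) = rsum e lam j" using rsum_Suc_le[OF assms(1), of e j] by simp
      have "j < lam 1" using less(2) rsum_eq_0[OF assms(1), of j e] by (cases "j < lam 1") auto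
      then obtain k where k: "k \<ge> Suc j" "rsum e lam k = rsum e lam (Suc j)"
        "rsum e lam (Suc k) < rsum e lam k" "conjugate lam (Suc k) = conjugate lam (Suc (Suc j))"
        "usum e lam (Suc k) = usum e lam (Suc (Suc j))"
        using less(1)[OF diff_less_mono2[OF lessI]] less(2) eq by (metis (no_types, lifting))
      have "conjugate lam (Suc (Suc j)) \<le> conjugate lam (Suc j)"
        using conjugate_antimono[OF assms(1)] by simp
      then have "conjugate lam (Suc (Suc j)) = conjugate lam (Suc j) \<and>
          usum e lam (Suc (Suc j)) = usum e lam (Suc j) \<and> e dvd rsum e lam (Suc j)"
        using eq usum_rec[OF assms(1), of e "Suc j"]
        by (auto simp: rsum_def[of e lam j] rsum_def[of e lam "Suc j"] split: if_splits)
      then show ?thesis using k eq by (metis Suc_leD)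
    qed
  qed
  then show ?thesis using that by blast
qed

text \<open>The walk spends the indices above \<open>rsum e lam (Suc k)\<close> up to
  \<open>rsum e lam k\<close> going down one column. At an index divisible by e it jumps to the next
  row, otherwise it turns left within the row; in the second case \<open>usum\<close> grows by one,
  which accounts for the repeated row.\<close>

lemma erim_node_eq:
  assumes e: "e \<ge> 2" and reg: "e_regular e lam"
    and "rsum e lam (Suc k) < n" "n \<le> rsum e lam k"
  shows "erim_node e lam n = (n - usum e lam (Suc k), Suc k)"
  using assms(3,4)
proof (induction n arbitrary: k)
  case 0
  then show ?case by simp
next
  case (Suc n)
  have p: "is_partition lam" using reg by (simp add: e_regular_def)
  let ?c = "\<lambda>k. conjugate lam (Suc k)" and ?u = "usum e lam" and ?r = "rsum e lam"
  have eps: "?u k \<le> ?u (Suc k) + ?c k" for k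
    using usum_rec[OF p, of e k] rsum_eps_le[OF e reg, of k] by (auto split: if_splits)
  have r: "?r k = ?c k + ?u (Suc k)" for k by (simp add: rsum_def)
  have node: "erim_node e lam (Suc n) = (case erim_node e lam n of (i, j) \<Rightarrow>
        if e dvd n then (i + 1, lam (i + 1))
        else if (i + 1, j) \<in> young lam then (i + 1, j)
        else (i, j - 1))" if "n > 0"
    using that by simp
  show ?case
  proof (cases "n = 0")
    case True
    then have "?r (Suc k) = 0" using Suc by simp
    then have z: "?c (Suc k) = 0" "?u (Suc k) = 0" using r[of "Suc k"] usum_rec[OF p, of e "Suc k"] by auto
    then have "lam 1 < Suc (Suc k)" using conjugate_eq_0_iff[OF p, of "Suc (Suc k)"] by simp
    moreover have "?c k \<noteq> 0" using Suc(3) r[of k] z True by simp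
    then have "Suc k \<le> lam 1" using conjugate_eq_0_iff[OF p, of "Suc k"] by simp
    ultimately have "lam 1 = Suc k" by simp
    then show ?thesis using True z by simp
  next
    case False
    show ?thesis
    proof (cases "?r (Suc k) < n")
      case True
      define i where "i = n - ?u (Suc k)"
      have IH: "erim_node e lam n = (i, Suc k)" using Suc.IH[OF True] Suc(3) by (simp add: i_def)
      have n: "n = i + ?u (Suc k)" "?c (Suc k) \<le> i"
        using True r[of "Suc k"] eps[of "Suc k"] usum_rec[OF p, of e "Suc k"]
        by (auto simp: i_def split: if_splits)
      have i1: "i + 1 \<le> ?c k" using Suc(3) r[of k] n by simp
      then have y: "Suc k \<le> lam (i + 1)" using conjugate_ge_iff[OF p, of "i + 1" "Suc k"] by simp
      have "\<not> i + 1 \<le> ?c (Suc k)" using n by simp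
      then have "\<not> Suc (Suc k) \<le> lam (i + 1)"
        using conjugate_ge_iff[OF p, of "i + 1" "Suc (Suc k)"] by simp
      then have "lam (i + 1) = Suc k" using y by simp
      then have "erim_node e lam (Suc n) = (i + 1, Suc k)"
        using node False IH y by (simp add: young_def)
      then show ?thesis using n by simp
    next
      case nlt: False
      then have n: "n = ?r (Suc k)" using Suc(2) by simp
      \<comment> \<open>The previous node lies in column k2, which need not be the right neighbour:
        columns without nodes of the e-rim are skipped.\<close>
      obtain k2 where k2: "Suc k \<le> k2" "?r k2 = ?r (Suc k)" "?r (Suc k2) < ?r k2"
        "?c k2 = ?c (Suc k)" "?u (Suc k2) = ?u (Suc (Suc k))" "k2 = Suc k \<or> e dvd ?r (Suc k)"
        using rsum_plateau[OF p, of e "Suc k"] n False by (metis neq0_conv)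
      have IH: "erim_node e lam n = (?c (Suc k), Suc k2)"
        using Suc.IH[of k2] k2 n r[of "Suc k"] by simp
      show ?thesis
      proof (cases "e dvd n")
        case True
        then have u: "?u (Suc k) = ?u (Suc (Suc k))" using usum_rec[OF p, of e "Suc k"] n by simp
        then have c: "?c (Suc k) + 1 \<le> ?c k" using Suc(3) n r[of k] r[of "Suc k"] by simp
        then have "Suc k \<le> lam (?c (Suc k) + 1)"
          using conjugate_ge_iff[OF p, of "?c (Suc k) + 1" "Suc k"] by simp
        moreover have "\<not> Suc (Suc k) \<le> lam (?c (Suc k) + 1)"
          using conjugate_ge_iff[OF p, of "?c (Suc k) + 1" "Suc (Suc k)"] by simp
        ultimately have "lam (?c (Suc k) + 1) = Suc k" by simp
        then have "erim_node e lam (Suc n) = (?c (Suc k) + 1, Suc k)"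
          using node False IH True by simp
        then show ?thesis using n u r[of "Suc k"] by simp
      next
        case nd: False
        then have k: "k2 = Suc k" using k2(6) n by simp
        have u: "?u (Suc k) = ?u (Suc (Suc k)) + 1" using usum_rec[OF p, of e "Suc k"] n nd by simp
        have "\<not> ?c (Suc k) + 1 \<le> ?c (Suc k)" by simp
        then have "(?c (Suc k) + 1, Suc (Suc k)) \<notin> young lam"
          using conjugate_ge_iff[OF p, of "?c (Suc k) + 1" "Suc (Suc k)"] by (simp add: young_def)
        then have "erim_node e lam (Suc n) = (?c (Suc k), Suc k)"
          using node False IH nd k by simp
        then show ?thesis using n u r[of "Suc k"] by simp
      qed
    qed
  qed
qed

lemma rsum_locate:
  assumes "is_partition lam" "1 \<le> n" "n \<le> rsum e lam 0"
  obtains k where "rsum e lam (Suc k) < n" "n \<le> rsum e lam k"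
proof -
  have "\<exists>k. rsum e lam (Suc k) < n \<and> n \<le> rsum e lam k"
  proof (rule ccontr)
    assume a: "\<not> ?thesis"
    have "n \<le> rsum e lam k" for k
      by (induction k) (use assms a in \<open>auto simp: not_less\<close>)
    then show False using rsum_eq_0[OF assms(1), of "lam 1" e] assms(2) by (metis le_refl not_one_le_zero order_trans)
  qed
  then show ?thesis using that by blast
qed

lemma rsum_dvd_plateau:
  assumes "is_partition lam" "e dvd rsum e lam k" "conjugate lam (Suc k) = conjugate lam (Suc 0)"
  shows "rsum e lam 0 = rsum e lam k"
  using assms(2,3)
proof (induction k)
  case (Suc k)
  have "conjugate lam (Suc (Suc k)) \<le> conjugate lam (Suc k)" "conjugate lam (Suc k) \<le> conjugate lam (Suc 0)"
    using conjugate_antimono[OF assms(1)] by auto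
  then have "conjugate lam (Suc k) = conjugate lam (Suc (Suc k))" using Suc(3) by simp
  then have "rsum e lam k = rsum e lam (Suc k)"
    using usum_rec[OF assms(1), of e "Suc k"] Suc(2) by (simp add: rsum_def)
  then show ?case using Suc \<open>conjugate lam (Suc k) = _\<close> by simp
qed simp

lemma erim_length_eq:
  assumes e: "e \<ge> 2" and reg: "e_regular e lam"
  shows "erim_length e lam = rsum e lam 0"
proof (cases "lam = empty_partition")
  case True
  then show ?thesis using rsum_eq_0[of lam 0 e] reg by (simp add: erim_length_def e_regular_def empty_partition_def)
next
  case False
  have p: "is_partition lam" using reg by (simp add: e_regular_def)
  let ?c = "\<lambda>k. conjugate lam (Suc k)" and ?u = "usum e lam" and ?r = "rsum e lam"
  have "?c 0 \<noteq> 0" using partition_1_pos[OF p False] conjugate_eq_0_iff[OF p, of 1] by simp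
  then have pos: "?r 0 \<ge> 1" by (simp add: rsum_def)
  have stop: "erim_stop e lam (?r 0)"
  proof -
    obtain k where k: "?r k = ?r 0" "?r (Suc k) < ?r k" "?c k = ?c 0" "?u (Suc k) = ?u (Suc 0)"
      "k = 0 \<or> e dvd ?r 0"
      using rsum_plateau[OF p, of e 0] pos by (metis less_eq_Suc_le One_nat_def)
    have "erim_node e lam (?r 0) = (?r 0 - ?u (Suc k), Suc k)"
      by (rule erim_node_eq[OF e reg]) (use k in auto)
    then have "erim_node e lam (?r 0) = (num_parts lam, Suc k)"
      using k by (simp add: num_parts_conjugate rsum_def)
    then show ?thesis using k by (auto simp: erim_stop_def)
  qed
  have nostop: "\<not> erim_stop e lam n" if n: "1 \<le> n" "n < ?r 0" for n
  proof
    assume s: "erim_stop e lam n"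
    obtain k where k: "?r (Suc k) < n" "n \<le> ?r k" using rsum_locate[OF p n(1), of e] n by auto
    have "erim_node e lam n = (n - ?u (Suc k), Suc k)" by (rule erim_node_eq[OF e reg k])
    then have s: "n - ?u (Suc k) = ?c 0" "k = 0 \<or> e dvd n"
      using s by (auto simp: erim_stop_def num_parts_conjugate)
    have "?c k \<le> ?c 0" using conjugate_antimono[OF p] by simp
    then have "?c k = ?c 0" "n = ?r k" using s(1) k(2) \<open>?c 0 \<noteq> 0\<close> by (auto simp: rsum_def)
    then show False using s(2) n rsum_dvd_plateau[OF p, of e k] by auto
  qed
  have "(LEAST k. k \<ge> 1 \<and> erim_stop e lam k) = ?r 0"
    by (rule Least_equality) (use pos stop nostop in \<open>auto simp: not_less[symmetric]\<close>)
  then show ?thesis using False by (simp add: erim_length_def)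
qed

lemma erim_eq:
  assumes e: "e \<ge> 2" and reg: "e_regular e lam"
  shows "(i, Suc k) \<in> erim e lam \<longleftrightarrow>
    conjugate lam (Suc (Suc k)) - (if e dvd rsum e lam (Suc k) then 0 else 1) < i \<and> i \<le> conjugate lam (Suc k)"
proof -
  have p: "is_partition lam" using reg by (simp add: e_regular_def)
  let ?c = "\<lambda>k. conjugate lam (Suc k)" and ?u = "usum e lam" and ?r = "rsum e lam"
  let ?eps = "\<lambda>k. if e dvd rsum e lam k then 0 else 1 :: nat"
  have eps: "?eps k \<le> ?c k" for k using rsum_eps_le[OF e reg, of k] by auto
  have u: "?u k = ?u (Suc k) + ?eps k" for k using usum_rec[OF p] .
  have erim: "erim e lam = erim_node e lam ` {1..?r 0}" by (simp add: erim_def erim_length_eq[OF e reg])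
  show ?thesis
  proof
    assume "(i, Suc k) \<in> erim e lam"
    then obtain n where n: "1 \<le> n" "n \<le> ?r 0" "erim_node e lam n = (i, Suc k)" unfolding erim by auto
    obtain k' where k: "?r (Suc k') < n" "n \<le> ?r k'" using rsum_locate[OF p n(1,2)] by blast
    have "k' = k" and i: "i = n - ?u (Suc k)" using erim_node_eq[OF e reg k] n(3) by auto
    have "?c (Suc k) + ?u (Suc (Suc k)) < n" "n \<le> ?c k + ?u (Suc k)"
      using k \<open>k' = k\<close> by (auto simp: rsum_def)
    then show "?c (Suc k) - ?eps (Suc k) < i \<and> i \<le> ?c k"
      using i u[of "Suc k"] eps[of "Suc k"] by (intro conjI) linarith+
  next
    assume i: "?c (Suc k) - ?eps (Suc k) < i \<and> i \<le> ?c k"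
    define n where "n = i + ?u (Suc k)"
    have r: "?r (Suc k) = ?c (Suc k) + ?u (Suc (Suc k))" "?r k = ?c k + ?u (Suc k)"
      by (simp_all add: rsum_def)
    have n: "?r (Suc k) < n" "n \<le> ?r k"
      using i u[of "Suc k"] eps[of "Suc k"] r unfolding n_def by linarith+
    have "erim_node e lam n = (i, Suc k)" using erim_node_eq[OF e reg n] by (simp add: n_def)
    moreover have "n \<in> {1..?r 0}" using n rsum_antimono[OF p, of 0 k e] by auto
    ultimately show "(i, Suc k) \<in> erim e lam" unfolding erim by (metis image_eqI)
  qed
qed

lemma nth_peel:
  "k < length xs \<Longrightarrow> peel e xs ! k = xs ! k - (if e dvd xs ! k + tok e (drop (Suc k) xs) then 0 else 1)"
proof (induction xs arbitrary: k)
  case (Cons a xs)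
  then show ?case by (cases k) auto
qed simp

text \<open>The e-rim cuts each column down to the peeled height of its right neighbour. So what
  remains is the list of peeled columns moved one place to the left.\<close>

lemma remove_erim_eq:
  assumes e: "e \<ge> 2" and reg: "e_regular e lam"
  shows "remove_erim e lam = of_cols (tl (peel e (cols lam (lam 1))))"
proof
  have p: "is_partition lam" using reg by (simp add: e_regular_def)
  let ?c = "\<lambda>k. conjugate lam (Suc k)" and ?xs = "tl (peel e (cols lam (lam 1)))"
  let ?eps = "\<lambda>k. if e dvd rsum e lam k then 0 else 1 :: nat"
  fix i
  show "remove_erim e lam i = of_cols ?xs i"
  proof (cases "i = 0")
    case True
    then show ?thesis by (simp add: remove_erim_def of_diagram_def of_cols_def young_def)
  next
    case False
    have row: "(i, Suc k) \<in> young lam - erim e lam \<longleftrightarrow> k < length ?xs \<and> i \<le> ?xs ! k" for k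
    proof (cases "k < length ?xs")
      case True
      then have "?xs ! k = ?c (Suc k) - ?eps (Suc k)"
        by (simp add: nth_tl nth_peel rsum_def usum_def)
      moreover have "?c (Suc k) \<le> ?c k" using conjugate_antimono[OF p] by simp
      ultimately show ?thesis
        using True False erim_eq[OF e reg, of i k] conjugate_ge_iff[OF p, of i "Suc k"]
        by (auto simp: young_def)
    next
      case k: False
      then have "?c (Suc k) = 0" using conjugate_eq_0_iff[OF p, of "Suc (Suc k)"] by simp
      then show ?thesis
        using k False erim_eq[OF e reg, of i k] conjugate_ge_iff[OF p, of i "Suc k"]
        by (auto simp: young_def)
    qed
    have "{j. (i, j) \<in> young lam - erim e lam} = Suc ` {k. k < length ?xs \<and> i \<le> ?xs ! k}"
    proof (intro set_eqI iffI)
      fix j assume j: "j \<in> {j. (i, j) \<in> young lam - erim e lam}"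
      then obtain k where "j = Suc k" by (cases j) (auto simp: young_def)
      then show "j \<in> Suc ` {k. k < length ?xs \<and> i \<le> ?xs ! k}" using j row[of k] by auto
    qed (use row in auto)
    then show ?thesis
      using False by (simp add: remove_erim_def of_diagram_def of_cols_def card_image)
  qed
qed

lemma mullineux_num_parts_eq:
  assumes e: "e \<ge> 2" and reg: "e_regular e lam"
  shows "mullineux_num_parts e lam = tok e (cols lam (lam 1)) \<or> lam = empty_partition"
proof -
  have p: "is_partition lam" using reg by (simp add: e_regular_def)
  have "tok e (cols lam (lam 1)) = usum e lam 0" by (simp add: usum_def)
  then show ?thesis
    using usum_rec[OF p, of e 0]
    by (auto simp: mullineux_num_parts_def erim_length_eq[OF e reg] rsum_def num_parts_conjugate)
qed

section \<open>The Mullineux map in terms of columns\<close>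

lemma restricted_conv_cols:
  assumes "restricted e xs"
  shows "xs = cols (of_cols xs) (of_cols xs 1) @ replicate (length xs - of_cols xs 1) 0"
proof -
  let ?l = "of_cols xs"
  have "xs = cols ?l (length xs)" by (rule cols_of_cols[OF assms, symmetric])
  also have "length xs = ?l 1 + (length xs - ?l 1)" using of_cols_first_le[OF assms] by simp
  also have "cols ?l \<dots> = cols ?l (?l 1) @ replicate (length xs - ?l 1) 0"
    by (rule cols_add[OF is_partition_of_cols[OF assms] order_refl])
  finally show ?thesis .
qed

lemma restricted_sum_list_zero:
  assumes "restricted e xs" "hd0 xs = 0"
  shows "sum_list xs = 0"
  using assms by (induction xs) auto

lemma num_parts_of_cols:
  assumes "restricted e xs"
  shows "num_parts (of_cols xs) = hd0 xs"
  using conjugate_of_cols[OF assms, of 0] by (simp add: num_parts_conjugate hd0_conv_nth)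

lemma of_cols_eq_empty_iff:
  assumes "restricted e xs"
  shows "of_cols xs = empty_partition \<longleftrightarrow> hd0 xs = 0"
proof
  assume "of_cols xs = empty_partition"
  then show "hd0 xs = 0" using num_parts_of_cols[OF assms] by (simp add: num_parts_def empty_partition_def)
next
  assume "hd0 xs = 0"
  then have "xs = replicate (length xs) 0" using assms restricted_hd0_zero by blast
  then have "\<not> i \<le> xs ! k" if "k < length xs" "i > 0" for k i
    using that by (metis nth_replicate not_less)
  then show "of_cols xs = empty_partition" by (auto simp: of_cols_def empty_partition_def fun_eq_iff)
qed

lemma tl_append_replicate:
  "of_cols (tl (xs @ replicate n 0)) = of_cols (tl xs)" "tok e (tl (xs @ replicate n 0)) = tok e (tl xs)"
proof -
  have r: "tl (replicate n (0::nat)) = replicate (n - 1) 0" by (cases n) auto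
  have o: "of_cols (replicate m 0) = of_cols []" for m using of_cols_append_zeros[of "[]" m] by simp
  show "of_cols (tl (xs @ replicate n 0)) = of_cols (tl xs)"
  proof (cases xs)
    case Nil
    then show ?thesis using o by (simp add: r)
  next
    case (Cons a ys)
    then show ?thesis by (simp only: append_Cons list.sel of_cols_append_zeros)
  qed
  show "tok e (tl (xs @ replicate n 0)) = tok e (tl xs)"
    by (cases xs) (simp_all add: r)
qed

lemma
  assumes "e \<ge> 2" "restricted e xs"
  shows erim_length_of_cols: "erim_length e (of_cols xs) = hd0 xs + tok e (tl xs)"
    and remove_erim_of_cols: "remove_erim e (of_cols xs) = of_cols (tl (peel e xs))"
    and mullineux_num_parts_of_cols: "mullineux_num_parts e (of_cols xs) = tok e xs"
proof -
  define l where "l = of_cols xs"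
  have reg: "e_regular e l" using e_regular_of_cols[OF assms] by (simp add: l_def)
  have xs: "xs = cols l (l 1) @ replicate (length xs - l 1) 0"
    using restricted_conv_cols[OF assms(2)] by (simp add: l_def)
  have "rsum e l 0 = hd0 xs + tok e (tl (cols l (l 1)))"
    using num_parts_of_cols[OF assms(2)] by (simp add: rsum_def usum_def l_def num_parts_conjugate drop_Suc)
  also have "tok e (tl (cols l (l 1))) = tok e (tl xs)"
    using tl_append_replicate(2)[of e "cols l (l 1)" "length xs - l 1"] unfolding xs[symmetric] by simp
  finally show "erim_length e (of_cols xs) = hd0 xs + tok e (tl xs)"
    using erim_length_eq[OF assms(1) reg] by (simp add: l_def)
  have "peel e xs = peel e (cols l (l 1)) @ replicate (length xs - l 1) 0"
    using arg_cong[OF xs, of "peel e"] by (simp only: peel_append_zeros)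
  then show "remove_erim e (of_cols xs) = of_cols (tl (peel e xs))"
    using remove_erim_eq[OF assms(1) reg] tl_append_replicate(1) unfolding l_def by (simp only:)
  have "tok e xs = tok e (cols l (l 1))" using arg_cong[OF xs, of "tok e"] by (simp only: tok_append_zeros)
  moreover have "mullineux_num_parts e l = 0 \<and> tok e xs = 0" if "l = empty_partition"
  proof -
    have "hd0 xs = 0" using that of_cols_eq_empty_iff[OF assms(2)] by (simp add: l_def)
    then have "xs = replicate (length xs) 0" using assms(2) restricted_hd0_zero by blast
    then have "tok e xs = 0" by (metis tok_replicate_0)
    then show ?thesis using that by (simp add: mullineux_num_parts_def erim_length_def num_parts_def empty_partition_def)
  qed
  ultimately show "mullineux_num_parts e (of_cols xs) = tok e xs"
    using mullineux_num_parts_eq[OF assms(1) reg] by (auto simp: l_def)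
qed

lemma of_cols_inject:
  assumes "restricted e xs" "restricted e ys" "length xs = length ys" "of_cols xs = of_cols ys"
  shows "xs = ys"
proof -
  have "xs = cols (of_cols xs) (length xs)" by (rule cols_of_cols[OF assms(1), symmetric])
  also have "\<dots> = cols (of_cols ys) (length ys)" by (simp only: assms(3,4))
  also have "\<dots> = ys" by (rule cols_of_cols[OF assms(2)])
  finally show ?thesis .
qed

lemma restricted_tl: "restricted e xs \<Longrightarrow> restricted e (tl xs)"
  by (cases xs) auto

lemma restricted_append_zeros:
  assumes "restricted e xs" "e > 0"
  shows "restricted e (xs @ replicate n 0)"
  using assms(1)
proof (induction xs)
  case Nil
  show ?case using assms(2) by (induction n) (auto simp: hd0_conv_nth)
next
  case (Cons a xs)
  have "hd0 (xs @ replicate n 0) = hd0 xs" by (cases xs; cases n) auto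
  then show ?case using Cons by simp
qed

text \<open>The number of parts is the first column, the e-rim length then gives the losses of the
  other columns, and removal of the e-rim gives the peeled columns; \<open>peel_inj\<close> recovers
  the list.\<close>

lemma mullineux_unique:
  assumes e: "e \<ge> 2" and reg: "e_regular e mu" "e_regular e nu"
    and eq: "erim_length e mu = erim_length e nu" "num_parts mu = num_parts nu" "remove_erim e mu = remove_erim e nu"
  shows "mu = nu"
proof -
  \<comment> \<open>Larger than both widths, so that the two column lists have equal length and are
    nonempty.\<close>
  define L where "L = Suc (max (mu 1) (nu 1))"
  define xs where "xs = cols mu L"
  define ys where "ys = cols nu L"
  have r: "restricted e xs" "restricted e ys"
    unfolding xs_def ys_def L_def by (rule restricted_cols[OF e]; use reg in simp)+
  have mu: "mu = of_cols xs" "nu = of_cols ys"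
    unfolding xs_def ys_def L_def by (rule of_cols_cols[OF e, symmetric]; use reg in simp)+
  have len: "length xs = Suc (max (mu 1) (nu 1))" "length ys = length xs"
    by (simp_all add: xs_def ys_def L_def)
  obtain a xs' where x: "xs = a # xs'" using len by (cases xs) auto
  obtain b ys' where y: "ys = b # ys'" using len by (cases ys) auto
  have ab: "a = b" using eq(2) num_parts_of_cols[OF r(1)] num_parts_of_cols[OF r(2)] by (simp add: mu x y)
  have t: "tok e xs' = tok e ys'"
    using eq(1) ab unfolding mu erim_length_of_cols[OF e r(1)] erim_length_of_cols[OF e r(2)] by (simp add: x y)
  have "tl (peel e xs) = tl (peel e ys)"
  proof (rule of_cols_inject)
    show "of_cols (tl (peel e xs)) = of_cols (tl (peel e ys))"
      using eq(3) unfolding mu remove_erim_of_cols[OF e r(1)] remove_erim_of_cols[OF e r(2)] .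
  qed (use r len restricted_peel[OF e] restricted_tl in auto)
  then have "peel e xs = peel e ys" using ab t by (simp add: x y)
  moreover have "tok e xs = tok e ys" using ab t by (simp add: x y)
  ultimately have "xs = ys" by (intro peel_inj[OF r]) (simp_all add: len)
  then show ?thesis by (simp add: mu)
qed

text \<open>By uniqueness only the data of the loss list \<open>B\<close> need checking.
  \<open>tokseq_Cons\<close> says that peeling \<open>B\<close> gives the loss list of the tail of
  \<open>xs\<close>; dropping its head gives that of the peeled tail, so removing the e-rim on both
  sides agrees by induction. The e-rim length is symmetric in the matrix.\<close>

theorem mullineux_of_cols:
  assumes e: "e \<ge> 2" and "restricted e xs" "sum_list xs \<le> N"
  shows "mullineux e (of_cols xs) = of_cols (tokseq e xs N)"
  using assms(2,3)
proof (induction "sum_list xs" arbitrary: xs N rule: less_induct)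
  case less
  note r = less(2)
  show ?case
  proof (cases "hd0 xs = 0")
    case True
    then have "xs = replicate (length xs) 0" using r restricted_hd0_zero by blast
    have "sum_list xs = 0" by (rule restricted_sum_list_zero[OF r True])
    then have "(peel e ^^ t) xs = replicate (length xs) 0" for t
      using funpow_peel_zero[OF e r, of t] by linarith
    then have "tokseq e xs N = replicate N 0"
      by (auto simp: tokseq_def intro!: nth_equalityI)
    moreover have "restricted e (replicate N 0)"
      using restricted_append_zeros[of e "[]" N] e by simp
    ultimately have "of_cols (tokseq e xs N) = empty_partition"
      using of_cols_eq_empty_iff[of e "replicate N 0"] by (cases N) auto
    moreover have "of_cols xs = empty_partition" using of_cols_eq_empty_iff[OF r] True by simp
    ultimately show ?thesis by (simp add: mullineux.simps)
  next
    case False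
    then obtain a ys where xs: "xs = a # ys" "a > 0" by (cases xs) auto
    then obtain M where N: "N = Suc M" using less(3) by (cases N) auto
    define B where "B = tokseq e xs N"
    have zero: "(peel e ^^ N) xs = replicate (length xs) 0" by (rule funpow_peel_zero[OF e r less(3)])
    have rB: "restricted e B" unfolding B_def by (rule restricted_tokseq[OF e r zero])
    have dual: "tok e B = a" "peel e B = tokseq e ys N"
      using tokseq_Cons[OF e, of a ys N] r zero by (auto simp: B_def xs)
    obtain B' where B: "B = tok e xs # B'" by (simp add: B_def N tokseq_Suc)
    have rys: "restricted e ys" using r xs by simp
    have sum: "sum_list (peel e ys) + tok e ys = sum_list ys" by (rule sum_list_peel[OF rys])
    have "tl (peel e xs) = peel e ys" by (simp add: xs)
    then have "mullineux e (remove_erim e (of_cols xs)) = mullineux e (of_cols (peel e ys))"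
      using remove_erim_of_cols[OF e r] by simp
    also have "\<dots> = of_cols (tokseq e (peel e ys) M)"
      by (rule less(1)) (use sum xs less(3) N restricted_peel[OF e rys] in auto)
    also have "\<dots> = of_cols (tl (peel e B))" by (simp add: dual N tokseq_Suc)
    also have "\<dots> = remove_erim e (of_cols B)" using remove_erim_of_cols[OF e rB] by simp
    finally have rem: "remove_erim e (of_cols B) = mullineux e (remove_erim e (of_cols xs))" by simp
    have num: "num_parts (of_cols B) = mullineux_num_parts e (of_cols xs)"
      unfolding num_parts_of_cols[OF rB] mullineux_num_parts_of_cols[OF e r] by (simp add: B)
    have len: "erim_length e (of_cols B) = erim_length e (of_cols xs)"
    proof -
      let ?eps = "if e dvd tok e xs + tok e B' then 0 else 1 :: nat"
      have "tok e B' + ?eps = a" using dual(1) by (simp add: B)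
      moreover have "tok e xs - ?eps = tok e ys" using dual(2) by (simp add: B N tokseq_Suc)
      moreover have "?eps \<le> tok e xs" using restricted_eps_le[OF rB[unfolded B]] by auto
      ultimately have "tok e xs + tok e B' = a + tok e ys" by linarith
      then show ?thesis
        unfolding erim_length_of_cols[OF e rB] erim_length_of_cols[OF e r] by (simp add: B xs)
    qed
    have ne: "of_cols xs \<noteq> empty_partition" using of_cols_eq_empty_iff[OF r] False by simp
    have "mullineux e (of_cols xs) = (THE mu. e_regular e mu
              \<and> erim_length e mu = erim_length e (of_cols xs)
              \<and> num_parts mu = mullineux_num_parts e (of_cols xs)
              \<and> remove_erim e mu = mullineux e (remove_erim e (of_cols xs)))"
      by (rule trans[OF mullineux.simps if_P]) (intro conjI e_regular_of_cols[OF e r] ne)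
    also have "\<dots> = of_cols B"
    proof (rule the_equality)
      show "e_regular e (of_cols B) \<and> erim_length e (of_cols B) = erim_length e (of_cols xs)
          \<and> num_parts (of_cols B) = mullineux_num_parts e (of_cols xs)
          \<and> remove_erim e (of_cols B) = mullineux e (remove_erim e (of_cols xs))"
        using rem num len e_regular_of_cols[OF e rB] by (intro conjI)
    next
      fix mu assume mu: "e_regular e mu \<and> erim_length e mu = erim_length e (of_cols xs)
          \<and> num_parts mu = mullineux_num_parts e (of_cols xs)
          \<and> remove_erim e mu = mullineux e (remove_erim e (of_cols xs))"
      show "mu = of_cols B"
      proof (rule mullineux_unique[OF e])
        show "e_regular e mu" using mu by (rule conjunct1)
        show "e_regular e (of_cols B)" by (rule e_regular_of_cols[OF e rB])
        show "erim_length e mu = erim_length e (of_cols B)" unfolding len using mu by (elim conjE)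
        show "num_parts mu = num_parts (of_cols B)" unfolding num using mu by (elim conjE)
        show "remove_erim e mu = remove_erim e (of_cols B)" unfolding rem using mu by (elim conjE)
      qed
    qed
    finally show ?thesis by (simp add: B_def)
  qed
qed

section \<open>Regularisation in terms of columns\<close>

text \<open>For a nonempty column this is the ladder of its lowest node; for an empty one, the
  ladder number just before that of its top position.\<close>

definition colval :: "nat \<Rightarrow> parts \<Rightarrow> nat \<Rightarrow> nat" where
  "colval e lam k = conjugate lam (Suc k) + (e - 1) * k"

text \<open>The counting function of the multiset of values. It encodes the ladder sizes and is
  blind to the order of the columns, which is what regularisation changes.\<close>

definition colcount :: "nat \<Rightarrow> parts \<Rightarrow> nat \<Rightarrow> nat" where
  "colcount e lam v = card {k. colval e lam k < v}"

lemma colval_ge: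
  assumes "e \<ge> 2"
  shows "k \<le> colval e lam k"
proof -
  have "1 * k \<le> (e - 1) * k" using assms by (intro mult_le_mono1) simp
  then show ?thesis unfolding colval_def by linarith
qed

lemma finite_colval_less: "e \<ge> 2 \<Longrightarrow> finite {k. colval e lam k < v}"
  by (rule finite_subset[of _ "{..<v}"]) (auto dest: order_le_less_trans[OF colval_ge])

lemma colval_Suc_le:
  assumes "is_partition lam"
  shows "colval e lam (Suc k) \<le> colval e lam k + (e - 1)"
  using conjugate_antimono[OF assms, of "Suc k" "Suc (Suc k)"] by (simp add: colval_def)

lemma colval_mono:
  assumes "e \<ge> 2" "e_regular e lam" "j \<le> k"
  shows "colval e lam j \<le> colval e lam k"
  using assms(3)
proof (induction k rule: dec_induct)
  case (step n)
  have p: "is_partition lam" using assms(2) by (simp add: e_regular_def)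
  have "conjugate lam (Suc n) < conjugate lam (Suc (Suc n)) + e"
    using e_regular_iff_conjugate[OF assms(1) p] assms(2) by simp
  then have "colval e lam n \<le> colval e lam (Suc n)" using assms(1) by (simp add: colval_def)
  then show ?case using step by simp
qed simp

lemma ladder_inter_young:
  assumes "is_partition lam" "(i, Suc k) \<in> ladder e l"
  shows "(i, Suc k) \<in> young lam \<longleftrightarrow> l \<le> colval e lam k"
  using assms conjugate_ge_iff[OF assms(1), of i "Suc k"]
  by (auto simp: ladder_def young_def colval_def)

text \<open>Column k meets ladder l in the diagram exactly if (e - 1) k < l and l is at most the
  value of the column.\<close>

lemma card_ladder_young:
  assumes e: "e \<ge> 2" and p: "is_partition lam"
  shows "card (young lam \<inter> ladder e l) = card {k. (e - 1) * k < l} - colcount e lam l"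
proof -
  let ?A = "{k. (e - 1) * k < l}" and ?B = "{k. colval e lam k < l}"
  have "young lam \<inter> ladder e l = (\<lambda>k. (l - (e - 1) * k, Suc k)) ` (?A - ?B)"
  proof (intro set_eqI iffI)
    fix x assume x: "x \<in> young lam \<inter> ladder e l"
    then obtain i k where ik: "x = (i, Suc k)" by (cases x; cases "snd x") (auto simp: ladder_def)
    have "l = i + (e - 1) * k" "i \<ge> 1" using x ik by (auto simp: ladder_def)
    moreover have "l \<le> colval e lam k" using ladder_inter_young[OF p, of i k e l] x ik by simp
    ultimately show "x \<in> (\<lambda>k. (l - (e - 1) * k, Suc k)) ` (?A - ?B)"
      by (auto simp: ik intro!: image_eqI[of _ _ k])
  next
    fix x assume "x \<in> (\<lambda>k. (l - (e - 1) * k, Suc k)) ` (?A - ?B)"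
    then obtain k where k: "x = (l - (e - 1) * k, Suc k)" "(e - 1) * k < l" "l \<le> colval e lam k"
      by (force simp: not_less)
    have "x \<in> ladder e l" using k by (auto simp: ladder_def)
    then show "x \<in> young lam \<inter> ladder e l" using ladder_inter_young[OF p, of _ k e l] k by auto
  qed
  moreover have "inj_on (\<lambda>k. (l - (e - 1) * k, Suc k)) (?A - ?B)" by (auto simp: inj_on_def)
  moreover have "?B \<subseteq> ?A" by (auto simp: colval_def)
  ultimately show ?thesis
    using finite_colval_less[OF e, of lam l] by (simp add: card_image card_Diff_subset colcount_def)
qed

lemma finite_ladder: "finite (ladder e l)" if "e \<ge> 2"
proof (rule finite_subset)
  show "ladder e l \<subseteq> {..l} \<times> {..Suc l}"
  proof
    fix x assume "x \<in> ladder e l"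
    then obtain i j where x: "x = (i, j)" "j \<ge> 1" "i + (e - 1) * (j - 1) = l" by (auto simp: ladder_def)
    have "1 * (j - 1) \<le> (e - 1) * (j - 1)" using that by (intro mult_le_mono1) simp
    then have "i \<le> l" "j \<le> Suc l" using x by linarith+
    then show "x \<in> {..l} \<times> {..Suc l}" using x by simp
  qed
qed simp

text \<open>Moving up a ladder means moving to the right, and the values of a regular partition
  increase weakly to the right; its nodes therefore already sit at the top of each ladder.\<close>

lemma top_of_ladder_regular:
  assumes e: "e \<ge> 2" and reg: "e_regular e kap"
  shows "top_of_ladder e l (card (young kap \<inter> ladder e l)) = young kap \<inter> ladder e l"
proof -
  have p: "is_partition kap" using reg by (simp add: e_regular_def)
  have up: "(i, j) \<in> young kap"
    if ij: "(i, j) \<in> ladder e l" "(i', j') \<in> ladder e l" "i \<le> i'" "(i', j') \<in> young kap" for i j i' j'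
  proof -
    obtain k k' where k: "j = Suc k" "j' = Suc k'" using ij by (cases j; cases j') (auto simp: ladder_def)
    have "i + (e - 1) * k = i' + (e - 1) * k'" using ij k by (auto simp: ladder_def)
    then have "(e - 1) * k' \<le> (e - 1) * k" using ij(3) by linarith
    then have "k' \<le> k" using e by simp
    then have "colval e kap k' \<le> colval e kap k" by (rule colval_mono[OF e reg])
    then show ?thesis
      using ladder_inter_young[OF p, of i k e l] ladder_inter_young[OF p, of i' k' e l] ij k by simp
  qed
  have "(i, j) \<in> young kap \<longleftrightarrow> card {(i', j') \<in> ladder e l. i' \<le> i} \<le> card (young kap \<inter> ladder e l)"
    if ij: "(i, j) \<in> ladder e l" for i j
  proof
    assume "(i, j) \<in> young kap"
    then have "{(i', j') \<in> ladder e l. i' \<le> i} \<subseteq> young kap \<inter> ladder e l" using up[OF _ ij] by auto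
    then show "card {(i', j') \<in> ladder e l. i' \<le> i} \<le> card (young kap \<inter> ladder e l)"
      using finite_ladder[OF e] by (intro card_mono) auto
  next
    assume le: "card {(i', j') \<in> ladder e l. i' \<le> i} \<le> card (young kap \<inter> ladder e l)"
    show "(i, j) \<in> young kap"
    proof (rule ccontr)
      assume n: "(i, j) \<notin> young kap"
      have "young kap \<inter> ladder e l \<subset> {(i', j') \<in> ladder e l. i' \<le> i}"
      proof
        show "young kap \<inter> ladder e l \<subseteq> {(i', j') \<in> ladder e l. i' \<le> i}"
        proof
          fix x assume x: "x \<in> young kap \<inter> ladder e l"
          obtain i' j' where x': "x = (i', j')" by fastforce
          have "\<not> i \<le> i'" using up[OF ij, of i' j'] n x x' by blast
          then show "x \<in> {(i', j') \<in> ladder e l. i' \<le> i}" using x x' by simp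
        qed
        show "young kap \<inter> ladder e l \<noteq> {(i', j') \<in> ladder e l. i' \<le> i}" using ij n by auto
      qed
      moreover have "finite {(i', j') \<in> ladder e l. i' \<le> i}"
        by (rule finite_subset[OF _ finite_ladder[OF e, of l]]) auto
      ultimately have "card (young kap \<inter> ladder e l) < card {(i', j') \<in> ladder e l. i' \<le> i}"
        by (intro psubset_card_mono)
      then show False using le by linarith
    qed
  qed
  then show ?thesis by (auto simp: top_of_ladder_def)
qed

lemma regularisation_eqI:
  assumes e: "e \<ge> 2" and reg: "e_regular e kap" and p: "is_partition lam"
    and eq: "\<And>v. colcount e kap v = colcount e lam v"
  shows "regularisation e lam = kap"
proof -
  have pk: "is_partition kap" using reg by (simp add: e_regular_def)
  have "card (young lam \<inter> ladder e l) = card (young kap \<inter> ladder e l)" for l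
    using card_ladder_young[OF e p] card_ladder_young[OF e pk] eq by simp
  then have "(\<Union>l\<in>{1..}. top_of_ladder e l (card (young lam \<inter> ladder e l)))
      = (\<Union>l\<in>{1..}. young kap \<inter> ladder e l)"
    using top_of_ladder_regular[OF e reg] by simp
  also have "\<dots> = young kap"
    by (auto simp: young_def ladder_def)
  finally show ?thesis using of_diagram_young[OF pk] by (simp add: regularisation_def)
qed

lemma colval_eventually:
  assumes p: "is_partition lam" and e: "e \<ge> 2" and "lam 1 + conjugate lam 1 \<le> k" "j \<le> k"
  shows "colval e lam j \<le> (e - 1) * k"
proof (cases "j < lam 1")
  case True
  have "conjugate lam (Suc j) \<le> conjugate lam 1" using conjugate_antimono[OF p] by simp
  then have "conjugate lam (Suc j) \<le> (e - 1) * (k - j)"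
    using assms(3) True e mult_le_mono[of 1 "e - 1" "conjugate lam (Suc j)" "k - j"] by simp
  then have "colval e lam j \<le> (e - 1) * (k - j) + (e - 1) * j" by (simp add: colval_def)
  also have "\<dots> = (e - 1) * k" using assms(4) by (simp flip: add_mult_distrib2)
  finally show ?thesis .
next
  case False
  then have "conjugate lam (Suc j) = 0" using conjugate_eq_0_iff[OF p, of "Suc j"] by simp
  then show ?thesis using assms(4) by (simp add: colval_def)
qed

text \<open>The columns of the regularisation are obtained by sorting the numbers \<^const>\<open>colval\<close>.\<close>

lemma regularisation_exists:
  assumes e: "e \<ge> 2" and p: "is_partition lam"
  obtains kap where "e_regular e kap" "\<And>v. colcount e kap v = colcount e lam v"
proof -
  let ?W = "colval e lam" and ?c = "colcount e lam"
  note fin = finite_colval_less[OF e, of lam]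
  have c_mono: "?c u \<le> ?c v" if "u \<le> v" for u v
    unfolding colcount_def using that by (intro card_mono fin) auto
  have ex: "\<exists>v. k < ?c (Suc v)" for k
  proof -
    define v where "v = (\<Sum>j\<le>k. ?W j)"
    have "{..k} \<subseteq> {j. ?W j < Suc v}"
      unfolding v_def by (auto simp: less_Suc_eq_le intro!: member_le_sum)
    from card_mono[OF fin this] show ?thesis unfolding colcount_def by (intro exI[of _ v]) simp
  qed
  \<comment> \<open>The k-th smallest value, counted from 0 with multiplicity, read off the counting
    function.\<close>
  define s where "s k = (LEAST v. k < ?c (Suc v))" for k
  have s1: "k < ?c (Suc (s k))" for k unfolding s_def by (rule LeastI_ex[OF ex])
  have s_le: "s k \<le> v" if "k < ?c (Suc v)" for k v unfolding s_def by (rule Least_le[of "\<lambda>v. k < ?c (Suc v)", OF that])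
  have s_less_iff: "s k < v \<longleftrightarrow> k < ?c v" for k v
  proof (cases v)
    case 0
    then show ?thesis by (simp add: colcount_def)
  next
    case (Suc u)
    then show ?thesis using s_le[of k u] s1[of k] c_mono[of "Suc (s k)" v] by auto
  qed
  have s_Suc: "s k \<le> s (Suc k)" for k
    using s_less_iff[of k "Suc (s (Suc k))"] s1[of "Suc k"] by simp
  have s_ge: "(e - 1) * k \<le> s k" for k
  proof (rule ccontr)
    assume a: "\<not> (e - 1) * k \<le> s k"
    have "{j. ?W j < Suc (s k)} \<subseteq> {..<k}"
    proof
      fix j assume "j \<in> {j. ?W j < Suc (s k)}"
      then have "(e - 1) * j \<le> s k" by (simp add: colval_def)
      then have "(e - 1) * j < (e - 1) * k" using a by linarith
      then show "j \<in> {..<k}" by simp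
    qed
    from card_mono[OF _ this] have "?c (Suc (s k)) \<le> k" by (simp add: colcount_def)
    then show False using s1[of k] by simp
  qed
  \<comment> \<open>Among the columns of value at most \<open>s k\<close>, take the last one. Its
    right neighbour is not among them and exceeds it by at most e - 1, so one more value is
    available.\<close>
  have s_gap: "s (Suc k) \<le> s k + (e - 1)" for k
  proof (rule s_le)
    let ?A = "{j. ?W j < Suc (s k)}"
    have "card ?A > 0" using s1[of k] by (simp add: colcount_def)
    then have ne: "?A \<noteq> {}" by (rule card_gt_0_iff[THEN iffD1, THEN conjunct1])
    define j where "j = Max ?A"
    have j: "j \<in> ?A" using Max_in[OF fin ne] by (simp add: j_def)
    have "Suc j \<notin> ?A"
    proof
      assume "Suc j \<in> ?A"
      from Max_ge[OF fin this] show False by (simp add: j_def)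
    qed
    moreover have "?W (Suc j) < Suc (s k + (e - 1))"
      using j colval_Suc_le[OF p, of e j] by simp
    ultimately have "insert (Suc j) ?A \<subseteq> {j. ?W j < Suc (s k + (e - 1))}" by auto
    from card_mono[OF fin this] have "card (insert (Suc j) ?A) \<le> ?c (Suc (s k + (e - 1)))" by (simp add: colcount_def)
    moreover have "card (insert (Suc j) ?A) = Suc (card ?A)" using \<open>Suc j \<notin> ?A\<close> fin by simp
    ultimately show "Suc k < ?c (Suc (s k + (e - 1)))" using s1[of k] by (simp add: colcount_def)
  qed
  define K where "K = lam 1 + conjugate lam 1"
  have s_ev: "s k = (e - 1) * k" if "k \<ge> K" for k
  proof (rule antisym[OF s_le s_ge])
    have "{..k} \<subseteq> {j. ?W j < Suc ((e - 1) * k)}"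
      using colval_eventually[OF p e] that by (auto simp: K_def less_Suc_eq_le)
    from card_mono[OF fin this] show "k < ?c (Suc ((e - 1) * k))" by (simp add: colcount_def)
  qed
  define xs where "xs = map (\<lambda>k. s k - (e - 1) * k) [0..<K]"
  have r: "restricted e xs"
    unfolding restricted_iff hd0_drop
  proof (intro allI impI)
    fix k assume k: "k < length xs"
    have "(if Suc k < length xs then xs ! Suc k else 0) = s (Suc k) - (e - 1) * Suc k"
      using s_ev[of "Suc k"] k by (auto simp: xs_def)
    moreover have "xs ! k = s k - (e - 1) * k" using k by (simp add: xs_def)
    moreover have "(e - 1) * Suc k = (e - 1) * k + (e - 1)" by simp
    ultimately show "(if Suc k < length xs then xs ! Suc k else 0) \<le> xs ! k \<and>
        xs ! k < (if Suc k < length xs then xs ! Suc k else 0) + e"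
      using s_gap[of k] s_Suc[of k] s_ge[of k] s_ge[of "Suc k"] e by linarith
  qed
  have W: "colval e (of_cols xs) k = s k" for k
    using s_ge[of k] s_ev[of k] unfolding colval_def conjugate_of_cols[OF r]
    by (cases "k < K") (auto simp: xs_def)
  have "colcount e (of_cols xs) v = ?c v" for v
  proof -
    have "{k. colval e (of_cols xs) k < v} = {..<?c v}" unfolding W s_less_iff by auto
    then show ?thesis unfolding colcount_def[of e "of_cols xs"] by simp
  qed
  then show ?thesis using that e_regular_of_cols[OF e r] by blast
qed

lemma
  assumes e: "e \<ge> 2" and p: "is_partition lam"
  shows e_regular_regularisation: "e_regular e (regularisation e lam)"
    and colcount_regularisation: "colcount e (regularisation e lam) v = colcount e lam v"
proof -
  obtain kap where k: "e_regular e kap" "\<And>v. colcount e kap v = colcount e lam v"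
    using regularisation_exists[OF e p] by blast
  have "regularisation e lam = kap" by (rule regularisation_eqI[OF e k(1) p k(2)])
  then show "e_regular e (regularisation e lam)" "colcount e (regularisation e lam) v = colcount e lam v"
    using k by simp_all
qed

section \<open>The greedy chain of columns\<close>

text \<open>The congruence is the one that \<open>rsum_gap\<close> gives for two consecutive kept
  columns of a regular partition; hence the summand 1.\<close>

definition cand :: "nat \<Rightarrow> parts \<Rightarrow> nat \<Rightarrow> nat set" where
  "cand e lam v = {k. k < lam 1 \<and> colval e lam k < v \<and> e dvd v + 1 - colval e lam k}"

text \<open>The initial value is that of the first empty column, as if the chain continued from the
  empty columns, whose consecutive values satisfy the same congruence.\<close>

fun cval :: "nat \<Rightarrow> parts \<Rightarrow> (nat \<Rightarrow> nat) \<Rightarrow> nat \<Rightarrow> nat" where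
  "cval e lam q 0 = (e - 1) * lam 1"
| "cval e lam q (Suc a) = colval e lam (q a)"

text \<open>The last clause fixes the choice between columns with equal value: a chain which enters a
  block of columns of equal height runs through to the left end of this block.\<close>

definition greedy_chain :: "nat \<Rightarrow> parts \<Rightarrow> nat \<Rightarrow> (nat \<Rightarrow> nat) \<Rightarrow> bool" where
  "greedy_chain e lam n q \<longleftrightarrow>
     (\<forall>a<n. q a \<in> cand e lam (cval e lam q a) \<and>
        (\<forall>k\<in>cand e lam (cval e lam q a). colval e lam k \<le> colval e lam (q a))) \<and>
     cand e lam (cval e lam q n) = {} \<and>
     (\<forall>a k. a < n \<and> q a = Suc k \<and> conjugate lam (Suc k) = conjugate lam (Suc (Suc k)) \<longrightarrow>
        Suc a < n \<and> q (Suc a) = k)"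

lemma greedy_chain_exists:
  assumes e: "e \<ge> 2"
  obtains n q where "greedy_chain e lam n q"
proof -
  let ?W = "colval e lam" and ?h = "\<lambda>k. conjugate lam (Suc k)"
  define nxt where "nxt v = (SOME k. k \<in> cand e lam v \<and> (\<forall>k'\<in>cand e lam v. ?W k' \<le> ?W k))" for v
  have nxt: "nxt v \<in> cand e lam v \<and> (\<forall>k'\<in>cand e lam v. ?W k' \<le> ?W (nxt v))" if "cand e lam v \<noteq> {}" for v
    unfolding nxt_def
  proof (rule someI_ex)
    have fin: "finite (?W ` cand e lam v)"
      by (rule finite_imageI, rule finite_subset[of _ "{..<lam 1}"]) (auto simp: cand_def)
    have "Max (?W ` cand e lam v) \<in> ?W ` cand e lam v" using Max_in[OF fin] that by simp
    then obtain k where "k \<in> cand e lam v" "?W k = Max (?W ` cand e lam v)" by auto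
    then show "\<exists>k. k \<in> cand e lam v \<and> (\<forall>k'\<in>cand e lam v. ?W k' \<le> ?W k)"
      using Max_ge[OF fin] by (intro exI[of _ k]) auto
  qed
  define stay where "stay k \<longleftrightarrow> k > 0 \<and> ?h (k - 1) = ?h k" for k
  define q where "q = rec_nat (nxt ((e - 1) * lam 1)) (\<lambda>a k. if stay k then k - 1 else nxt (?W k))"
  have q0: "q 0 = nxt ((e - 1) * lam 1)" and qS: "q (Suc a) = (if stay (q a) then q a - 1 else nxt (?W (q a)))" for a
    by (simp_all add: q_def)
  let ?v = "cval e lam q"
  have step: "q a \<in> cand e lam (?v a) \<and> (\<forall>k\<in>cand e lam (?v a). ?W k \<le> ?W (q a))"
    and stay_cand: "stay (q a) \<Longrightarrow> q a - 1 \<in> cand e lam (?v (Suc a))"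
    if "\<forall>b\<le>a. cand e lam (?v b) \<noteq> {}" for a
    using that
  proof (induction a)
    case 0
    case 1
    then show ?case using nxt by (simp add: q0)
    case 2
    then have q: "q 0 < lam 1" using nxt[of "?v 0"] 2(2) by (simp add: q0 cand_def)
    obtain k where k: "q 0 = Suc k" "?h k = ?h (Suc k)" using 2(1) by (cases "q 0") (auto simp: stay_def)
    then show ?case using q e by (simp add: cand_def colval_def)
  next
    case (Suc a)
    case 1
    then have IH: "q a \<in> cand e lam (?v a)" "stay (q a) \<Longrightarrow> q a - 1 \<in> cand e lam (?v (Suc a))"
      using Suc by auto
    show ?case
    proof (cases "stay (q a)")
      case True
      then obtain k where k: "q a = Suc k" "?h k = ?h (Suc k)" by (cases "q a") (auto simp: stay_def)
      \<comment> \<open>A positive multiple of e is at least e, so a candidate lies at least e - 1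
        below; the left neighbour of equal height attains this bound.\<close>
      have max: "?W j \<le> ?W k" if "j \<in> cand e lam (?v (Suc a))" for j
      proof -
        have "e dvd ?W (Suc k) + 1 - ?W j" "?W j < ?W (Suc k)" using that k by (auto simp: cand_def)
        then have "e \<le> ?W (Suc k) + 1 - ?W j" by (intro dvd_imp_le) auto
        then show ?thesis using k(2) e by (simp add: colval_def)
      qed
      then show ?thesis using IH(2)[OF True] True by (simp add: qS k)
    next
      case False
      have "cand e lam (?v (Suc a)) \<noteq> {}" using 1 by blast
      then show ?thesis using nxt[of "?v (Suc a)"] False by (simp add: qS)
    qed
    case 2
    have q: "q (Suc a) < lam 1"
    proof (cases "stay (q a)")
      case True
      then show ?thesis using IH(1) by (auto simp: qS cand_def)
    next
      case False
      have "cand e lam (?v (Suc a)) \<noteq> {}" using 2(2) by blast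
      then have "nxt (?W (q a)) \<in> cand e lam (?W (q a))" using nxt by simp
      then show ?thesis using False by (simp add: qS cand_def)
    qed
    obtain k where k: "q (Suc a) = Suc k" "?h k = ?h (Suc k)" using 2(1) by (cases "q (Suc a)") (auto simp: stay_def)
    then show ?case using q e by (simp add: cand_def colval_def)
  qed
  have ex: "\<exists>a. cand e lam (?v a) = {}"
  proof (rule ccontr)
    assume "\<nexists>a. cand e lam (?v a) = {}"
    then have dec: "?v (Suc a) < ?v a" for a using step[of a] by (auto simp: cand_def)
    have "?v a + a \<le> ?v 0" for a
      by (induction a) (use dec in \<open>auto simp del: cval.simps intro: order_trans[rotated] simp: less_eq_Suc_le\<close>)
    from this[of "Suc (?v 0)"] show False by simp
  qed
  define n where "n = (LEAST a. cand e lam (?v a) = {})"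
  have n0: "cand e lam (?v n) = {}" unfolding n_def by (rule LeastI_ex[OF ex])
  have ne: "cand e lam (?v a) \<noteq> {}" if "a < n" for a using that not_less_Least unfolding n_def by blast
  have "greedy_chain e lam n q"
    unfolding greedy_chain_def
  proof (intro conjI allI impI ballI n0)
    fix a assume "a < n"
    then have all: "\<forall>b\<le>a. cand e lam (?v b) \<noteq> {}" using ne by simp
    show "q a \<in> cand e lam (?v a)" using step[OF all] by simp
    show "?W k \<le> ?W (q a)" if "k \<in> cand e lam (?v a)" for k using step[OF all] that by simp
  next
    fix a k assume "a < n \<and> q a = Suc k \<and> ?h k = ?h (Suc k)"
    then have a: "a < n" "q a = Suc k" "stay (q a)" by (auto simp: stay_def)
    then have all: "\<forall>b\<le>a. cand e lam (?v b) \<noteq> {}" using ne by simp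
    have "cand e lam (?v (Suc a)) \<noteq> {}" using stay_cand[OF all a(3)] by blast
    then have "Suc a \<noteq> n" using n0 by metis
    then show "Suc a < n" using a by simp
    show "q (Suc a) = k" using a by (simp add: qS)
  qed
  then show ?thesis using that by blast
qed

section \<open>The greedy chain and the nonnegativity of \<open>phi\<close>\<close>

locale column_chain =
  fixes e :: nat and lam :: parts and n :: nat and q :: "nat \<Rightarrow> nat"
  assumes e: "e \<ge> 2" and part: "is_partition lam" and chain: "greedy_chain e lam n q"
begin

abbreviation "W \<equiv> colval e lam"
abbreviation "h k \<equiv> conjugate lam (Suc k)"
abbreviation "v \<equiv> cval e lam q"
abbreviation "w \<equiv> lam 1"

text \<open>By congruences modulo \<open>e\<close>, the columns where \<open>phi\<close> is divisible by \<open>e\<close> are those whose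
  value can occur in the chain.  The comparison of \<^const>\<open>mullineux\<close> with the
  conjugate rests on \<open>phi \<ge> 0\<close>, with equality if and only if \<open>phi\<close> vanishes on the chain.\<close>

definition "C = q ` {..<n}"
definition "ahead k = card {a. a < n \<and> W k < W (q a)}"
definition "phi k = int (Suc k) + int (ahead k) + int ((e - 1) * h k) - int w"

lemma q_cand: "a < n \<Longrightarrow> q a \<in> cand e lam (v a)"
  and q_max: "a < n \<Longrightarrow> k \<in> cand e lam (v a) \<Longrightarrow> W k \<le> W (q a)"
  and cand_end: "cand e lam (v n) = {}"
  and q_stay: "a < n \<Longrightarrow> q a = Suc k \<Longrightarrow> h k = h (Suc k) \<Longrightarrow> Suc a < n \<and> q (Suc a) = k"
  using chain unfolding greedy_chain_def by blast+

lemma q_less: "a < n \<Longrightarrow> q a < w"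
  using q_cand by (auto simp: cand_def)

lemma v_Suc_less: "a < n \<Longrightarrow> v (Suc a) < v a"
  using q_cand by (auto simp: cand_def)

lemma v_less: "a < b \<Longrightarrow> b \<le> n \<Longrightarrow> v b < v a"
proof (induction b rule: less_induct)
  case (less b)
  then obtain c where c: "b = Suc c" by (cases b) auto
  show ?case
  proof (cases "a = c")
    case True
    then show ?thesis using v_Suc_less less c by simp
  next
    case False
    then have "v c < v a" using less c by simp
    moreover have "v b < v c" unfolding c by (rule v_Suc_less) (use less c in simp)
    ultimately show ?thesis by simp
  qed
qed

lemma v_dvd: "a < n \<Longrightarrow> e dvd v a + 1 - v (Suc a)"
  using q_cand by (auto simp: cand_def)

lemma v_cong: "a \<le> n \<Longrightarrow> \<exists>s. v 0 + a = v a + e * s"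
proof (induction a)
  case (Suc a)
  then obtain s where s: "v 0 + a = v a + e * s" by auto
  obtain t where t: "v a + 1 - v (Suc a) = e * t" using v_dvd[of a] Suc(2) by (auto elim: dvdE)
  have "v (Suc a) < v a" using v_Suc_less[of a] Suc(2) by simp
  then have "v 0 + Suc a = v (Suc a) + e * (s + t)" using s t by (simp add: add_mult_distrib2 del: cval.simps)
  then show ?case by blast
qed (auto intro: exI[of _ 0])

lemma W_q_less: "a < b \<Longrightarrow> b < n \<Longrightarrow> W (q b) < W (q a)"
  using v_less[of "Suc a" "Suc b"] by simp

lemma inj_Wq: "inj_on (\<lambda>a. W (q a)) {..<n}"
  using W_q_less by (auto simp: inj_on_def) (metis less_irrefl linorder_neqE_nat)

lemma inj_q: "inj_on q {..<n}"
  using inj_Wq by (auto simp: inj_on_def)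

lemma inj_W_C: "inj_on W C"
  using inj_Wq unfolding C_def by (auto simp: inj_on_def)

lemma finite_C [simp]: "finite C" and card_C [simp]: "card C = n"
  unfolding C_def by (simp_all add: card_image inj_q)

lemma C_less: "k \<in> C \<Longrightarrow> k < w"
  unfolding C_def using q_less by auto

lemma n_le: "n \<le> w"
proof -
  have "C \<subseteq> {..<w}" using C_less by auto
  from card_mono[OF _ this] show ?thesis by simp
qed

lemma ahead_iff: "a < n \<Longrightarrow> W k < W (q a) \<longleftrightarrow> a < ahead k"
proof -
  assume a: "a < n"
  let ?S = "{a. a < n \<and> W k < W (q a)}"
  have down: "b \<in> ?S" if "c \<in> ?S" "b \<le> c" for b c
    using that W_q_less[of b c] by (cases "b = c") auto
  show ?thesis
  proof
    assume "W k < W (q a)"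
    then have "{..a} \<subseteq> ?S" using down[of a] a by auto
    from card_mono[OF _ this] show "a < ahead k" by (simp add: ahead_def)
  next
    assume l: "a < ahead k"
    show "W k < W (q a)"
    proof (rule ccontr)
      assume nl: "\<not> W k < W (q a)"
      have "?S \<subseteq> {..<a}"
      proof
        fix b assume b: "b \<in> ?S"
        show "b \<in> {..<a}" using down[OF b, of a] nl a by (cases "a \<le> b") auto
      qed
      from card_mono[OF _ this] show False using l by (simp add: ahead_def)
    qed
  qed
qed

lemma ahead_le: "ahead k \<le> n"
  unfolding ahead_def by (rule order_trans[OF card_mono[of "{..<n}"]]) auto

lemma ahead_q: "a < n \<Longrightarrow> ahead (q a) = a"
proof -
  assume a: "a < n"
  have "\<not> a < ahead (q a)" using ahead_iff[OF a, of "q a"] by simp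
  moreover have "b < ahead (q a)" if "b < a" for b using ahead_iff[of b "q a"] W_q_less[OF that a] that a by simp
  ultimately show ?thesis by (cases rule: linorder_cases[of "ahead (q a)" a]) auto
qed

lemma less_v_ahead: "ahead k > 0 \<Longrightarrow> W k < v (ahead k)"
proof -
  assume "ahead k > 0"
  then obtain a where a: "ahead k = Suc a" by (cases "ahead k") auto
  then have "a < n" using ahead_le[of k] by simp
  then show ?thesis using ahead_iff[of a k] a by simp
qed

lemma int_e1: "int (e - 1) = int e - 1"
  using e by simp

text \<open>Divisibility of \<open>phi k\<close> translates into k being a candidate after
  \<open>ahead k\<close> steps. The choice made there is at least \<open>W k\<close> by maximality
  and at most \<open>W k\<close> by the meaning of \<open>ahead\<close>.\<close>

lemma chain_value:
  assumes k: "k < w" "W k < v (ahead k)" "int e dvd phi k"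
  shows "ahead k < n \<and> W (q (ahead k)) = W k"
proof -
  let ?A = "ahead k"
  obtain s where s: "v 0 + ?A = v ?A + e * s" using v_cong[OF ahead_le] by blast
  have "int (v ?A + 1 - W k) = phi k + int e * (int w - int s - int (h k) - int k)"
  proof -
    have "int (v ?A) = (int e - 1) * int w + int ?A - int e * int s"
      using arg_cong[OF s, of int] int_e1 by simp
    moreover have "int (W k) = int (h k) + (int e - 1) * int k"
      unfolding colval_def of_nat_add of_nat_mult int_e1 by simp
    moreover have "phi k = int k + 1 + int ?A + (int e - 1) * int (h k) - int w"
      unfolding phi_def of_nat_mult int_e1 by simp
    moreover have "int (v ?A + 1 - W k) = int (v ?A) + 1 - int (W k)" using k(2) by linarith
    ultimately show ?thesis by (simp add: algebra_simps)
  qed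
  then have "int e dvd int (v ?A + 1 - W k)" using k(3) by simp
  then have "e dvd v ?A + 1 - W k" by (simp only: int_dvd_int_iff)
  then have c: "k \<in> cand e lam (v ?A)" using k(1,2) by (simp add: cand_def)
  have n: "?A < n" using c cand_end ahead_le[of k] by (metis empty_iff nat_less_le)
  have "W k \<le> W (q ?A)" by (rule q_max[OF n c])
  moreover have "\<not> W k < W (q ?A)" using ahead_iff[OF n, of k] by simp
  ultimately show ?thesis using n by simp
qed

lemma ahead_antimono: "W j \<le> W k \<Longrightarrow> ahead k \<le> ahead j"
  unfolding ahead_def by (rule card_mono) auto

text \<open>The chain values are distinct integers, so at most \<open>W j - W k\<close> of them fit
  between the two values.\<close>

lemma ahead_le_add:
  assumes "W k \<le> W j"
  shows "ahead k \<le> ahead j + (W j - W k)"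
proof -
  let ?S = "{a. a < n \<and> W k < W (q a)}" and ?T = "{a. a < n \<and> W j < W (q a)}"
  have "card ((\<lambda>a. W (q a)) ` (?S - ?T)) \<le> card {W k<..W j}"
    by (rule card_mono) auto
  moreover have "card ((\<lambda>a. W (q a)) ` (?S - ?T)) = card (?S - ?T)"
    by (rule card_image, rule inj_on_subset[OF inj_Wq]) auto
  moreover have "card ?S \<le> card (?T \<union> (?S - ?T))" by (rule card_mono) auto
  moreover have "card (?T \<union> (?S - ?T)) \<le> card ?T + card (?S - ?T)" by (rule card_Un_le)
  ultimately show ?thesis by (simp add: ahead_def)
qed

lemma phi_last: "w = Suc k \<Longrightarrow> phi k \<ge> 0"
  by (simp add: phi_def)

text \<open>\<open>chain_value\<close> needs \<open>W k\<close> to be below the current chain value.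
  This is clear once some chain value exceeds \<open>W k\<close>, and the remaining case is a
  computation with the initial value. For T = e = 2 the difference would be -1.\<close>

lemma less_v0:
  assumes k: "k < w" and T: "T = 0 \<or> T = e \<and> e \<ge> 3" and eq: "phi k = int T" and A0: "ahead k = 0"
  shows "W k < v 0"
proof -
  let ?h = "int (h k)" and ?e = "int e"
  have w: "int w = int k + 1 + (?e - 1) * ?h - int T"
    using eq unfolding phi_def A0 of_nat_mult int_e1 by simp
  have "int (v 0) - int (W k) = (?e - 1) * ((?e - 1) * ?h + 1 - int T) - ?h"
    unfolding cval.simps(1) colval_def of_nat_add of_nat_mult int_e1 w by (simp add: algebra_simps)
  moreover have "(?e - 1) * ((?e - 1) * ?h + 1 - int T) - ?h > 0"
    using T
  proof
    assume T0: "T = 0"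
    have "?h * 1 \<le> ?h * ((?e - 1) * (?e - 1))"
    proof (rule mult_left_mono)
      show "1 \<le> (?e - 1) * (?e - 1)" using mult_mono[of 1 "?e - 1" 1 "?e - 1"] e by simp
    qed simp
    moreover have "(?e - 1) * ((?e - 1) * ?h + 1 - int T) = ?h * ((?e - 1) * (?e - 1)) + (?e - 1)"
      unfolding T0 by (simp add: algebra_simps)
    moreover have "?e - 1 > 0" using e by simp
    ultimately show ?thesis by linarith
  next
    assume Te: "T = e \<and> e \<ge> 3"
    have "?h \<ge> 2"
    proof (rule ccontr)
      assume "\<not> ?h \<ge> 2"
      then have "(?e - 1) * ?h \<le> (?e - 1) * 1" using e by (intro mult_left_mono) auto
      then have "(?e - 1) * ?h \<le> ?e - 1" by simp
      moreover have "int T = ?e" "int k + 1 \<le> int w" using Te k by simp_all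
      ultimately show False using w by linarith
    qed
    then have "(?e * (?e - 2)) * 2 \<le> (?e * (?e - 2)) * ?h"
      using Te by (intro mult_left_mono) auto
    moreover have "3 * ?e \<le> ?e * ?e" using Te by (intro mult_right_mono) auto
    moreover have "(?e - 1) * ((?e - 1) * ?h + 1 - int T) - ?h = (?e * (?e - 2)) * ?h - (?e * ?e - 2 * ?e + 1)"
      using Te by (simp add: algebra_simps)
    moreover have "(?e * (?e - 2)) * 2 = 2 * (?e * ?e) - 4 * ?e" by (simp add: algebra_simps)
    moreover have "?e \<ge> 3" using Te by simp
    ultimately show ?thesis by linarith
  qed
  ultimately show ?thesis unfolding A0 by linarith
qed

text \<open>The function \<open>phi\<close> drops by at most one from a column to its left neighbour, and the columns
  where it is divisible by \<open>e\<close> carry values of the chain, which stops the descent.\<close>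

lemma phi_step:
  assumes k: "Suc k < w" and T: "T = 0 \<or> T = e \<and> e \<ge> 3" and ge: "phi (Suc k) \<ge> int T"
  shows "phi k \<ge> int T"
proof -
  define d where "d = h k - h (Suc k)"
  have hk: "h k = h (Suc k) + d" using conjugate_antimono[OF part, of "Suc k" "Suc (Suc k)"] by (simp add: d_def)
  have diff: "phi k = phi (Suc k) - 1 + int (ahead k) - int (ahead (Suc k)) + (int e - 1) * int d"
    unfolding phi_def hk of_nat_mult int_e1 by (simp add: algebra_simps)
  have Wk: "int (W k) = int (W (Suc k)) + int d - (int e - 1)"
    unfolding colval_def hk of_nat_add of_nat_mult int_e1 by (simp add: algebra_simps)
  show ?thesis
  proof (cases "d = 0")
    case True
    then have lt: "W k < W (Suc k)" using Wk e by linarith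
    then have ab: "ahead (Suc k) \<le> ahead k" by (intro ahead_antimono) simp
    show ?thesis
    proof (cases "phi (Suc k) = int T")
      case False
      then show ?thesis using diff True ge ab by simp
    next
      case eq: True
      have "W (Suc k) < v (ahead (Suc k))"
      proof (cases "ahead (Suc k) = 0")
        case True
        then show ?thesis using less_v0[OF k T eq] by simp
      qed (use less_v_ahead in blast)
      moreover have "int e dvd phi (Suc k)" using eq T by auto
      ultimately have "ahead (Suc k) < n \<and> W (q (ahead (Suc k))) = W (Suc k)"
        by (rule chain_value[OF k])
      then have "ahead (Suc k) < ahead k" using ahead_iff[of "ahead (Suc k)" k] lt by simp
      then show ?thesis using diff True eq by simp
    qed
  next
    case False
    have "(int e - 1) * int d \<ge> 1 * int d" using e by (intro mult_right_mono) auto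
    show ?thesis
    proof (cases "W k \<le> W (Suc k)")
      case True
      then have "ahead (Suc k) \<le> ahead k" by (rule ahead_antimono)
      then show ?thesis using diff ge False \<open>(int e - 1) * int d \<ge> 1 * int d\<close> by linarith
    next
      case F: False
      then have "ahead (Suc k) \<le> ahead k + (W k - W (Suc k))" by (intro ahead_le_add) simp
      then show ?thesis using diff ge F Wk \<open>(int e - 1) * int d \<ge> 1 * int d\<close> e by linarith
    qed
  qed
qed

text \<open>The threshold 0, started at the last column, gives nonnegativity; the threshold e bounds
  \<open>phi\<close> from above to the right of a tight chain column, see
  \<open>phi_less\<close>.\<close>

lemma phi_left_closed:
  assumes "j \<le> k" "k < w" and T: "T = 0 \<or> T = e \<and> e \<ge> 3" and ge: "phi k \<ge> int T"
  shows "phi j \<ge> int T"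
  using assms(1,2,4)
proof (induction k rule: dec_induct)
  case (step k)
  then show ?case using phi_step[OF _ T, of k] by simp
qed simp

lemma phi_nonneg:
  assumes "k < w"
  shows "phi k \<ge> 0"
  using phi_left_closed[of k "w - 1" 0] phi_last[of "w - 1"] assms by simp

end

lemma left_closed_interval:
  fixes B :: "nat set"
  assumes "finite B" "\<And>k. k \<in> B \<Longrightarrow> b \<le> k" "\<And>j k. k \<in> B \<Longrightarrow> b \<le> j \<Longrightarrow> j \<le> k \<Longrightarrow> j \<in> B"
  shows "B = {b..<b + card B}"
proof (cases "B = {}")
  case False
  define M where "M = Max B"
  have M: "M \<in> B" "\<And>k. k \<in> B \<Longrightarrow> k \<le> M"
    using Max_in[OF assms(1) False] Max_ge[OF assms(1)] by (simp_all add: M_def)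
  have "b \<le> M" using assms(2) M(1) .
  have B: "B = {b..<Suc M}"
  proof (intro set_eqI iffI)
    fix k assume "k \<in> B"
    then show "k \<in> {b..<Suc M}" using assms(2)[of k] M(2)[of k] by simp
  next
    fix k assume "k \<in> {b..<Suc M}"
    then show "k \<in> B" using assms(3)[OF M(1), of k] by simp
  qed
  show ?thesis unfolding B using \<open>b \<le> M\<close> by simp
qed simp

text \<open>A value at most u drops below u unless it is u itself and its column is kept, which
  happens for at most one column. The lemma serves both for \<open>nu\<close> and for the peeled
  regularisation.\<close>

lemma colcount_decrement:
  assumes e: "e \<ge> 2" and inj: "inj_on (colval e lam) A"
    and dec: "\<And>k. colval e mu k = (if k \<in> A then colval e lam k else colval e lam k - 1)"
    and pos: "\<And>k. k \<notin> A \<Longrightarrow> 1 \<le> colval e lam k"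
  shows "colcount e lam (Suc u) = colcount e mu u + of_bool (u \<in> colval e lam ` A)"
proof -
  let ?W = "colval e lam"
  have split: "{k. ?W k < Suc u} = {k. colval e mu k < u} \<union> {k \<in> A. ?W k = u}"
  proof -
    have "?W k < Suc u \<longleftrightarrow> colval e mu k < u \<or> (k \<in> A \<and> ?W k = u)" for k
      unfolding dec using pos[of k] by (cases "k \<in> A") force+
    then show ?thesis by blast
  qed
  have fin: "finite {k \<in> A. ?W k = u}"
    by (rule finite_subset[OF _ finite_colval_less[OF e, of lam "Suc u"]]) auto
  have "card {k \<in> A. ?W k = u} = of_bool (u \<in> ?W ` A)"
  proof (cases "u \<in> ?W ` A")
    case True
    then obtain k where k: "k \<in> A" "?W k = u" by auto
    then have "{k \<in> A. ?W k = u} = {k}" using inj by (auto simp: inj_on_def)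
    then show ?thesis using True by simp
  next
    case False
    then have none: "{k \<in> A. ?W k = u} = {}" by auto
    show ?thesis unfolding none using False by simp
  qed
  moreover have "card {k. ?W k < Suc u} = card {k. colval e mu k < u} + card {k \<in> A. ?W k = u}"
    unfolding split by (rule card_Un_disjoint[OF finite_colval_less[OF e] fin]) (auto simp: dec)
  ultimately show ?thesis by (simp add: colcount_def)
qed

section \<open>The partition \<open>nu\<close> left after the other columns have lost a node\<close>

context column_chain
begin

text \<open>Defined by rows: after a loss in all nonempty columns row i would be the old row i + 1,
  and each kept column of height i restores one node. The column form is
  \<open>conjugate_nu\<close>.\<close>

definition "nu i = (if i = 0 then 0 else lam (Suc i) + card {k \<in> C. h k = i})"

text \<open>All kept columns, including the empty ones; with these the kept values have no largest
  element and can be compared with those of the regularisation.\<close>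

definition "S = C \<union> {w..}"

lemma h_ge_iff: "i \<ge> 1 \<Longrightarrow> i \<le> h k \<longleftrightarrow> k < lam i"
  using conjugate_ge_iff[OF part, of i "Suc k"] by (simp add: Suc_le_eq)

lemma h_eq_iff: "i \<ge> 1 \<Longrightarrow> h k = i \<longleftrightarrow> lam (Suc i) \<le> k \<and> k < lam i"
  using h_ge_iff[of i k] h_ge_iff[of "Suc i" k] by auto

lemma h_pos: "k < w \<Longrightarrow> h k \<ge> 1"
  using h_ge_iff[of 1 k] by simp

lemma h_zero: "w \<le> k \<Longrightarrow> h k = 0"
  using h_ge_iff[of 1 k] by simp

lemma C_stay: "Suc k \<in> C \<Longrightarrow> h k = h (Suc k) \<Longrightarrow> k \<in> C"
proof -
  assume "Suc k \<in> C" "h k = h (Suc k)"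
  moreover from this obtain a where a: "a < n" "q a = Suc k" by (force simp: C_def)
  ultimately have "Suc a < n \<and> q (Suc a) = k" by (intro q_stay)
  then show "k \<in> C" by (auto simp: C_def)
qed

lemma C_left_closed:
  assumes "k \<in> C" "j \<le> k" "h j = h k"
  shows "j \<in> C"
  using assms(2,1,3)
proof (induction j rule: inc_induct)
  case (step m)
  have "h m \<ge> h (Suc m)" "h (Suc m) \<ge> h k"
    using conjugate_antimono[OF part, of "Suc m" "Suc (Suc m)"]
      conjugate_antimono[OF part, of "Suc (Suc m)" "Suc k"] step by simp_all
  then have "h (Suc m) = h k" "h m = h (Suc m)" using step by simp_all
  then show ?case using C_stay step by blast
qed

lemma nu_block: "i \<ge> 1 \<Longrightarrow> {k \<in> C. h k = i} = {lam (Suc i)..<nu i}"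
proof -
  assume i: "i \<ge> 1"
  have "{k \<in> C. h k = i} = {lam (Suc i)..<lam (Suc i) + card {k \<in> C. h k = i}}"
  proof (rule left_closed_interval)
    fix k assume "k \<in> {k \<in> C. h k = i}"
    then show "lam (Suc i) \<le> k" using h_eq_iff[OF i] by simp
  next
    fix j k assume k: "k \<in> {k \<in> C. h k = i}" "lam (Suc i) \<le> j" "j \<le> k"
    then have "h j = i" using h_eq_iff[OF i] by simp
    then show "j \<in> {k \<in> C. h k = i}" using C_left_closed[of k j] k by simp
  qed simp
  then show ?thesis using i by (simp add: nu_def)
qed

lemma nu_ge: "i \<ge> 1 \<Longrightarrow> lam (Suc i) \<le> nu i"
  by (simp add: nu_def)

lemma nu_le: "nu i \<le> lam i"
proof (cases "i = 0")
  case False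
  then have i: "i \<ge> 1" by simp
  have "{k \<in> C. h k = i} \<subseteq> {lam (Suc i)..<lam i}"
  proof
    fix k assume "k \<in> {k \<in> C. h k = i}"
    then show "k \<in> {lam (Suc i)..<lam i}" using h_eq_iff[OF i, of k] by simp
  qed
  from card_mono[OF _ this] have "nu i \<le> lam (Suc i) + (lam i - lam (Suc i))" using i by (simp add: nu_def)
  moreover have "lam (Suc i) \<le> lam i" using partition_antimono[OF part i, of "Suc i"] by simp
  ultimately show ?thesis by simp
qed (simp add: nu_def)

lemma is_partition_nu: "is_partition nu"
  unfolding is_partition_def
proof (intro conjI allI impI)
  show "nu 0 = 0" by (simp add: nu_def)
  show "nu (i + 1) \<le> nu i" if "i \<ge> 1" for i
    using order_trans[OF nu_le nu_ge[OF that]] by simp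
  show "finite {i. i \<ge> 1 \<and> nu i \<noteq> 0}"
  proof (rule finite_subset[OF _ partition_finite[OF part]], rule subsetI)
    fix i assume "i \<in> {i. i \<ge> 1 \<and> nu i \<noteq> 0}"
    then show "i \<in> {i. i \<ge> 1 \<and> lam i \<noteq> 0}" using nu_le[of i] by simp
  qed
qed

lemma conjugate_nu: "conjugate nu (Suc k) = (if k < w \<and> k \<notin> C then h k - 1 else h k)"
proof (cases "k < w")
  case False
  then have "conjugate nu (Suc k) = 0"
    using conjugate_eq_0_iff[OF is_partition_nu, of "Suc k"] nu_le[of 1] by simp
  then show ?thesis using False h_zero[of k] by simp
next
  case True
  define H where "H = h k"
  have H: "H \<ge> 1" "lam (Suc H) \<le> k" "k < lam H" using h_pos[OF True] h_eq_iff[of H k] by (simp_all add: H_def)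
  have iff: "i \<le> conjugate nu (Suc k) \<longleftrightarrow> i < H \<or> i = H \<and> k \<in> C" if i: "i \<ge> 1" for i
  proof -
    have *: "i \<le> conjugate nu (Suc k) \<longleftrightarrow> k < nu i"
      using conjugate_ge_iff[OF is_partition_nu i, of "Suc k"] by (simp add: Suc_le_eq)
    consider "i < H" | "i = H" | "i > H" by linarith
    then show ?thesis
    proof cases
      case 1
      then have "k < lam (Suc i)" using partition_antimono[OF part, of "Suc i" H] H by simp
      then have "k < nu i" using nu_ge[OF i] by simp
      then show ?thesis using * 1 by simp
    next
      case 2
      have "k \<in> C \<longleftrightarrow> k < nu i" using nu_block[OF i] H(2) 2 by (auto simp: H_def)
      then show ?thesis using * 2 by simp
    next
      case 3
      then have "lam i \<le> k" using partition_antimono[OF part, of "Suc H" i] H by simp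
      then show ?thesis using * 3 nu_le[of i] by simp
    qed
  qed
  let ?c = "conjugate nu (Suc k)"
  show ?thesis
  proof (cases "k \<in> C")
    case True
    then show ?thesis using iff[of H] iff[of ?c] H by (cases "?c = 0") (auto simp: H_def)
  next
    case False
    have "\<not> H \<le> ?c" using iff[of H] H False by simp
    moreover have "H - 1 \<le> ?c" using iff[of "H - 1"] by (cases "H - 1 = 0") auto
    ultimately show ?thesis using False \<open>k < w\<close> by (simp add: H_def)
  qed
qed

lemma colval_nu: "colval e nu k = (if k \<in> S then W k else W k - 1)"
  using h_pos[of k] h_zero[of k] by (auto simp: colval_def conjugate_nu S_def)

lemma W_C_less: "k \<in> C \<Longrightarrow> W k < (e - 1) * w"
proof -
  assume "k \<in> C"
  then obtain a where "a < n" "k = q a" by (auto simp: C_def)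
  then show ?thesis using v_less[of 0 "Suc a"] by simp
qed

lemma W_ge_w: "w \<le> k \<Longrightarrow> W k = (e - 1) * k"
  using h_zero[of k] by (simp add: colval_def)

lemma inj_W_S: "inj_on W S"
  unfolding S_def inj_on_Un
proof (intro conjI)
  show "inj_on W {w..}" using e W_ge_w by (auto simp: inj_on_def)
  have ge: "(e - 1) * w \<le> W k" if "w \<le> k" for k using W_ge_w[OF that] that by simp
  have "x \<noteq> y" if x: "x \<in> W ` C" and y: "y \<in> W ` {w..}" for x y
  proof -
    have "x < (e - 1) * w" using x W_C_less by auto
    moreover have "(e - 1) * w \<le> y" using y ge by auto
    ultimately show ?thesis by simp
  qed
  then show "W ` (C - {w..}) \<inter> W ` ({w..} - C) = {}" by blast
qed (rule inj_W_C)

lemma colcount_nu: "colcount e lam (Suc u) = colcount e nu u + of_bool (u \<in> W ` S)"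
proof (rule colcount_decrement[OF e inj_W_S colval_nu])
  show "1 \<le> W k" if "k \<notin> S" for k using that h_pos[of k] by (simp add: S_def colval_def)
qed

text \<open>Each step lowers the chain value by at least e - 1, since the difference plus 1 is a
  positive multiple of e. As values stay positive, \<open>n < w\<close> follows, so some column does
  lose a node.\<close>

lemma v_upper: "a \<le> n \<Longrightarrow> v a + (e - 1) * a \<le> (e - 1) * w"
proof (induction a)
  case (Suc a)
  have "e \<le> v a + 1 - v (Suc a)"
    using v_dvd[of a] v_Suc_less[of a] Suc(2) by (intro dvd_imp_le) auto
  moreover have "v a + (e - 1) * a \<le> (e - 1) * w" using Suc by simp
  moreover have "(e - 1) * Suc a = (e - 1) * a + (e - 1)" by simp
  ultimately show ?case using e by linarith
qed simp

lemma n_less: "w > 0 \<Longrightarrow> n < w"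
proof (cases n)
  case (Suc a)
  have a: "a < n" using Suc by simp
  have "v n = h (q a) + (e - 1) * q a" using Suc by (simp add: colval_def)
  then have "0 < v n" using h_pos[OF q_less[OF a]] by linarith
  then have "(e - 1) * n < (e - 1) * w" using v_upper[of n] by linarith
  then show ?thesis by simp
qed simp

lemma card_young_nu:
  assumes "lam \<noteq> empty_partition"
  shows "card (young nu) < card (young lam)"
proof (rule psubset_card_mono[OF finite_young[OF part]])
  have sub: "young nu \<subseteq> young lam" using nu_le by (auto simp: young_def intro: order_trans)
  have "\<not> {..<w} \<subseteq> C"
    using card_mono[OF finite_C, of "{..<w}"] n_less partition_1_pos[OF part assms] by auto
  then obtain k where k: "k < w" "k \<notin> C" by auto
  have "(h k, Suc k) \<in> young lam" "(h k, Suc k) \<notin> young nu"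
    using h_pos[OF k(1)] h_ge_iff[of "h k" k] conjugate_ge_iff[OF is_partition_nu, of "h k" "Suc k"] k
    by (auto simp: young_def conjugate_nu)
  with sub show "young nu \<subset> young lam" by blast
qed

end

section \<open>Peeling the regularisation\<close>

definition next_in :: "nat set \<Rightarrow> nat \<Rightarrow> nat \<Rightarrow> bool" where
  "next_in A v u \<longleftrightarrow> u \<in> A \<and> v < u \<and> (\<forall>x\<in>A. v < x \<longrightarrow> u \<le> x)"

text \<open>A set \<open>A\<close> of values with this property is determined, from the top down, by \<open>R\<close> and by its
  large elements.\<close>

definition chain_closed :: "nat \<Rightarrow> nat set \<Rightarrow> nat set \<Rightarrow> bool" where
  "chain_closed e R A \<longleftrightarrow> (\<forall>v. v \<in> A \<longleftrightarrow> v \<in> R \<and> (\<exists>u. next_in A v u \<and> e dvd u + 1 - v))"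

lemma chain_closed_unique:
  assumes "chain_closed e R A" "chain_closed e R B" "\<And>v. v \<ge> N \<Longrightarrow> v \<in> A \<longleftrightarrow> v \<in> B"
  shows "A = B"
proof -
  have "v \<in> A \<longleftrightarrow> v \<in> B" for v
  proof (induction "N - v" arbitrary: v rule: less_induct)
    case less
    show ?case
    proof (cases "v \<ge> N")
      case False
      have eq: "x \<in> A \<longleftrightarrow> x \<in> B" if "v < x" for x using less[of x] that False by simp
      have "next_in A v u \<longleftrightarrow> next_in B v u" for u unfolding next_in_def using eq by blast
      then show ?thesis using assms(1,2) unfolding chain_closed_def by blast
    qed (use assms(3) in blast)
  qed
  then show ?thesis by blast
qed

lemma range_colval_iff:
  assumes "e \<ge> 2"
  shows "u \<in> range (colval e lam) \<longleftrightarrow> colcount e lam u < colcount e lam (Suc u)"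
proof
  assume "u \<in> range (colval e lam)"
  then obtain k where "u = colval e lam k" by auto
  then have "k \<in> {k. colval e lam k < Suc u}" "k \<notin> {k. colval e lam k < u}" by auto
  moreover have "{k. colval e lam k < u} \<subseteq> {k. colval e lam k < Suc u}" by auto
  ultimately have "{k. colval e lam k < u} \<subset> {k. colval e lam k < Suc u}" by blast
  then show "colcount e lam u < colcount e lam (Suc u)"
    unfolding colcount_def by (intro psubset_card_mono finite_colval_less[OF assms])
next
  assume lt: "colcount e lam u < colcount e lam (Suc u)"
  show "u \<in> range (colval e lam)"
  proof (rule ccontr)
    assume "u \<notin> range (colval e lam)"
    then have "colval e lam k < Suc u \<longleftrightarrow> colval e lam k < u" for k
      by (auto simp: less_Suc_eq)
    then show False using lt by (simp add: colcount_def)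
  qed
qed

context column_chain
begin

text \<open>Below the initial value this is the greedy rule, the next larger kept value being
  \<open>v (ahead k)\<close>. From there on the kept values are the multiples of e - 1 belonging to
  the empty columns.\<close>

lemma chain_closed_W_S: "chain_closed e (range W) (W ` S)"
proof -
  have ge: "(e - 1) * w \<le> W k" if "w \<le> k" for k using W_ge_w[OF that] that by simp
  have nxt_C: "next_in (W ` S) x (v a)" if a: "a \<le> n" and x: "x < v a" "\<And>b. b < n \<Longrightarrow> x < W (q b) \<Longrightarrow> b < a" for a x
    unfolding next_in_def
  proof (intro conjI ballI impI)
    show "v a \<in> W ` S"
    proof (cases a)
      case 0
      then show ?thesis using W_ge_w[of w] by (auto simp: S_def intro!: image_eqI[of _ _ w])
    next
      case (Suc b)
      then show ?thesis using a by (auto simp: S_def C_def)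
    qed
  next
    fix y assume y: "y \<in> W ` S" "x < y"
    have v0: "v a \<le> (e - 1) * w" using v_upper[OF a] by linarith
    show "v a \<le> y"
    proof (cases "y \<in> W ` C")
      case True
      then obtain b where b: "b < n" "y = W (q b)" by (auto simp: C_def)
      then have "Suc b \<le> a" using x(2)[of b] y(2) by simp
      then have "v a \<le> v (Suc b)" using v_less[of "Suc b" a] a by (cases "Suc b = a") auto
      then show ?thesis using b by simp
    next
      case False
      then obtain k where "w \<le> k" "y = W k" using y by (auto simp: S_def)
      then show ?thesis using ge[of k] v0 by simp
    qed
  qed (use x in simp)
  have "x \<in> W ` S \<longleftrightarrow> x \<in> range W \<and> (\<exists>u. next_in (W ` S) x u \<and> e dvd u + 1 - x)" for x
  proof (cases "x < (e - 1) * w")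
    case True
    show ?thesis
    proof
      assume "x \<in> W ` S"
      then obtain k where k: "k \<in> S" "x = W k" by auto
      then have "k \<in> C" using True ge[of k] by (auto simp: S_def)
      then obtain a where a: "a < n" "k = q a" by (auto simp: C_def)
      have "next_in (W ` S) x (v a)"
      proof (rule nxt_C)
        show "x < v a" using v_Suc_less[OF a(1)] k(2) a(2) by simp
        fix b assume "b < n" "x < W (q b)"
        then show "b < a" using ahead_iff[of b k] ahead_q[OF a(1)] k(2) a(2) by simp
      qed (use a in simp)
      moreover have "e dvd v a + 1 - x" using v_dvd[OF a(1)] k(2) a(2) by simp
      ultimately show "x \<in> range W \<and> (\<exists>u. next_in (W ` S) x u \<and> e dvd u + 1 - x)" using k(2) by blast
    next
      assume "x \<in> range W \<and> (\<exists>u. next_in (W ` S) x u \<and> e dvd u + 1 - x)"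
      then obtain k u where k: "x = W k" and u: "next_in (W ` S) x u" "e dvd u + 1 - x" by auto
      have kw: "k < w" using ge[of k] True k by (cases "k < w") auto
      let ?A = "ahead k"
      have xA: "x < v ?A"
        using less_v_ahead[of k] True k by (cases "?A = 0") auto
      have "next_in (W ` S) x (v ?A)"
        by (rule nxt_C[OF ahead_le xA]) (use ahead_iff[of _ k] k in simp)
      then have "u = v ?A" using u(1) unfolding next_in_def by (meson le_antisym)
      then have c: "k \<in> cand e lam (v ?A)" using kw xA u(2) k by (simp add: cand_def)
      then have "?A < n" using cand_end ahead_le[of k] by (cases "?A = n") auto
      have "W k \<le> W (q ?A)" by (rule q_max[OF \<open>?A < n\<close> c])
      moreover have "\<not> W k < W (q ?A)" using ahead_iff[OF \<open>?A < n\<close>, of k] by simp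
      ultimately have "x = W (q ?A)" using k by simp
      then show "x \<in> W ` S" using \<open>?A < n\<close> by (auto simp: S_def C_def)
    qed
  next
    case False
    have top: "y \<in> W ` S \<longleftrightarrow> (\<exists>j\<ge>w. y = (e - 1) * j)" if "y \<ge> (e - 1) * w" for y
    proof
      assume "y \<in> W ` S"
      then obtain k where k: "k \<in> S" "y = W k" by auto
      then have "k \<notin> C" using W_C_less[of k] that by auto
      then have "w \<le> k" using k by (simp add: S_def)
      then show "\<exists>j\<ge>w. y = (e - 1) * j" using k(2) W_ge_w by blast
    next
      assume "\<exists>j\<ge>w. y = (e - 1) * j"
      then obtain j where j: "j \<ge> w" "y = (e - 1) * j" by blast
      then have "y = W j" using W_ge_w by simp
      then show "y \<in> W ` S" using j by (auto simp: S_def)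
    qed
    \<comment> \<open>The next kept value above x is (e - 1) (j + 1), so the congruence reads e dvd
      e - r with r < e - 1, which forces r = 0.\<close>
    define j where "j = x div (e - 1)"
    define r where "r = x mod (e - 1)"
    have xj: "x = (e - 1) * j + r" "r < e - 1" using e by (simp_all add: j_def r_def)
    have jw: "w \<le> j"
    proof (rule ccontr)
      assume "\<not> w \<le> j"
      then have "(e - 1) * Suc j \<le> (e - 1) * w" by (intro mult_le_mono2) simp
      then show False using False xj by simp
    qed
    have nxt: "next_in (W ` S) x ((e - 1) * Suc j)"
      unfolding next_in_def
    proof (intro conjI ballI impI)
      have "W (Suc j) = (e - 1) * Suc j" using jw by (intro W_ge_w) simp
      moreover have "Suc j \<in> S" using jw by (simp add: S_def)
      ultimately show "(e - 1) * Suc j \<in> W ` S" by (metis imageI)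
      show "x < (e - 1) * Suc j" using xj by simp
      fix y assume y: "y \<in> W ` S" "x < y"
      then obtain i where i: "y = (e - 1) * i" using top[of y] False by auto
      then have "(e - 1) * j < (e - 1) * i" using y(2) xj by linarith
      then have "Suc j \<le> i" by simp
      then show "(e - 1) * Suc j \<le> y" unfolding i by (rule mult_le_mono2)
    qed
    have d: "(e - 1) * Suc j + 1 - x = e - r" using xj e by simp
    show ?thesis
    proof
      assume "x \<in> W ` S"
      then obtain i where i: "x = (e - 1) * i" using top[of x] False by auto
      then have "r = 0" by (simp add: r_def)
      then have "e dvd (e - 1) * Suc j + 1 - x" unfolding d by simp
      then show "x \<in> range W \<and> (\<exists>u. next_in (W ` S) x u \<and> e dvd u + 1 - x)"
        using nxt \<open>x \<in> W ` S\<close> by blast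
    next
      assume "x \<in> range W \<and> (\<exists>u. next_in (W ` S) x u \<and> e dvd u + 1 - x)"
      then obtain u where u: "next_in (W ` S) x u" "e dvd u + 1 - x" by blast
      have "u = (e - 1) * Suc j" using u(1) nxt unfolding next_in_def by (meson le_antisym)
      then have "e dvd e - r" using u(2) d by simp
      then have "e \<le> e - r" using xj by (intro dvd_imp_le) auto
      then have "r = 0" using e by simp
      then show "x \<in> W ` S" using top[of x] False xj(1) jw by auto
    qed
  qed
  then show ?thesis unfolding chain_closed_def by blast
qed

end

definition rzero :: "nat \<Rightarrow> parts \<Rightarrow> nat set" where
  "rzero e lam = {k. e dvd rsum e lam k}"

lemma usum_drop:
  assumes "is_partition lam" "lam 1 \<le> K"
  shows "tok e (drop k (cols lam K)) = usum e lam k"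
proof -
  obtain m where m: "K = lam 1 + m" using assms(2) le_Suc_ex by blast
  show ?thesis
    unfolding m cols_add[OF assms(1) order_refl] usum_def by (simp add: drop_append)
qed

lemma usum_gap:
  assumes p: "is_partition lam" and "m \<le> k" "k \<in> rzero e lam" "\<And>j. m \<le> j \<Longrightarrow> j < k \<Longrightarrow> j \<notin> rzero e lam"
  shows "usum e lam m = usum e lam (Suc k) + (k - m)"
  using assms(2,4)
proof (induction m rule: inc_induct)
  case base
  then show ?case using usum_rec[OF p, of e k] assms(3) by (simp add: rzero_def)
next
  case (step m)
  have "usum e lam m = usum e lam (Suc m) + 1"
    using usum_rec[OF p, of e m] step(4)[of m] step(2) by (simp add: rzero_def)
  moreover have "usum e lam (Suc m) = usum e lam (Suc k) + (k - Suc m)"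
    by (rule step(3)) (use step(4) in simp)
  ultimately show ?case using step(2) by simp
qed

text \<open>All columns strictly between two consecutive kept ones lose a node, so
  \<open>usum\<close> changes by their number. This turns divisibility of running sums into the
  congruence between values that defines the chain.\<close>

lemma rsum_gap:
  assumes p: "is_partition lam" and e: "e \<ge> 2" and "j < k" "k \<in> rzero e lam" "\<And>i. j < i \<Longrightarrow> i < k \<Longrightarrow> i \<notin> rzero e lam"
  shows "rsum e lam j + colval e lam k + 1 = rsum e lam k + colval e lam j + e * (k - j)"
proof -
  define d where "d = k - Suc j"
  have k: "k = Suc (j + d)" using assms(3) by (simp add: d_def)
  obtain f where f: "e = Suc f" using e by (cases e) auto
  have "usum e lam (Suc j) = usum e lam (Suc k) + (k - Suc j)"
    by (rule usum_gap[OF p]) (use assms(3-) in auto)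
  then have "usum e lam (Suc j) = usum e lam (Suc k) + d" by (simp add: d_def)
  then show ?thesis
    unfolding rsum_def colval_def by (simp add: k f algebra_simps)
qed

lemma rzero_ge: "is_partition lam \<Longrightarrow> lam 1 \<le> k \<Longrightarrow> k \<in> rzero e lam"
  using rsum_eq_0 by (simp add: rzero_def)

lemma rzero_next:
  assumes "is_partition lam"
  obtains k where "j < k" "k \<in> rzero e lam" "\<And>i. j < i \<Longrightarrow> i < k \<Longrightarrow> i \<notin> rzero e lam"
proof -
  let ?P = "\<lambda>k. j < k \<and> k \<in> rzero e lam"
  have "?P (Suc j + lam 1)" using rzero_ge[OF assms, of "Suc j + lam 1"] by simp
  from LeastI[of ?P, OF this] not_less_Least[of _ ?P] show ?thesis
    by (intro that[of "LEAST k. ?P k"]) blast+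
qed

text \<open>For consecutive kept columns, equal values would make both \<open>rsum e kap j\<close>
  and its successor divisible by e.\<close>

lemma colval_rzero_strict:
  assumes e: "e \<ge> 2" and reg: "e_regular e kap" and jk: "j \<in> rzero e kap" "k \<in> rzero e kap" "j < k"
  shows "colval e kap j < colval e kap k"
proof -
  have p: "is_partition kap" using reg by (simp add: e_regular_def)
  obtain l where l: "j < l" "l \<in> rzero e kap" "\<And>i. j < i \<Longrightarrow> i < l \<Longrightarrow> i \<notin> rzero e kap"
    using rzero_next[OF p] by blast
  have "\<not> k < l" using l(3)[of k] jk by auto
  then have le: "colval e kap j \<le> colval e kap l" "colval e kap l \<le> colval e kap k"
    using colval_mono[OF e reg] l by simp_all
  have "colval e kap j \<noteq> colval e kap l"
  proof
    assume "colval e kap j = colval e kap l"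
    then have "rsum e kap j + 1 = rsum e kap l + e * (l - j)" using rsum_gap[OF p e l] by simp
    moreover have "e dvd rsum e kap l + e * (l - j)" using l(2) by (simp add: rzero_def)
    ultimately have "e dvd rsum e kap j + 1" by simp
    then have "e dvd 1" using jk(1) by (simp only: rzero_def mem_Collect_eq dvd_add_right_iff)
    then show False using e by simp
  qed
  then show ?thesis using le by simp
qed

lemma inj_colval_rzero:
  assumes e: "e \<ge> 2" and reg: "e_regular e kap"
  shows "inj_on (colval e kap) (rzero e kap)"
proof (rule inj_onI)
  fix j k assume "j \<in> rzero e kap" "k \<in> rzero e kap" "colval e kap j = colval e kap k"
  then show "j = k"
    using colval_rzero_strict[OF e reg, of j k] colval_rzero_strict[OF e reg, of k j]
    by (cases rule: linorder_cases[of j k]) auto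
qed

lemma chain_closed_rzero:
  assumes e: "e \<ge> 2" and reg: "e_regular e kap"
  shows "chain_closed e (range (colval e kap)) (colval e kap ` rzero e kap)"
  unfolding chain_closed_def
proof (intro allI iffI)
  let ?W = "colval e kap" and ?E = "rzero e kap"
  have p: "is_partition kap" using reg by (simp add: e_regular_def)
  {
    fix x assume "x \<in> ?W ` ?E"
    then obtain k where k: "k \<in> ?E" "x = ?W k" by auto
    obtain l where l: "k < l" "l \<in> ?E" "\<And>i. k < i \<Longrightarrow> i < l \<Longrightarrow> i \<notin> ?E"
      using rzero_next[OF p] by blast
    have lt: "?W k < ?W l" by (rule colval_rzero_strict[OF e reg k(1) l(2,1)])
    have "next_in (?W ` ?E) x (?W l)"
      unfolding next_in_def
    proof (intro conjI ballI impI)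
      fix y assume y: "y \<in> ?W ` ?E" "x < y"
      then obtain j where j: "j \<in> ?E" "y = ?W j" by auto
      have "\<not> j \<le> k" using colval_mono[OF e reg, of j k] y(2) j(2) k(2) by auto
      then have "l \<le> j" using l(3)[of j] j(1) by (cases "l \<le> j") auto
      then show "?W l \<le> y" using colval_mono[OF e reg] j(2) by simp
    qed (use lt k l in auto)
    moreover have "e dvd ?W l + 1 - x"
    proof -
      have "?W l + 1 - x = rsum e kap l + e * (l - k) - rsum e kap k"
        using rsum_gap[OF p e l] lt k(2) by linarith
      then show ?thesis using k(1) l(2) by (simp add: rzero_def dvd_diff_nat)
    qed
    ultimately show "x \<in> range ?W \<and> (\<exists>u. next_in (?W ` ?E) x u \<and> e dvd u + 1 - x)"
      using k(2) by blast
  next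
    fix x assume "x \<in> range ?W \<and> (\<exists>u. next_in (?W ` ?E) x u \<and> e dvd u + 1 - x)"
    then obtain k u where k: "x = ?W k" and u: "next_in (?W ` ?E) x u" "e dvd u + 1 - x" by auto
    then obtain l where l: "l \<in> ?E" "u = ?W l" by (auto simp: next_in_def)
    have xu: "?W k < ?W l" using u(1) k l(2) by (simp add: next_in_def)
    then have kl: "k < l" using colval_mono[OF e reg, of l k] by (cases "k < l") auto
    show "x \<in> ?W ` ?E"
    proof (rule ccontr)
      assume no: "x \<notin> ?W ` ?E"
      have gap: "i \<notin> ?E" if i: "k < i" "i < l" for i
      proof
        assume iE: "i \<in> ?E"
        have "?W k \<le> ?W i" using colval_mono[OF e reg, of k i] i by simp
        moreover have "?W k \<noteq> ?W i" using no iE k by auto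
        moreover have "?W i < ?W l" by (rule colval_rzero_strict[OF e reg iE l(1) i(2)])
        ultimately have "x < ?W i" "\<not> u \<le> ?W i" using k l(2) by simp_all
        then show False using u(1) iE unfolding next_in_def by blast
      qed
      have "rsum e kap k = rsum e kap l + e * (l - k) - (?W l + 1 - ?W k)"
        using rsum_gap[OF p e kl l(1) gap] xu by linarith
      moreover have "e dvd rsum e kap l + e * (l - k)" using l(1) by (simp add: rzero_def)
      ultimately have "e dvd rsum e kap k" using u(2) k l(2) by (simp add: dvd_diff_nat)
      then show False using no k by (auto simp: rzero_def)
    qed
  }
qed

lemma colval_of_cols_peel:
  assumes e: "e \<ge> 2" and reg: "e_regular e kap" and K: "kap 1 \<le> K"
  shows "colval e (of_cols (peel e (cols kap K))) k =
    (if k \<in> rzero e kap then colval e kap k else colval e kap k - 1)"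
proof -
  have p: "is_partition kap" using reg by (simp add: e_regular_def)
  note r = restricted_peel[OF e restricted_cols[OF e reg K]]
  show ?thesis
  proof (cases "k < K")
    case True
    have "peel e (cols kap K) ! k = conjugate kap (Suc k) - (if k \<in> rzero e kap then 0 else 1)"
      using nth_peel[of k "cols kap K" e] True usum_drop[OF p K]
      by (simp add: rzero_def rsum_def)
    then show ?thesis
      using True rsum_eps_le[OF e reg, of k] unfolding colval_def conjugate_of_cols[OF r]
      by (simp add: rzero_def)
  next
    case False
    then have "k \<in> rzero e kap" using rzero_ge[OF p, of k e] K by simp
    moreover have "conjugate kap (Suc k) = 0" using conjugate_eq_0_iff[OF p, of "Suc k"] K False by simp
    ultimately show ?thesis using False unfolding colval_def conjugate_of_cols[OF r] by simp
  qed
qed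

lemma colcount_of_cols_peel:
  assumes e: "e \<ge> 2" and reg: "e_regular e kap" and K: "kap 1 \<le> K"
  shows "colcount e kap (Suc u) = colcount e (of_cols (peel e (cols kap K))) u
    + of_bool (u \<in> colval e kap ` rzero e kap)"
proof (rule colcount_decrement[OF e inj_colval_rzero[OF e reg] colval_of_cols_peel[OF e reg K]])
  show "1 \<le> colval e kap k" if "k \<notin> rzero e kap" for k
    using rsum_eps_le[OF e reg, of k] that by (simp add: rzero_def colval_def)
qed

lemma tok_eq_card:
  assumes p: "is_partition kap" and K: "kap 1 \<le> K"
  shows "tok e (cols kap K) + card (rzero e kap \<inter> {..<K}) = K"
proof -
  have "usum e kap 0 + card (rzero e kap \<inter> {..<m}) = usum e kap m + m" for m
  proof (induction m)
    case (Suc m)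
    have "rzero e kap \<inter> {..<Suc m} = (if m \<in> rzero e kap then insert m (rzero e kap \<inter> {..<m}) else rzero e kap \<inter> {..<m})"
      by (auto simp: less_Suc_eq)
    then have "card (rzero e kap \<inter> {..<Suc m}) = card (rzero e kap \<inter> {..<m}) + (if m \<in> rzero e kap then 1 else 0)"
      by simp
    then show ?case using Suc usum_rec[OF p, of e m] by (auto simp: rzero_def)
  qed simp
  moreover have "usum e kap 0 = tok e (cols kap K)" using usum_drop[OF p K, of e 0] by simp
  moreover have "usum e kap K = 0" using K by (simp add: usum_def)
  ultimately show ?thesis by (metis add_0)
qed

context column_chain
begin

abbreviation "kap \<equiv> regularisation e lam"

text \<open>Regularisation preserves the set of all values, both sets of kept values obey the same
  rule relative to it, and both consist of the multiples of e - 1 far up; such a set is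
  unique.\<close>

lemma values_eq: "W ` S = colval e kap ` rzero e kap"
proof (rule chain_closed_unique)
  note reg = e_regular_regularisation[OF e part]
  have p: "is_partition kap" using reg by (simp add: e_regular_def)
  have "range (colval e kap) = range W"
    using range_colval_iff[OF e, of _ kap] range_colval_iff[OF e, of _ lam]
      colcount_regularisation[OF e part] by (intro set_eqI) simp
  then show "chain_closed e (range W) (colval e kap ` rzero e kap)"
    using chain_closed_rzero[OF e reg] by simp
  show "chain_closed e (range W) (W ` S)" by (rule chain_closed_W_S)
  define N where "N = Suc ((e - 1) * (w + kap 1))"
  fix x assume x: "N \<le> x"
  have large: "colval e kap k = (e - 1) * k" if "kap 1 \<le> k" for k
    using conjugate_eq_0_iff[OF p, of "Suc k"] that by (simp add: colval_def)
  have 1: "x \<in> W ` S \<longleftrightarrow> (\<exists>k\<ge>w. x = (e - 1) * k)"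
  proof -
    have "k \<notin> C" if "x = W k" for k using W_C_less[of k] x that by (auto simp: N_def add_mult_distrib2)
    then have "x \<in> W ` S \<longleftrightarrow> x \<in> W ` {w..}" by (auto simp: S_def)
    also have "\<dots> \<longleftrightarrow> (\<exists>k\<ge>w. x = (e - 1) * k)" using W_ge_w by force
    finally show ?thesis .
  qed
  have 2: "x \<in> colval e kap ` rzero e kap \<longleftrightarrow> (\<exists>k\<ge>kap 1. x = (e - 1) * k)"
  proof
    assume "x \<in> colval e kap ` rzero e kap"
    then obtain k where k: "x = colval e kap k" by auto
    have "kap 1 \<le> k"
    proof (rule ccontr)
      assume "\<not> kap 1 \<le> k"
      then have "x \<le> (e - 1) * kap 1" using colval_mono[OF e reg, of k "kap 1"] large[of "kap 1"] k by simp
      then show False using x by (simp add: N_def add_mult_distrib2)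
    qed
    then show "\<exists>k\<ge>kap 1. x = (e - 1) * k" using large k by blast
  next
    assume "\<exists>k\<ge>kap 1. x = (e - 1) * k"
    then obtain k where "kap 1 \<le> k" "x = colval e kap k" using large by metis
    then show "x \<in> colval e kap ` rzero e kap" using rzero_ge[OF p] by blast
  qed
  have big: "w + kap 1 \<le> k" if "x = (e - 1) * k" for k
  proof -
    have "(e - 1) * (w + kap 1) < (e - 1) * k" using x that by (simp only: N_def)
    then show ?thesis by simp
  qed
  show "x \<in> W ` S \<longleftrightarrow> x \<in> colval e kap ` rzero e kap"
    unfolding 1 2 using big by (metis add_leD1 add_leD2)
qed

text \<open>On both sides every value falls by one except for the same kept values, so the counting
  functions remain equal.\<close>

lemma regularisation_nu:
  assumes K: "kap 1 \<le> K"
  shows "regularisation e nu = of_cols (peel e (cols kap K))"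
proof (rule regularisation_eqI[OF e _ is_partition_nu])
  note reg = e_regular_regularisation[OF e part]
  show "e_regular e (of_cols (peel e (cols kap K)))"
    by (rule e_regular_of_cols[OF e restricted_peel[OF e restricted_cols[OF e reg K]]])
  show "colcount e (of_cols (peel e (cols kap K))) u = colcount e nu u" for u
    using colcount_of_cols_peel[OF e reg K, of u] colcount_nu[of u] values_eq
      colcount_regularisation[OF e part, of "Suc u"] by simp
qed

text \<open>Kept columns are counted by their values below (e - 1) L for a common bound L: the chain
  and the empty columns give n + (L - w), and the losses in the regularisation are the remaining w -
  n.\<close>

lemma tok_regularisation:
  assumes K: "kap 1 \<le> K"
  shows "tok e (cols kap K) = w - n"
proof -
  note reg = e_regular_regularisation[OF e part]
  have p: "is_partition kap" using reg by (simp add: e_regular_def)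
  define L where "L = K + w"
  have L: "kap 1 \<le> L" "w \<le> L" using K by (simp_all add: L_def)
  let ?X = "colval e kap ` rzero e kap"
  have large: "colval e kap L = (e - 1) * L"
    using conjugate_eq_0_iff[OF p, of "Suc L"] L by (simp add: colval_def)
  have "colval e kap ` (rzero e kap \<inter> {..<L}) = ?X \<inter> {..<(e - 1) * L}"
  proof (intro set_eqI iffI)
    fix x assume "x \<in> colval e kap ` (rzero e kap \<inter> {..<L})"
    then show "x \<in> ?X \<inter> {..<(e - 1) * L}"
      using colval_rzero_strict[OF e reg _ rzero_ge[OF p L(1), of e]] large by auto
  next
    fix x assume "x \<in> ?X \<inter> {..<(e - 1) * L}"
    then obtain k where k: "k \<in> rzero e kap" "x = colval e kap k" "colval e kap k < (e - 1) * L" by auto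
    have "(e - 1) * k < (e - 1) * L" using k(3) unfolding colval_def by linarith
    then have "k < L" by simp
    then show "x \<in> colval e kap ` (rzero e kap \<inter> {..<L})" using k by auto
  qed
  moreover have "W ` (C \<union> {w..<L}) = W ` S \<inter> {..<(e - 1) * L}"
  proof (intro set_eqI iffI)
    fix x assume "x \<in> W ` (C \<union> {w..<L})"
    then obtain k where k: "x = W k" "k \<in> C \<union> {w..<L}" by (rule imageE)
    then have kC: "k \<in> C \<or> w \<le> k \<and> k < L" by simp
    have "W k < (e - 1) * L"
    proof (cases "k \<in> C")
      case True
      show ?thesis using W_C_less[OF True] mult_le_mono2[OF L(2)] by (rule order_less_le_trans)
    next
      case False
      then show ?thesis using kC W_ge_w[of k] e by simp
    qed
    then show "x \<in> W ` S \<inter> {..<(e - 1) * L}" using k(1) kC by (auto simp: S_def)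
  next
    fix x assume "x \<in> W ` S \<inter> {..<(e - 1) * L}"
    then obtain k where k: "k \<in> S" "x = W k" "W k < (e - 1) * L" by auto
    have "(e - 1) * k < (e - 1) * L" using k(3) unfolding colval_def by linarith
    then have "k < L" by simp
    then show "x \<in> W ` (C \<union> {w..<L})" using k by (auto simp: S_def)
  qed
  ultimately have "card (colval e kap ` (rzero e kap \<inter> {..<L})) = card (W ` (C \<union> {w..<L}))"
    using values_eq by simp
  moreover have "card (colval e kap ` (rzero e kap \<inter> {..<L})) = card (rzero e kap \<inter> {..<L})"
    by (rule card_image, rule inj_on_subset[OF inj_colval_rzero[OF e reg]]) auto
  moreover have "card (W ` (C \<union> {w..<L})) = card (C \<union> {w..<L})"
    by (rule card_image, rule inj_on_subset[OF inj_W_S]) (auto simp: S_def)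
  moreover have "card (C \<union> {w..<L}) = n + (L - w)"
    using card_Un_disjoint[OF finite_C, of "{w..<L}"] C_less by fastforce
  ultimately have "tok e (cols kap L) + (n + (L - w)) = L" using tok_eq_card[OF p L(1), of e] by simp
  moreover have "tok e (cols kap L) = tok e (cols kap K)"
    unfolding L_def cols_add[OF p K] by simp
  ultimately show ?thesis using L(2) n_le by linarith
qed

end

section \<open>Majorisation\<close>

text \<open>A dual form of partial sums that does not depend on the order of the sequence, so that
  it can be computed before sorting. Cutting off at T is harmless when
  \<open>t <= s t\<close>.\<close>

definition excess :: "(nat \<Rightarrow> nat) \<Rightarrow> nat \<Rightarrow> nat" where
  "excess s T = (\<Sum>t\<le>T. T - s t)"

lemma excess_extend:
  assumes "\<And>t. t \<le> s t" "T \<le> M"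
  shows "(\<Sum>t\<le>M. T - s t) = excess s T"
  unfolding excess_def
proof (rule sum.mono_neutral_right)
  show "\<forall>t\<in>{..M} - {..T}. T - s t = 0"
  proof
    fix t assume "t \<in> {..M} - {..T}"
    then show "T - s t = 0" using assms(1)[of t] by simp
  qed
qed (use assms(2) in auto)

lemma partial_sums_le:
  fixes s s' :: "nat \<Rightarrow> nat"
  assumes "\<And>t. t \<le> s t" "\<And>t. t \<le> s' t" "mono s'" "\<And>T. excess s T \<le> excess s' T"
  shows "(\<Sum>t<j. s' t) \<le> (\<Sum>t<j. s t)"
proof -
  \<comment> \<open>At this threshold only the first j terms of the increasing sequence contribute
    to its excess, and none of them is truncated.\<close>
  define T where "T = s' j"
  have jT: "j \<le> T" using assms(2) by (simp add: T_def)
  have "(\<Sum>t<j. T - s t) \<le> excess s T"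
    unfolding excess_def by (rule sum_mono2) (use jT in auto)
  also have "\<dots> \<le> excess s' T" by (rule assms(4))
  also have "\<dots> = (\<Sum>t<j. T - s' t)"
    unfolding excess_def
  proof (rule sum.mono_neutral_right)
    show "\<forall>t\<in>{..T} - {..<j}. T - s' t = 0"
    proof
      fix t assume "t \<in> {..T} - {..<j}"
      then have "s' j \<le> s' t" by (intro monoD[OF assms(3)]) simp
      then show "T - s' t = 0" by (simp add: T_def)
    qed
  qed (use jT in auto)
  finally have "(\<Sum>t<j. T - s t) \<le> (\<Sum>t<j. T - s' t)" .
  moreover have "(\<Sum>t<j. T) \<le> (\<Sum>t<j. T - s t) + (\<Sum>t<j. s t)"
    unfolding sum.distrib[symmetric] by (rule sum_mono) simp
  moreover have "(\<Sum>t<j. T) = (\<Sum>t<j. T - s' t) + (\<Sum>t<j. s' t)"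
    unfolding sum.distrib[symmetric]
  proof (rule sum.cong)
    fix t assume "t \<in> {..<j}"
    then have "s' t \<le> T" unfolding T_def by (intro monoD[OF assms(3)]) simp
    then show "T = T - s' t + s' t" by simp
  qed simp
  ultimately show ?thesis by linarith
qed

lemma partial_sums_eq:
  fixes s s' :: "nat \<Rightarrow> nat"
  assumes "\<And>j. (\<Sum>t<j. s' t) = (\<Sum>t<j. s t)"
  shows "s' = s"
proof
  fix t show "s' t = s t" using assms[of "Suc t"] assms[of t] by simp
qed

lemma excess_eq_imp_eq:
  assumes "\<And>t. t \<le> s t" "\<And>t. t \<le> s' t" "mono s" "mono s'" "\<And>T. excess s T = excess s' T"
  shows "s' = s"
  by (rule partial_sums_eq, rule antisym; rule partial_sums_le) (use assms in simp_all)

text \<open>Exchange of summation expresses the excess by the counting function; hence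
  regularisation preserves it.\<close>

lemma excess_colval:
  assumes e: "e \<ge> 2"
  shows "excess (colval e mu) T = (\<Sum>u\<le>T. colcount e mu u)"
proof -
  have 1: "T - colval e mu t = (\<Sum>u\<le>T. of_bool (colval e mu t < u))" for t
  proof -
    have "(\<Sum>u\<le>T. of_bool (colval e mu t < u)) = card ({..T} \<inter> {u. colval e mu t < u})"
      by (simp add: sum.If_cases of_bool_def)
    moreover have "{..T} \<inter> {u. colval e mu t < u} = {colval e mu t<..T}" by auto
    ultimately show ?thesis by simp
  qed
  have 2: "colcount e mu u = (\<Sum>t\<le>T. of_bool (colval e mu t < u))" if "u \<le> T" for u
  proof -
    have "(\<Sum>t\<le>T. of_bool (colval e mu t < u)) = card ({..T} \<inter> {t. colval e mu t < u})"
      by (simp add: sum.If_cases of_bool_def)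
    moreover have "{..T} \<inter> {t. colval e mu t < u} = {t. colval e mu t < u}"
      using that order_le_less_trans[OF colval_ge[OF e]] by fastforce
    ultimately show ?thesis by (simp add: colcount_def)
  qed
  have "excess (colval e mu) T = (\<Sum>t\<le>T. \<Sum>u\<le>T. of_bool (colval e mu t < u))"
    unfolding excess_def by (rule sum.cong[OF refl 1])
  also have "\<dots> = (\<Sum>u\<le>T. \<Sum>t\<le>T. of_bool (colval e mu t < u))" by (rule sum.swap)
  also have "\<dots> = (\<Sum>u\<le>T. colcount e mu u)" by (rule sum.cong[OF refl]) (simp only: 2 atMost_iff)
  finally show ?thesis .
qed

lemma excess_Suc:
  assumes "\<And>t. t \<le> s t"
  shows "excess (case_nat m (\<lambda>t. s t + c)) T = (T - m) + excess s (T - c)"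
proof (cases T)
  case 0
  then show ?thesis by (simp add: excess_def)
next
  case (Suc M)
  show ?thesis
  proof (cases "c = 0")
    case True
    have "excess (case_nat m (\<lambda>t. s t + c)) T = (T - m) + (\<Sum>t\<le>M. T - s t)"
      unfolding excess_def Suc by (subst sum.atMost_Suc_shift) (simp add: True)
    moreover have "excess s T = (\<Sum>t\<le>M. T - s t)"
      using assms[of "Suc M"] by (simp add: excess_def Suc)
    ultimately show ?thesis by (simp add: True)
  next
    case False
    have "excess (case_nat m (\<lambda>t. s t + c)) T = (T - m) + (\<Sum>t\<le>M. (T - c) - s t)"
      unfolding excess_def Suc by (subst sum.atMost_Suc_shift) (simp add: add.commute)
    moreover have "(\<Sum>t\<le>M. (T - c) - s t) = excess s (T - c)"
      by (rule excess_extend[OF assms]) (use Suc False in simp)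
    ultimately show ?thesis by simp
  qed
qed

lemma card_block: "T - (x + c) = T - (x + b + c) + card {k \<in> {x..<x + b}. Suc k + c \<le> T}" for x b c T :: nat
proof (induction b)
  case (Suc b)
  have "{k \<in> {x..<x + Suc b}. Suc k + c \<le> T} =
      (if Suc (x + b) + c \<le> T then insert (x + b) {k \<in> {x..<x + b}. Suc k + c \<le> T} else {k \<in> {x..<x + b}. Suc k + c \<le> T})"
    by (auto simp: less_Suc_eq)
  then have "card {k \<in> {x..<x + Suc b}. Suc k + c \<le> T} = card {k \<in> {x..<x + b}. Suc k + c \<le> T} + (if Suc (x + b) + c \<le> T then 1 else 0)"
    by simp
  then show ?case using Suc by (auto split: if_splits)
qed simp

section \<open>The row values of \<open>lam\<close> compared with those of \<open>nu\<close>\<close>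

context column_chain
begin

definition "rowvals = colval e (conjugate lam)"
text \<open>The unsorted values belonging to the column list that starts with the number w - n of
  lost nodes and continues with the columns of the regularised conjugate of \<open>nu\<close>;
  moving these one place to the right costs e - 1.\<close>

definition "rowvals' = case_nat (w - n) (\<lambda>t. colval e (conjugate nu) t + (e - 1))"

lemma rowvals: "rowvals t = lam (Suc t) + (e - 1) * t"
  unfolding rowvals_def colval_def conjugate_conjugate[OF part] ..

lemma rowvals': "rowvals' 0 = w - n" "rowvals' (Suc t) = nu (Suc t) + (e - 1) * Suc t"
  unfolding rowvals'_def by (simp_all add: colval_def conjugate_conjugate[OF is_partition_nu])

lemma ahead_le_phi: "k < w \<Longrightarrow> w - ahead k \<le> Suc k + (e - 1) * h k"
  using phi_nonneg[of k] unfolding phi_def by linarith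

lemma phi_zero_iff: "k < w \<Longrightarrow> phi k = 0 \<longleftrightarrow> Suc k + (e - 1) * h k = w - ahead k"
  using phi_nonneg[of k] ahead_le[of k] n_le unfolding phi_def by linarith

text \<open>Shrinking the first entry from w to w - n gains a unit at each position w - a, and these
  are the numbers \<open>w - ahead k\<close> on the chain. Growing \<open>lam (Suc i)\<close> to
  \<open>nu i\<close> costs a unit for each kept column of height i, at position
  \<open>Suc k + (e - 1) * i\<close>.\<close>

lemma excess_rowvals:
  "excess rowvals' T + card {k \<in> C. Suc k + (e - 1) * h k \<le> T} = excess rowvals T + card {k \<in> C. w - ahead k \<le> T}"
proof -
  let ?f = "\<lambda>k. Suc k + (e - 1) * h k"
  have 0: "T - rowvals' 0 = T - rowvals 0 + card {k \<in> C. w - ahead k \<le> T}"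
  proof -
    have "{k \<in> C. w - ahead k \<le> T} = q ` {a. a < n \<and> w - a \<le> T}"
      using ahead_q by (auto simp: C_def)
    moreover have "card (q ` {a. a < n \<and> w - a \<le> T}) = card {a. a < n \<and> w - a \<le> T}"
      by (rule card_image, rule inj_on_subset[OF inj_q]) auto
    moreover have "card ((\<lambda>a. w - Suc a) ` {a. a < n \<and> w - a \<le> T}) = card {a. a < n \<and> w - a \<le> T}"
    proof (rule card_image, rule inj_onI)
      fix a b assume "a \<in> {a. a < n \<and> w - a \<le> T}" "b \<in> {a. a < n \<and> w - a \<le> T}" "w - Suc a = w - Suc b"
      then show "a = b" using n_le unfolding mem_Collect_eq by linarith
    qed
    moreover have "(\<lambda>a. w - Suc a) ` {a. a < n \<and> w - a \<le> T} = {k \<in> {w - n..<w - n + n}. Suc k + 0 \<le> T}"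
    proof (intro set_eqI iffI)
      fix k assume "k \<in> (\<lambda>a. w - Suc a) ` {a. a < n \<and> w - a \<le> T}"
      then obtain a where a: "a < n" "w - a \<le> T" "k = w - Suc a" by blast
      then have "Suc k = w - a" using n_le by simp
      then show "k \<in> {k \<in> {w - n..<w - n + n}. Suc k + 0 \<le> T}" using a n_le by simp
    next
      fix k assume "k \<in> {k \<in> {w - n..<w - n + n}. Suc k + 0 \<le> T}"
      then have k: "w - n \<le> k" "k < w" "Suc k \<le> T" using n_le by simp_all
      then have "w - Suc k < n" "w - (w - Suc k) = Suc k" "k = w - Suc (w - Suc k)" by simp_all
      then show "k \<in> (\<lambda>a. w - Suc a) ` {a. a < n \<and> w - a \<le> T}"
        using k by (intro image_eqI[of _ _ "w - Suc k"]) simp_all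
    qed
    ultimately have "card {k \<in> C. w - ahead k \<le> T} = card {k \<in> {w - n..<w - n + n}. Suc k + 0 \<le> T}" by simp
    then show ?thesis using card_block[of T "w - n" 0 n] n_le by (simp add: rowvals rowvals')
  qed
  have S: "T - rowvals (Suc t) = T - rowvals' (Suc t) + card {k \<in> C. h k = Suc t \<and> ?f k \<le> T}" for t
  proof -
    define b where "b = card {k \<in> C. h k = Suc t}"
    have nu: "nu (Suc t) = lam (Suc (Suc t)) + b" by (simp add: nu_def b_def)
    have "{k \<in> C. h k = Suc t \<and> ?f k \<le> T} =
        {k \<in> {k \<in> C. h k = Suc t}. Suc k + (e - 1) * Suc t \<le> T}" by auto
    then have "{k \<in> C. h k = Suc t \<and> ?f k \<le> T} =
        {k \<in> {lam (Suc (Suc t))..<lam (Suc (Suc t)) + b}. Suc k + (e - 1) * Suc t \<le> T}"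
      using nu_block[of "Suc t"] nu by simp
    then show ?thesis using card_block[of T "lam (Suc (Suc t))" "(e - 1) * Suc t" b]
      unfolding rowvals rowvals' nu by simp
  qed
  have sums: "excess s (Suc M) = (Suc M - s 0) + (\<Sum>t\<le>M. Suc M - s (Suc t))" for s M
    unfolding excess_def by (rule sum.atMost_Suc_shift)
  show ?thesis
  proof (cases T)
    case 0
    then have "{k \<in> C. ?f k \<le> T} = {}" by auto
    moreover have "{k \<in> C. w - ahead k \<le> T} = {}"
    proof -
      have "\<not> w - ahead k \<le> T" if "k \<in> C" for k
        using that ahead_q n_le 0 by (auto simp: C_def)
      then show ?thesis by blast
    qed
    ultimately show ?thesis using 0 by (simp add: excess_def)
  next
    case (Suc M)
    have "(\<Sum>t\<le>M. card {k \<in> C. h k = Suc t \<and> ?f k \<le> T}) = card (\<Union>t\<in>{..M}. {k \<in> C. h k = Suc t \<and> ?f k \<le> T})"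
      by (rule card_UN_disjoint[symmetric]) auto
    also have "(\<Union>t\<in>{..M}. {k \<in> C. h k = Suc t \<and> ?f k \<le> T}) = {k \<in> C. ?f k \<le> T}"
    proof (intro set_eqI iffI)
      fix k assume k: "k \<in> {k \<in> C. ?f k \<le> T}"
      then have "h k \<ge> 1" using h_pos C_less by simp
      then obtain t where t: "h k = Suc t" by (cases "h k") auto
      have "1 * h k \<le> (e - 1) * h k" using e by (intro mult_le_mono1) simp
      moreover have "Suc k + (e - 1) * h k \<le> Suc M" using k Suc by blast
      ultimately have "t \<le> M" using t by linarith
      then show "k \<in> (\<Union>t\<in>{..M}. {k \<in> C. h k = Suc t \<and> ?f k \<le> T})" using k t by auto
    qed auto
    finally have cards: "(\<Sum>t\<le>M. card {k \<in> C. h k = Suc t \<and> ?f k \<le> T}) = card {k \<in> C. ?f k \<le> T}" .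
    have "(\<Sum>t\<le>M. T - rowvals (Suc t)) = (\<Sum>t\<le>M. T - rowvals' (Suc t)) + card {k \<in> C. ?f k \<le> T}"
      unfolding S sum.distrib cards ..
    then show ?thesis using 0 unfolding Suc sums by simp
  qed
qed

lemma front_subset: "{k \<in> C. Suc k + (e - 1) * h k \<le> T} \<subseteq> {k \<in> C. w - ahead k \<le> T}"
proof
  fix k assume k: "k \<in> {k \<in> C. Suc k + (e - 1) * h k \<le> T}"
  then have "w - ahead k \<le> Suc k + (e - 1) * h k" using ahead_le_phi[OF C_less] by blast
  also have "\<dots> \<le> T" using k by blast
  finally show "k \<in> {k \<in> C. w - ahead k \<le> T}" using k by blast
qed

lemma excess_rowvals_le: "excess rowvals T \<le> excess rowvals' T"
  using excess_rowvals[of T] card_mono[OF _ front_subset, of T] by simp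

definition "tight \<longleftrightarrow> (\<forall>k\<in>C. phi k = 0)"

lemma tight_iff_excess: "tight \<longleftrightarrow> (\<forall>T. excess rowvals' T = excess rowvals T)"
proof
  assume tight
  then have "Suc k + (e - 1) * h k = w - ahead k" if "k \<in> C" for k
    using phi_zero_iff[OF C_less[OF that]] that by (simp add: tight_def)
  then have "{k \<in> C. Suc k + (e - 1) * h k \<le> T} = {k \<in> C. w - ahead k \<le> T}" for T
    by (intro Collect_cong) (metis (no_types))
  then show "\<forall>T. excess rowvals' T = excess rowvals T" using excess_rowvals by simp
next
  assume eq: "\<forall>T. excess rowvals' T = excess rowvals T"
  show tight
    unfolding tight_def
  proof (rule ballI, rule ccontr)
    fix k assume k: "k \<in> C" "phi k \<noteq> 0"
    \<comment> \<open>At this threshold k is already counted among the gains but not yet among the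
      costs.\<close>
    let ?T = "w - ahead k"
    have "\<not> Suc k + (e - 1) * h k \<le> ?T"
      using phi_zero_iff[OF C_less[OF k(1)]] ahead_le_phi[OF C_less[OF k(1)]] k(2) by linarith
    then have "k \<notin> {k \<in> C. Suc k + (e - 1) * h k \<le> ?T}" "k \<in> {k \<in> C. w - ahead k \<le> ?T}"
      using k(1) by simp_all
    then have "{k \<in> C. Suc k + (e - 1) * h k \<le> ?T} \<subset> {k \<in> C. w - ahead k \<le> ?T}"
      using front_subset[of ?T] by blast
    then have "card {k \<in> C. Suc k + (e - 1) * h k \<le> ?T} < card {k \<in> C. w - ahead k \<le> ?T}"
      by (intro psubset_card_mono) simp_all
    then show False using excess_rowvals[of ?T] eq by simp
  qed
qed

text \<open>This keeps w - n in first place after sorting. Apply \<open>phi_nonneg\<close> to the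
  column k = \<open>nu i\<close>. If it has height i, then either \<open>phi k > 0\<close> or, by
  \<open>chain_value\<close>, \<open>ahead k < n\<close>, and both gain the missing unit; if it is
  lower, the height difference does.\<close>

lemma rowvals'_ge: "w - n \<le> rowvals' t"
proof (cases t)
  case (Suc t')
  define i k where "i = t" and "k = nu i"
  have i: "i \<ge> 1" using Suc by (simp add: i_def)
  have r: "rowvals' t = k + (e - 1) * i" using Suc by (simp add: rowvals' i_def k_def)
  show ?thesis
  proof (cases "k < w")
    case True
    have ph: "w \<le> Suc k + ahead k + (e - 1) * h k" using ahead_le_phi[OF True] by linarith
    show ?thesis
    proof (cases "k < lam i")
      case k_lam: True
      have hk: "h k = i" using h_eq_iff[OF i, of k] nu_ge[OF i] k_lam by (simp add: k_def)
      show ?thesis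
      proof (cases "phi k = 0")
        case True
        have "W k < v (ahead k)"
          using less_v0[OF \<open>k < w\<close>, of 0] True less_v_ahead[of k] by (cases "ahead k = 0") simp_all
        from chain_value[OF \<open>k < w\<close> this] have "ahead k < n" using True by simp
        then show ?thesis using ph[unfolded hk] r by linarith
      next
        case False
        then have "Suc k + (e - 1) * h k \<noteq> w - ahead k" using phi_zero_iff[OF \<open>k < w\<close>] by simp
        then have "w - ahead k < Suc k + (e - 1) * h k" using ahead_le_phi[OF \<open>k < w\<close>] by simp
        then show ?thesis using r ahead_le[of k] unfolding hk by linarith
      qed
    next
      case False
      then have "h k < i" using h_ge_iff[OF i, of k] by simp
      then have "(e - 1) * Suc (h k) \<le> (e - 1) * i" by (intro mult_le_mono2) simp
      then show ?thesis using ph r ahead_le[of k] e by simp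
    qed
  qed (use r in simp)
qed (simp add: rowvals')

lemma rowvals'_lower: "w - n \<le> colval e (conjugate nu) t + (e - 1)"
  using rowvals'_ge[of "Suc t"] by (simp add: rowvals'_def)

end

section \<open>Comparison of the columns of the Mullineux image and of the regularised
  conjugate\<close>

definition toks :: "nat \<Rightarrow> parts \<Rightarrow> nat \<Rightarrow> nat" where
  "toks e lam t = tok e ((peel e ^^ t) (cols (regularisation e lam) (regularisation e lam 1)))"

definition dcols :: "nat \<Rightarrow> parts \<Rightarrow> nat \<Rightarrow> nat" where
  "dcols e lam t = conjugate (regularisation e (conjugate lam)) (Suc t)"

lemma colval_dcols: "colval e (regularisation e (conjugate lam)) t = dcols e lam t + (e - 1) * t"
  by (simp add: dcols_def colval_def)

lemma funpow_peel_append_zeros: "(peel e ^^ t) (xs @ replicate m 0) = (peel e ^^ t) xs @ replicate m 0"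
  by (induction t) auto

lemma toks_eq:
  assumes "e \<ge> 2" "is_partition lam" "regularisation e lam 1 \<le> K"
  shows "tok e ((peel e ^^ t) (cols (regularisation e lam) K)) = toks e lam t"
proof -
  have p: "is_partition (regularisation e lam)"
    using e_regular_regularisation[OF assms(1,2)] by (simp add: e_regular_def)
  obtain m where m: "K = regularisation e lam 1 + m" using assms(3) le_Suc_ex by blast
  show ?thesis
    unfolding m cols_add[OF p order_refl] funpow_peel_append_zeros toks_def by simp
qed

lemma mullineux_regularisation_iff:
  assumes e: "e \<ge> 2" and p: "is_partition lam"
  shows "mullineux e (regularisation e lam) = regularisation e (conjugate lam) \<longleftrightarrow> toks e lam = dcols e lam"
proof -
  let ?R = "regularisation e (conjugate lam)" and ?xs = "cols (regularisation e lam) (regularisation e lam 1)"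
  note reg = e_regular_regularisation[OF e p]
  note r = restricted_cols[OF e reg order_refl]
  have pR: "is_partition ?R"
    using e_regular_regularisation[OF e is_partition_conjugate[OF p]] by (simp add: e_regular_def)
  define N where "N = sum_list ?xs"
  have m: "mullineux e (regularisation e lam) = of_cols (tokseq e ?xs N)"
    using mullineux_of_cols[OF e r, of N] of_cols_cols[OF e reg order_refl] by (simp add: N_def)
  have rt: "restricted e (tokseq e ?xs N)"
    by (rule restricted_tokseq[OF e r funpow_peel_zero[OF e r]]) (simp add: N_def)
  have zero: "toks e lam t = 0" if "t \<ge> N" for t
    using funpow_peel_zero[OF e r, of t] that by (simp add: toks_def N_def)
  have c: "conjugate (of_cols (tokseq e ?xs N)) (Suc t) = toks e lam t" for t
    unfolding conjugate_of_cols[OF rt] using zero[of t] by (simp add: tokseq_def toks_def)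
  show ?thesis
  proof
    assume "mullineux e (regularisation e lam) = ?R"
    then have "toks e lam t = dcols e lam t" for t using c[of t] m by (simp add: dcols_def)
    then show "toks e lam = dcols e lam" by blast
  next
    assume eq: "toks e lam = dcols e lam"
    have "of_cols (tokseq e ?xs N) = ?R"
    proof (rule conjugate_inj[OF is_partition_of_cols[OF rt] pR])
      fix j :: nat assume "j \<ge> 1"
      then obtain t where j: "j = Suc t" by (cases j) auto
      show "conjugate (of_cols (tokseq e ?xs N)) j = conjugate ?R j"
        unfolding j c eq dcols_def ..
    qed
    then show "mullineux e (regularisation e lam) = ?R" using m by simp
  qed
qed

context column_chain
begin

lemma toks_nu: "toks e lam = case_nat (w - n) (toks e nu)"
proof
  note reg = e_regular_regularisation[OF e part]
  define xs where "xs = cols kap (kap 1)"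
  have r: "restricted e (peel e xs)"
    unfolding xs_def by (rule restricted_peel[OF e restricted_cols[OF e reg order_refl]])
  have nu: "regularisation e nu = of_cols (peel e xs)" unfolding xs_def by (rule regularisation_nu) simp
  have l: "length (peel e xs) = kap 1" by (simp add: xs_def)
  have "regularisation e nu 1 \<le> kap 1" using of_cols_first_le[OF r] nu l by simp
  from toks_eq[OF e is_partition_nu this] have "tok e ((peel e ^^ t) (peel e xs)) = toks e nu t" for t
    using cols_of_cols[OF r] nu l by simp
  moreover have "toks e lam t = tok e ((peel e ^^ t) xs)" for t by (simp add: toks_def xs_def)
  moreover have "tok e xs = w - n" unfolding xs_def by (rule tok_regularisation) simp
  ultimately show "toks e lam t = case_nat (w - n) (toks e nu) t" for t
    by (cases t) (simp_all add: funpow_swap1 del: peel.simps)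
qed

definition "dvals = colval e (regularisation e (conjugate lam))"
definition "dvals' = case_nat (w - n) (\<lambda>t. colval e (regularisation e (conjugate nu)) t + (e - 1))"

lemma dvals: "dvals t = dcols e lam t + (e - 1) * t"
  unfolding dvals_def by (rule colval_dcols)

lemma dvals': "dvals' t = case_nat (w - n) (dcols e nu) t + (e - 1) * t"
  by (cases t) (simp_all add: dvals'_def colval_dcols)

lemma dvals_ge: "t \<le> dvals t"
  unfolding dvals_def by (rule colval_ge[OF e])

lemma dvals'_ge: "t \<le> dvals' t"
proof (cases t)
  case (Suc u)
  then show ?thesis
    using colval_ge[OF e, of u "regularisation e (conjugate nu)"] e by (simp add: dvals'_def)
qed simp

lemma mono_dvals: "mono dvals"
  unfolding dvals_def
  by (intro monoI colval_mono[OF e] e_regular_regularisation[OF e] is_partition_conjugate part)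

lemma mono_dvals': "mono dvals'"
proof (rule monoI)
  let ?R = "regularisation e (conjugate nu)"
  note pn = is_partition_conjugate[OF is_partition_nu]
  fix t u :: nat assume tu: "t \<le> u"
  show "dvals' t \<le> dvals' u"
  proof (cases u)
    case (Suc u')
    show ?thesis
    proof (cases t)
      case 0
      have "range (colval e ?R) = range (colval e (conjugate nu))"
        using range_colval_iff[OF e, of _ ?R] range_colval_iff[OF e, of _ "conjugate nu"]
          colcount_regularisation[OF e pn] by (intro set_eqI) simp
      then obtain j where "colval e ?R u' = colval e (conjugate nu) j" by (metis rangeI rangeE)
      then show ?thesis using rowvals'_lower[of j] 0 Suc by (simp add: dvals'_def)
    next
      case (Suc t')
      then show ?thesis using tu \<open>u = Suc u'\<close> colval_mono[OF e e_regular_regularisation[OF e pn], of t' u']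
        by (simp add: dvals'_def)
    qed
  qed (use tu in simp)
qed

lemma excess_dvals: "excess dvals = excess rowvals"
  unfolding dvals_def rowvals_def
  using excess_colval[OF e] colcount_regularisation[OF e is_partition_conjugate[OF part]] by (intro ext) simp

lemma excess_dvals': "excess dvals' = excess rowvals'"
proof
  fix T
  have "excess (colval e (regularisation e (conjugate nu))) T' = excess (colval e (conjugate nu)) T'" for T'
    using excess_colval[OF e] colcount_regularisation[OF e is_partition_conjugate[OF is_partition_nu]] by simp
  then show "excess dvals' T = excess rowvals' T"
    unfolding dvals'_def rowvals'_def excess_Suc[OF colval_ge[OF e]] by simp
qed

lemma sum_dcols_le: "(\<Sum>t<j. case_nat (w - n) (dcols e nu) t) \<le> (\<Sum>t<j. dcols e lam t)"
proof -
  have "(\<Sum>t<j. dvals' t) \<le> (\<Sum>t<j. dvals t)"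
    by (rule partial_sums_le[OF dvals_ge dvals'_ge mono_dvals'])
      (simp add: excess_dvals excess_dvals' excess_rowvals_le)
  then show ?thesis by (simp add: dvals dvals' sum.distrib)
qed

lemma tight_iff: "tight \<longleftrightarrow> dcols e lam = case_nat (w - n) (dcols e nu)"
proof -
  have "tight \<longleftrightarrow> dvals' = dvals"
    unfolding tight_iff_excess excess_dvals[symmetric] excess_dvals'[symmetric]
    using excess_eq_imp_eq[OF dvals_ge dvals'_ge mono_dvals mono_dvals'] by metis
  also have "\<dots> \<longleftrightarrow> dcols e lam = case_nat (w - n) (dcols e nu)"
    unfolding fun_eq_iff dvals dvals' by auto
  finally show ?thesis .
qed

lemma toks_dcols_step:
  assumes IH: "\<And>j. (\<Sum>t<j. toks e nu t) \<le> (\<Sum>t<j. dcols e nu t)"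
  shows "(\<Sum>t<j. toks e lam t) \<le> (\<Sum>t<j. dcols e lam t)"
    and "toks e lam = dcols e lam \<longleftrightarrow> tight \<and> toks e nu = dcols e nu"
proof -
  have le: "(\<Sum>t<j. toks e lam t) \<le> (\<Sum>t<j. case_nat (w - n) (dcols e nu) t)" for j
  proof (cases j)
    case (Suc i)
    then show ?thesis using IH[of i] by (simp add: toks_nu sum.lessThan_Suc_shift del: sum.lessThan_Suc)
  qed simp
  show "(\<Sum>t<j. toks e lam t) \<le> (\<Sum>t<j. dcols e lam t)"
    using le sum_dcols_le by (rule order_trans)
  show "toks e lam = dcols e lam \<longleftrightarrow> tight \<and> toks e nu = dcols e nu"
  proof
    assume eq: "toks e lam = dcols e lam"
    have "case_nat (w - n) (dcols e nu) = dcols e lam"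
    proof (rule partial_sums_eq)
      show "(\<Sum>t<j. case_nat (w - n) (dcols e nu) t) = (\<Sum>t<j. dcols e lam t)" for j
        using le[of j] sum_dcols_le[of j] eq by simp
    qed
    moreover from this have "case_nat (w - n) (toks e nu) = case_nat (w - n) (dcols e nu)"
      using eq toks_nu by simp
    then have "toks e nu t = dcols e nu t" for t by (drule_tac fun_cong[of _ _ "Suc t"]) simp
    ultimately show "tight \<and> toks e nu = dcols e nu" using tight_iff by auto
  next
    assume "tight \<and> toks e nu = dcols e nu"
    then show "toks e lam = dcols e lam" using tight_iff toks_nu by simp
  qed
qed

end

section \<open>Hooks\<close>

definition hooks_ok :: "nat \<Rightarrow> parts \<Rightarrow> bool" where
  "hooks_ok e lam \<longleftrightarrow> (\<forall>i k. 1 \<le> i \<longrightarrow> k < lam i \<longrightarrow> e dvd hook_length lam i (Suc k) \<longrightarrow>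
     shallow e lam i (Suc k) \<or> steep e lam i (Suc k))"

lemma hooks_ok_iff_young:
  "hooks_ok e lam \<longleftrightarrow> (\<forall>(i, j) \<in> young lam. e dvd hook_length lam i j \<longrightarrow> shallow e lam i j \<or> steep e lam i j)"
proof
  assume ok: "hooks_ok e lam"
  show "\<forall>(i, j) \<in> young lam. e dvd hook_length lam i j \<longrightarrow> shallow e lam i j \<or> steep e lam i j"
  proof clarify
    fix i j assume ij: "(i, j) \<in> young lam" "e dvd hook_length lam i j" "\<not> steep e lam i j"
    then obtain k where "j = Suc k" by (cases j) (auto simp: young_def)
    then show "shallow e lam i j" using ok ij by (auto simp: hooks_ok_def young_def Suc_le_eq)
  qed
next
  assume "\<forall>(i, j) \<in> young lam. e dvd hook_length lam i j \<longrightarrow> shallow e lam i j \<or> steep e lam i j"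
  then show "hooks_ok e lam" unfolding hooks_ok_def young_def by fastforce
qed

lemma hooks_ok_2: "hooks_ok 2 lam"
  by (auto simp: hooks_ok_def shallow_def steep_def)

text \<open>Writing the hook length as e t, the hypothesis says t < l + 1, hence t <= l:
  divisibility sharpens the bound by a whole step.\<close>

lemma less_mult_leg_of_dvd:
  fixes a l e :: nat
  assumes e: "e \<ge> 2" and d: "e dvd a + l + 1" and lt: "a < (e - 1) * Suc l"
  shows "a < (e - 1) * l"
proof -
  obtain t where t: "a + l + 1 = e * t" using d by (elim dvdE)
  obtain f where f: "e = Suc f" using e by (cases e) auto
  have "e * t < e * Suc l" using t lt by (simp add: f)
  then have "t < Suc l" by (simp only: mult_less_cancel1)
  then have "t \<le> l" by simp
  then have "e * t \<le> e * l" by simp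
  then show ?thesis using t by (simp add: f)
qed

text \<open>For hook length e t take s = a + 1 - t. In terms of values, s measures in units of e how
  far the value of the column lies below \<open>i + (e - 1) * lam i\<close>, where i is the row of
  the node.\<close>

lemma not_steep_dvdE:
  fixes a l e :: nat
  assumes e: "e \<ge> 2" and "e dvd a + l + 1" and "l < (e - 1) * a"
  obtains s where "s \<ge> 1" "l + e * s = (e - 1) * (a + 1)"
proof -
  obtain t where t: "a + l + 1 = e * t" using assms(2) by (elim dvdE)
  obtain f where f: "e = Suc f" using e by (cases e) auto
  have "e * t < e * Suc a" using t assms(3) by (simp add: f)
  then have "t < Suc a" by (simp only: mult_less_cancel1)
  then have ta: "t \<le> a" by simp
  define s where "s = Suc a - t"
  have "s + t = Suc a" using ta by (simp add: s_def)
  then have "e * s + e * t = e * Suc a" by (metis add_mult_distrib2)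
  then have "l + e * s = (e - 1) * (a + 1)" using t by (simp add: f)
  moreover have "s \<ge> 1" using ta by (simp add: s_def)
  ultimately show ?thesis using that by blast
qed

context column_chain
begin

text \<open>Let k be the first chain column with \<open>phi k > 0\<close>. The preceding chain
  column x, of height i, is the length of row i + 1; at the start x = w and i = 0. The node in row i
  + 1 of column k has a bad hook: \<open>W k < v a\<close> bounds its leg, \<open>phi k > 0\<close>
  bounds its arm, and the chain congruence makes its length divisible by e.\<close>

lemma tight_of_hooks_ok:
  assumes ok: "hooks_ok e lam"
  shows tight
proof -
  have "phi (q a) = 0" if "a < n" for a
    using that
  proof (induction a rule: less_induct)
    case (less a)
    define k where "k = q a"
    note kw = q_less[OF less(2), folded k_def]
    have ak: "ahead k = a" unfolding k_def by (rule ahead_q[OF less(2)])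
    show ?case
    proof (rule ccontr)
      assume "phi (q a) \<noteq> 0"
      then have pos: "phi k > 0" using phi_nonneg[OF kw] by (simp add: k_def)
      obtain i x where ix: "lam (Suc i) = x" "v a = i + (e - 1) * x" "w = a + x + (e - 1) * i"
      proof (cases a)
        case 0
        then show ?thesis using that[of 0 w] by simp
      next
        case (Suc b)
        define x where "x = q b"
        define i where "i = h x"
        have b: "b < n" using Suc less(2) by simp
        have ph: "phi x = 0" using less(1)[of b] Suc b by (simp add: x_def)
        have ax: "ahead x = b" unfolding x_def by (rule ahead_q[OF b])
        have xw: "x < w" using q_less[OF b] by (simp add: x_def)
        have i1: "i \<ge> 1" using h_pos[OF xw] by (simp add: i_def)
        have le: "lam (Suc i) \<le> x" "x < lam i" using h_eq_iff[OF i1, of x] by (simp_all add: i_def)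
        \<comment> \<open>Otherwise the chain would pass on to the left neighbour of equal height.
          Then k would be this neighbour, where \<open>phi\<close> has the same value 0 as at
          x.\<close>
        have "\<not> lam (Suc i) < x"
        proof
          assume lt: "lam (Suc i) < x"
          then obtain y where y: "x = Suc y" by (cases x) auto
          have "h y = i" using h_eq_iff[OF i1, of y] lt le y by simp
          then have hy: "h y = h (Suc y)" using y by (simp add: i_def)
          have "q (Suc b) = y" using q_stay[OF b _ hy] y by (simp add: x_def)
          then have "k = y" using Suc by (simp add: k_def)
          then have "phi k = phi x" using ak ax Suc hy y by (simp add: phi_def)
          then show False using ph pos by simp
        qed
        then have 1: "lam (Suc i) = x" using le by simp
        have 2: "v a = i + (e - 1) * x" using Suc by (simp add: colval_def x_def i_def)
        have "Suc x + (e - 1) * h x = w - b" using ph phi_zero_iff[OF xw] ax by simp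
        then have 3: "w = a + x + (e - 1) * i" using Suc b n_le by (simp add: i_def)
        show ?thesis by (rule that[OF 1 2 3])
      qed
      have Wk: "h k + (e - 1) * k < i + (e - 1) * x"
        using v_Suc_less[OF less(2)] ix(2) by (simp add: k_def colval_def)
      have phk: "x + (e - 1) * i < Suc k + (e - 1) * h k"
      proof -
        have "w < Suc k + a + (e - 1) * h k" using pos unfolding phi_def ak by linarith
        then show ?thesis unfolding ix(3) by linarith
      qed
      have kx: "k < x"
      proof (rule ccontr)
        assume "\<not> k < x"
        then obtain D where D: "k = x + D" using le_Suc_ex not_less by blast
        have "\<not> Suc i \<le> h k" using h_ge_iff[of "Suc i" k] ix(1) D by simp
        then obtain d where d: "i = h k + d" using le_Suc_ex[of "h k" i] by auto
        have "(e - 1) * D < d" using Wk unfolding D by (simp add: d D add_mult_distrib2)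
        moreover have "(e - 1) * d \<le> D" using phk unfolding D by (simp add: d D add_mult_distrib2)
        moreover have "1 * D \<le> (e - 1) * D" "1 * d \<le> (e - 1) * d" using e by (intro mult_le_mono1; simp)+
        ultimately show False by linarith
      qed
      have ih: "Suc i \<le> h k" using h_ge_iff[of "Suc i" k] ix(1) kx by simp
      define A l where "A = x - Suc k" and "l = h k - Suc i"
      have xA: "x = Suc k + A" and hl: "h k = Suc i + l" using kx ih by (simp_all add: A_def l_def)
      have arm: "arm lam (Suc i) (Suc k) = A" and leg: "leg lam (Suc i) (Suc k) = l"
        by (simp_all add: arm_def leg_def ix(1) A_def l_def)
      obtain f where f: "e = Suc f" using e by (cases e) auto
      have lt1: "l < f * Suc A" using Wk by (simp add: f xA hl algebra_simps)
      have lt2: "A < f * Suc l" using phk by (simp add: f xA hl algebra_simps)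
      have "e dvd v a + 1 - W k" using v_dvd[OF less(2)] by (simp add: k_def)
      moreover have "v a + 1 - W k = i + (e - 1) * x + 1 - (h k + (e - 1) * k)"
        unfolding ix(2) colval_def ..
      moreover have "\<dots> = f * Suc A - l"
        by (simp add: f xA hl algebra_simps)
      ultimately have dv: "e dvd f * Suc A - l" by simp
      have "A + l + 1 = e * Suc A - (f * Suc A - l)" using lt1 by (simp add: f)
      then have dvd: "e dvd A + l + 1" using dv by (simp add: dvd_diff_nat)
      have ns: "\<not> (e - 1) * A \<le> l"
      proof
        assume "(e - 1) * A \<le> l"
        then have "f * Suc A - l \<le> f" by (simp add: f)
        moreover have "e \<le> f * Suc A - l" using dv lt1 by (intro dvd_imp_le) auto
        ultimately show False by (simp add: f)
      qed
      have "A < (e - 1) * l" by (rule less_mult_leg_of_dvd[OF e dvd]) (use lt2 f in simp)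
      then have "\<not> shallow e lam (Suc i) (Suc k)" "\<not> steep e lam (Suc i) (Suc k)"
        using ns by (simp_all add: shallow_def steep_def arm leg)
      moreover have "e dvd hook_length lam (Suc i) (Suc k)" using dvd by (simp add: hook_length_def arm leg)
      ultimately show False using ok ix(1) kx by (auto simp: hooks_ok_def)
    qed
  qed
  then show ?thesis by (auto simp: tight_def C_def)
qed

text \<open>For e = 2 the bound \<open>v_upper\<close> is just the inequality
  \<open>phi (q a) <= 0\<close>.\<close>

lemma tight_2: "e = 2 \<Longrightarrow> tight"
proof -
  assume 2: "e = 2"
  have "phi (q a) = 0" if a: "a < n" for a
  proof -
    have "v (Suc a) + Suc a \<le> w" using v_upper[of "Suc a"] a 2 by simp
    then have "h (q a) + q a + Suc a \<le> w" by (simp add: colval_def 2)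
    then have "phi (q a) \<le> 0" unfolding phi_def ahead_q[OF a] by (simp add: 2)
    then show ?thesis using phi_nonneg[OF q_less[OF a]] by simp
  qed
  then show tight by (auto simp: tight_def C_def)
qed

lemma phi_diff:
  assumes "h k = h (Suc k) + d"
  shows "phi k = phi (Suc k) - 1 + int (ahead k) - int (ahead (Suc k)) + (int e - 1) * int d"
    and "int (W k) = int (W (Suc k)) + int d - (int e - 1)"
  unfolding phi_def colval_def assms of_nat_add of_nat_mult int_e1 by (simp_all add: algebra_simps)

end

section \<open>The shape of a partition with a tight chain\<close>

locale tight_chain = column_chain +
  assumes e3: "e \<ge> 3" and tight: tight
begin

lemma phi_C: "k \<in> C \<Longrightarrow> phi k = 0"
  using tight by (simp add: tight_def)

lemma phi_eq: "phi k = int k + 1 + int (ahead k) + (int e - 1) * int (h k) - int w"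
  unfolding phi_def of_nat_mult int_e1 by simp

lemma W_eq: "int (W k) = int (h k) + (int e - 1) * int k"
  unfolding colval_def of_nat_add of_nat_mult int_e1 by simp

lemma h_antimono: "j \<le> k \<Longrightarrow> h k \<le> h j"
  by (rule conjugate_antimono[OF part]) simp_all

text \<open>\<open>chain_value\<close> yields a chain column with the same value and the same
  \<open>phi\<close>. With f = e - 1, the differences D of positions and E of heights satisfy D + f
  E = 0 and E + f D = 0, so both vanish because f^2 - 1 > 0.\<close>

lemma phi_zero_C:
  assumes "k < w" "phi k = 0"
  shows "k \<in> C"
proof -
  have "W k < v (ahead k)"
    using less_v0[OF assms(1), of 0] assms(2) less_v_ahead[of k] by (cases "ahead k = 0") simp_all
  from chain_value[OF assms(1) this] have A: "ahead k < n" "W (q (ahead k)) = W k" using assms(2) by simp_all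
  define c where "c = q (ahead k)"
  have cC: "c \<in> C" using A(1) by (auto simp: c_def C_def)
  have ac: "ahead c = ahead k" unfolding c_def by (rule ahead_q[OF A(1)])
  let ?f = "int e - 1" and ?D = "int k - int c" and ?E = "int (h k) - int (h c)"
  have 1: "?D + ?f * ?E = 0" using assms(2) phi_C[OF cC] unfolding phi_eq ac by (simp add: algebra_simps)
  have "int (W c) = int (W k)" using A(2) by (simp add: c_def)
  then have 2: "?E + ?f * ?D = 0" unfolding W_eq by (simp add: algebra_simps)
  have "?D * (?f * ?f - 1) = ?f * (?E + ?f * ?D) - (?D + ?f * ?E)" by (simp add: algebra_simps)
  then have "?D * (?f * ?f - 1) = 0" unfolding 1 2 by simp
  moreover have "?f * ?f - 1 > 0" using mult_mono[of 2 ?f 2 ?f] e3 by simp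
  ultimately have "k = c" by auto
  then show ?thesis using cC by simp
qed

text \<open>If \<open>phi\<close> reached e at k, it would be at least e at the chain column c as
  well, where tightness makes it 0.\<close>

lemma phi_less:
  assumes "c \<in> C" "c \<le> k" "k < w"
  shows "phi k < int e"
  using phi_left_closed[OF assms(2,3), of e] phi_C[OF assms(1)] e3 by (cases "phi k < int e") simp_all

text \<open>Compare K with the chain column c that follows it in value. In terms of the differences
  D of positions and E of heights, the hypotheses read 1 <= D + f E <= f and 0 <= E + f D < f with f
  = e - 1; since heights decrease weakly, D and E cannot both be positive or both negative, and no
  pair is left.\<close>

lemma no_interloper:
  assumes K: "K < w" "ahead K < n" and ph: "1 \<le> phi K" "phi K < int e"
    and W1: "W (q (ahead K)) \<le> W K" and W2: "W K < W (q (ahead K)) + (e - 1)"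
  shows False
proof -
  define c where "c = q (ahead K)"
  have cC: "c \<in> C" using K(2) by (auto simp: c_def C_def)
  have ac: "ahead c = ahead K" unfolding c_def by (rule ahead_q[OF K(2)])
  define f D E where "f = int e - 1" and "D = int K - int c" and "E = int (h K) - int (h c)"
  have f2: "f \<ge> 2" using e3 by (simp add: f_def)
  have T: "phi K = D + f * E" using phi_C[OF cC] unfolding phi_eq ac f_def D_def E_def by (simp add: algebra_simps)
  have y: "int (W K) - int (W c) = E + f * D" unfolding W_eq f_def D_def E_def by (simp add: algebra_simps)
  have W2': "int (W K) < int (W c) + f" using W2 int_e1 unfolding c_def f_def by linarith
  have b: "1 \<le> D + f * E" "D + f * E \<le> f" "0 \<le> E + f * D" "E + f * D < f"
    using ph T y W1 W2' by (simp_all add: c_def f_def)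
  consider "D > 0" | "D = 0" | "D < 0" by linarith
  then show False
  proof cases
    case 1
    then have "E \<le> 0" using h_antimono[of c K] by (simp add: D_def E_def)
    have "f * (1 - f * E) \<le> f * D" using b(1) f2 by (intro mult_left_mono) auto
    moreover have "f * f * E \<le> 1 * E"
      using \<open>E \<le> 0\<close> mult_mono[of 1 f 1 f] f2 by (intro mult_right_mono_neg) auto
    ultimately show False using b(4) by (simp add: algebra_simps)
  next
    case 2
    then have "E = 0" by (simp add: D_def E_def)
    then show False using 2 b(1) by simp
  next
    case 3
    have "f * (- (f * D)) \<le> f * E" using b(3) f2 by (intro mult_left_mono) auto
    then have "- (f * f * D) \<le> f * E" by (simp add: algebra_simps)
    moreover have "(f * f - 1) * 1 \<le> (f * f - 1) * - D"
      using 3 mult_mono[of 2 f 2 f] f2 by (intro mult_left_mono) auto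
    then have "f * f - 1 \<le> D - f * f * D" by (simp add: algebra_simps)
    moreover have "2 * f \<le> f * f" using f2 by (intro mult_right_mono) auto
    ultimately show False using b(2) f2 by linarith
  qed
qed

text \<open>The bound \<open>phi < e\<close> leaves little room. Between equal heights
  \<open>phi\<close> drops by one, as \<open>no_interloper\<close> excludes a new chain value unless
  \<open>phi\<close> is already 0; a rise in height by one adds about e - 1, so it starts from at
  most 1; a larger rise would exceed the bound.\<close>

lemma phi_step_eq:
  assumes c: "c \<in> C" "c \<le> k" and k: "Suc k < w"
  shows "h k = h (Suc k) \<and> phi k = max (phi (Suc k) - 1) 0 \<or>
    h k = Suc (h (Suc k)) \<and> phi (Suc k) \<le> 1 \<and> phi k = int e - 1"
proof -
  define d where "d = h k - h (Suc k)"
  have hk: "h k = h (Suc k) + d" using h_antimono[of k "Suc k"] by (simp add: d_def)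
  note diff = phi_diff[OF hk]
  have less: "phi k < int e" "phi (Suc k) < int e"
    using phi_less[OF c(1)] c(2) k by simp_all
  have nn: "phi k \<ge> 0" "phi (Suc k) \<ge> 0" using phi_nonneg k by simp_all
  have f2: "int e - 1 \<ge> 2" using e3 by simp
  have ahead_less: "ahead (Suc k) < ahead k" if "Suc k \<in> C" "W k < W (Suc k)"
  proof -
    obtain a where a: "a < n" "Suc k = q a" using \<open>Suc k \<in> C\<close> by (auto simp: C_def)
    then show ?thesis using ahead_iff[of a k] ahead_q[OF a(1)] that(2) by simp
  qed
  consider "d = 0" | "d = 1" | "d \<ge> 2" by linarith
  then show ?thesis
  proof cases
    case 1
    then have lt: "W k < W (Suc k)" using diff(2) f2 by linarith
    have le: "ahead (Suc k) \<le> ahead k" using lt by (intro ahead_antimono) simp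
    have "phi k = max (phi (Suc k) - 1) 0"
    proof (cases "phi (Suc k) = 0")
      case True
      then have "k \<in> C" using C_stay phi_zero_C[OF k] hk 1 by simp
      then show ?thesis using phi_C True by simp
    next
      case False
      have "ahead k = ahead (Suc k)"
      proof (rule ccontr)
        assume "ahead k \<noteq> ahead (Suc k)"
        then have A: "ahead (Suc k) < ahead k" using le by simp
        then have An: "ahead (Suc k) < n" using ahead_le[of k] by simp
        have "W k < W (q (ahead (Suc k)))" using ahead_iff[OF An, of k] A by simp
        moreover have "\<not> W (Suc k) < W (q (ahead (Suc k)))" using ahead_iff[OF An, of "Suc k"] by simp
        moreover have "W (Suc k) = W k + (e - 1)" using diff(2) 1 int_e1 by linarith
        ultimately have "W (q (ahead (Suc k))) \<le> W (Suc k)" "W (Suc k) < W (q (ahead (Suc k))) + (e - 1)"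
          by linarith+
        moreover have "1 \<le> phi (Suc k)" using False nn by simp
        ultimately show False using no_interloper[OF k An] less by blast
      qed
      then show ?thesis using diff(1) 1 nn False by simp
    qed
    then show ?thesis using hk 1 by simp
  next
    case 2
    then have lt: "W k < W (Suc k)" using diff(2) f2 by linarith
    have le: "ahead (Suc k) \<le> ahead k" using lt by (intro ahead_antimono) simp
    have "phi (Suc k) \<le> 1 \<and> phi k = int e - 1"
    proof (cases "phi (Suc k) = 0")
      case True
      then have "ahead (Suc k) < ahead k" using ahead_less[OF phi_zero_C[OF k] lt] by simp
      then show ?thesis using True diff(1) 2 less by simp
    next
      case False
      then show ?thesis using diff(1) 2 less nn le by simp
    qed
    then show ?thesis using hk 2 by simp
  next
    case 3
    have m1: "(int e - 1) * 2 \<le> (int e - 1) * int d" using 3 f2 by (intro mult_left_mono) auto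
    have m2: "(int e - 2) * 2 \<le> (int e - 2) * int d" using 3 f2 by (intro mult_left_mono) auto
    have False
    proof (cases "W k \<le> W (Suc k)")
      case True
      then have "ahead (Suc k) \<le> ahead k" by (rule ahead_antimono)
      then show False using diff(1) m1 less nn f2 by simp
    next
      case F: False
      then have a: "ahead (Suc k) \<le> ahead k + (W k - W (Suc k))" by (intro ahead_le_add) simp
      have "int (ahead (Suc k)) \<le> int (ahead k) + int d - (int e - 1)"
        using a F diff(2) by linarith
      moreover have "(int e - 1) * int d = (int e - 2) * int d + int d" "(int e - 2) * 2 = 2 * int e - 4"
        by (simp_all add: algebra_simps)
      ultimately show False using diff(1) m2 less nn f2 by linarith
    qed
    then show ?thesis ..
  qed
qed

text \<open>In the last column \<open>phi\<close> is \<open>ahead\<close> plus e - 1 times the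
  height, and the bound \<open>phi < e\<close> forces height 1. If \<open>phi\<close> is then
  positive and below e, the value at least e - 1 is determined.\<close>

lemma last_column:
  assumes c: "c \<in> C"
  shows "h (w - 1) = 1 \<and> phi (w - 1) = int e - 1"
proof -
  have cw: "c < w" using C_less[OF c] .
  then have k: "w - 1 < w" by simp
  have l: "phi (w - 1) < int e" using phi_less[OF c _ k] cw by simp
  have ph: "phi (w - 1) = int (ahead (w - 1)) + (int e - 1) * int (h (w - 1))"
    unfolding phi_eq using cw by simp
  have h1: "h (w - 1) \<ge> 1" by (rule h_pos[OF k])
  have "h (w - 1) = 1"
  proof (rule ccontr)
    assume "h (w - 1) \<noteq> 1"
    then have "(int e - 1) * 2 \<le> (int e - 1) * int (h (w - 1))" using h1 e3 by (intro mult_left_mono) auto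
    moreover have "int e \<ge> 3" "(int e - 1) * 2 = 2 * int e - 2" using e3 by simp_all
    ultimately show False using l ph by linarith
  qed
  then show ?thesis using ph l by simp
qed

text \<open>Right of a column of the chain, the heights increase by steps of one, and every block of
  columns of equal height has at least \<open>e - 1\<close> columns, all of which but the last \<open>e - 1\<close> belong
  to the chain.\<close>

lemma shape:
  assumes c: "c \<in> C" "c \<le> k" and k: "k < w"
  shows "phi k = int (e - (lam (h k) - k)) \<and> (\<forall>j. 1 \<le> j \<and> j < h k \<longrightarrow> lam (Suc j) + (e - 1) \<le> lam j)"
proof -
  have "k \<le> w - 1" using k by simp
  then show ?thesis using c(2)
  proof (induction k rule: inc_induct)
    case base
    then show ?case using last_column[OF c(1)] C_less[OF c(1)] e3 by simp
  next
    case (step k)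
    have sk: "Suc k < w" using step(2) by simp
    have IH: "phi (Suc k) = int (e - (lam (h (Suc k)) - Suc k))"
      "\<forall>j. 1 \<le> j \<and> j < h (Suc k) \<longrightarrow> lam (Suc j) + (e - 1) \<le> lam j"
      using step(3,4) by simp_all
    define i where "i = h (Suc k)"
    have i1: "i \<ge> 1" using h_pos[OF sk] by (simp add: i_def)
    have ki: "lam (Suc i) \<le> Suc k" "Suc k < lam i" using h_eq_iff[OF i1, of "Suc k"] by (simp_all add: i_def)
    show ?case
      using phi_step_eq[OF c(1) step(4) sk]
    proof
      assume a: "h k = h (Suc k) \<and> phi k = max (phi (Suc k) - 1) 0"
      have "lam i - k = Suc (lam i - Suc k)" using ki by simp
      then have "phi k = int (e - (lam i - k))" using a IH(1)[folded i_def] by (simp add: max_def)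
      then show ?thesis using a IH(2) by (simp add: i_def)
    next
      assume a: "h k = Suc (h (Suc k)) \<and> phi (Suc k) \<le> 1 \<and> phi k = int e - 1"
      have "k < lam (Suc i)" using h_ge_iff[of "Suc i" k] a by (simp add: i_def)
      then have eq: "lam (Suc i) = Suc k" using ki by simp
      have "e - (lam i - Suc k) \<le> 1" using a IH(1)[folded i_def] by simp
      then have "lam (Suc i) + (e - 1) \<le> lam i" using eq ki by simp
      then have "lam (Suc j) + (e - 1) \<le> lam j" if "1 \<le> j" "j < Suc i" for j
        using that IH(2) by (cases "j = i") (simp_all add: i_def)
      moreover have "phi k = int (e - (lam (Suc i) - k))" using a eq e3 by simp
      ultimately show ?thesis using a by (simp add: i_def)
    qed
  qed
qed

lemma W_strict:
  assumes c: "c \<in> C" "c \<le> j" and k: "j < k" "k < w"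
  shows "W j < W k"
proof -
  have step: "W l < W (Suc l)" if l: "c \<le> l" "Suc l < w" for l
  proof -
    obtain d where d: "h l = h (Suc l) + d" "d \<le> 1" using phi_step_eq[OF c(1) l] by force
    then show ?thesis using phi_diff(2)[OF d(1)] e3 by linarith
  qed
  from Suc_leI[OF k(1)] k(2) show ?thesis
  proof (induction k rule: dec_induct)
    case base
    then show ?case using step[OF c(2)] by simp
  next
    case (step l)
    then show ?case using \<open>\<And>l. c \<le> l \<Longrightarrow> Suc l < w \<Longrightarrow> W l < W (Suc l)\<close>[of l] c(2) by simp
  qed
qed

end

lemma shallow_of_gaps:
  assumes p: "is_partition mu" and "i \<ge> 1" "k < mu i"
    and gap: "\<And>j. i \<le> j \<Longrightarrow> j < conjugate mu (Suc k) \<Longrightarrow> mu (Suc j) + (e - 1) \<le> mu j"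
  shows "shallow e mu i (Suc k)"
proof -
  define H where "H = conjugate mu (Suc k)"
  have iH: "i \<le> H" using conjugate_ge_iff[OF p assms(2), of "Suc k"] assms(3) by (simp add: H_def)
  have kH: "Suc k \<le> mu H" using conjugate_ge_iff[OF p, of H "Suc k"] iH assms(2) by (simp add: H_def)
  have "mu j + (e - 1) * (j - i) \<le> mu i" if "i \<le> j" "j \<le> H" for j
    using that
  proof (induction j rule: dec_induct)
    case (step j)
    have "mu (Suc j) + (e - 1) \<le> mu j" using gap step by (simp add: H_def)
    moreover have "(e - 1) * (Suc j - i) = (e - 1) * (j - i) + (e - 1)" using step(1) by (simp add: Suc_diff_le)
    ultimately show ?case using step by simp
  qed simp
  from this[of H] have "mu H + (e - 1) * (H - i) \<le> mu i" using iH by simp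
  then show ?thesis using kH unfolding shallow_def arm_def leg_def H_def by linarith
qed

section \<open>Transfer of hooks between \<open>lam\<close> and \<open>nu\<close>\<close>

context tight_chain
begin

text \<open>Row \<open>Suc p\<close> is the deleted row, and the rows above it are shortened. The
  default 0 for an empty chain makes the first row the deleted one.\<close>

definition "p = (if C = {} then 0 else h (Min C))"

lemma C_ge: "k \<in> C \<Longrightarrow> lam (Suc p) \<le> k"
proof -
  assume k: "k \<in> C"
  then have "Min C \<le> k" by simp
  then have "h k \<le> p" using h_antimono k by (auto simp: p_def)
  then show ?thesis using h_ge_iff[of "Suc p" k] by simp
qed

lemma h_le_p: "lam (Suc p) \<le> k \<Longrightarrow> h k \<le> p"
  using h_ge_iff[of "Suc p" k] by simp

lemma corner:
  assumes "p \<ge> 1"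
  shows "lam (Suc p) \<in> C" and "h (lam (Suc p)) = p"
proof -
  have ne: "C \<noteq> {}" using assms by (auto simp: p_def)
  then have "Min C \<in> C" by simp
  moreover have "h (Min C) = p" using ne by (simp add: p_def)
  ultimately have "Min C \<in> {k \<in> C. h k = p}" by blast
  then have "lam (Suc p) \<in> {k \<in> C. h k = p}" using nu_block[OF assms] by simp
  then show "lam (Suc p) \<in> C" "h (lam (Suc p)) = p" by simp_all
qed

lemma lam_gap:
  assumes "1 \<le> i" "i \<le> p"
  shows "lam (Suc i) + (e - 1) \<le> lam i"
proof -
  note c = corner[OF order_trans[OF assms]]
  note sh = shape[OF c(1) order_refl C_less[OF c(1)], unfolded c(2)]
  show ?thesis
  proof (cases "i = p")
    case True
    have "e \<le> lam p - lam (Suc p)" using phi_C[OF c(1)] sh by simp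
    then show ?thesis using True e by simp
  next
    case False
    then show ?thesis using sh assms by simp
  qed
qed

lemma corner_le: "1 \<le> i \<Longrightarrow> i \<le> Suc p \<Longrightarrow> lam (Suc p) \<le> lam i"
  by (rule partition_antimono[OF part])

lemma C_iff:
  assumes "1 \<le> i" "i \<le> p" and k: "lam (Suc i) \<le> k" "k < lam i"
  shows "k \<in> C \<longleftrightarrow> k + e \<le> lam i"
proof -
  note c = corner[OF order_trans[OF assms(1,2)]]
  have hk: "h k = i" using h_eq_iff[OF assms(1), of k] k by simp
  have kw: "k < w" using k partition_antimono[OF part, of 1 i] assms(1) by simp
  have ck: "lam (Suc p) \<le> k" using corner_le[of "Suc i"] assms(2) k(1) by simp
  have "k \<in> C \<longleftrightarrow> phi k = 0" using phi_C phi_zero_C[OF kw] by blast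
  also have "\<dots> \<longleftrightarrow> k + e \<le> lam i" using shape[OF c(1) ck kw] hk k by auto
  finally show ?thesis .
qed

lemma nu_low:
  assumes i: "1 \<le> i" "i \<le> p"
  shows "nu i = lam i - (e - 1)"
proof -
  note gap = lam_gap[OF i]
  have iff: "k < nu i \<longleftrightarrow> k < lam i - (e - 1)" if k: "lam (Suc i) \<le> k" for k
  proof (cases "k < lam i")
    case True
    have hk: "h k = i" using h_eq_iff[OF i(1), of k] k True by simp
    have "k < nu i \<longleftrightarrow> k \<in> {k \<in> C. h k = i}" using nu_block[OF i(1)] k by simp
    also have "\<dots> \<longleftrightarrow> k + e \<le> lam i" using C_iff[OF i k True] hk by simp
    finally show ?thesis using e by linarith
  next
    case False
    then show ?thesis using nu_le[of i] by simp
  qed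
  show ?thesis
    using iff[of "nu i"] iff[of "lam i - (e - 1)"] nu_ge[OF i(1)] gap by linarith
qed

lemma nu_high: "p < i \<Longrightarrow> nu i = lam (Suc i)"
proof -
  assume i: "p < i"
  have "h k \<noteq> i" if "k \<in> C" for k using h_le_p[OF C_ge[OF that]] i by simp
  then have none: "{k \<in> C. h k = i} = {}" by blast
  show ?thesis using i unfolding nu_def none by simp
qed

text \<open>Values increase strictly to the right from the corner column, so the chain ends there.
  For an empty chain the default p = 0 gives the initial value.\<close>

lemma v_last: "v n = p + (e - 1) * lam (Suc p)"
proof (cases n)
  case 0
  then have "C = {}" unfolding C_def by simp
  then have "p = 0" unfolding p_def by simp
  then show ?thesis using 0 by simp
next
  case (Suc a)
  have an: "a < n" using Suc by simp
  have qC: "q a \<in> C" using an by (auto simp: C_def)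
  then have ne: "C \<noteq> {}" by blast
  then have "Min C \<in> C" by simp
  then have "h (Min C) \<ge> 1" using h_pos C_less by blast
  then have p1: "p \<ge> 1" using ne by (simp add: p_def)
  note c = corner[OF p1]
  obtain b where b: "b < n" "lam (Suc p) = q b" using c(1) by (auto simp: C_def)
  have "b = a"
  proof (rule ccontr)
    assume "b \<noteq> a"
    then have "W (q a) < W (lam (Suc p))" using W_q_less[of b a] b Suc by simp
    moreover have "W (lam (Suc p)) \<le> W (q a)"
      using W_strict[OF c(1) order_refl, of "q a"] C_ge[OF qC] C_less[OF qC]
      by (cases "lam (Suc p) = q a") simp_all
    ultimately show False by simp
  qed
  then show ?thesis using Suc b(2) c(2) by (simp add: colval_def)
qed

text \<open>The last e - 1 columns of the block of height i are outside the chain, which leaves a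
  gap in the chain values. For s between 1 and e - 2 the value \<open>W k\<close> would fall into
  this gap, while a computation shows \<open>phi k\<close> divisible by e, so that
  \<open>W k\<close> would have to be a chain value.\<close>

lemma gap_value:
  assumes i: "1 \<le> i" "i \<le> p" and k: "k < lam (Suc p)"
    and Wk: "W k + e * s = i + (e - 1) * lam i"
  shows "\<not> (1 \<le> s \<and> s \<le> e - 2)"
proof
  assume s: "1 \<le> s \<and> s \<le> e - 2"
  note c = corner[OF order_trans[OF i]]
  note gap = lam_gap[OF i]
  define f where "f = int e - 1"
  have f2: "f \<ge> 2" and ef: "int e = f + 1" using e3 by (simp_all add: f_def)
  have lw: "lam i \<le> w" using partition_antimono[OF part, of 1 i] i by simp
  have ci: "lam (Suc p) \<le> lam (Suc i)" using corner_le[of "Suc i"] i by simp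
  \<comment> \<open>K is the last column of height i, and K1 the first of the last e - 1 columns of
    height i.\<close>
  define K where "K = lam i - 1"
  define K1 where "K1 = lam i - (e - 1)"
  have K1K: "lam (Suc i) \<le> K1" "K1 \<le> K" "K < lam i" "K < w" "int K = int (lam i) - 1" "int K1 = int (lam i) - f"
    using gap e3 lw by (simp_all add: K_def K1_def f_def of_nat_diff)
  have hK: "h K = i" and hK1: "h K1 = i" using h_eq_iff[OF i(1)] K1K by simp_all
  have cK: "lam (Suc p) \<le> K" "lam (Suc p) \<le> K1" using ci K1K by simp_all
  have WK: "int (W K) = int i + f * int (lam i) - f"
    unfolding W_eq f_def[symmetric] hK K1K(5) by (simp add: algebra_simps)
  have WK1: "int (W K1) = int i + f * int (lam i) - f * f"
    unfolding W_eq f_def[symmetric] hK1 K1K(6) by (simp add: algebra_simps)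
  have Wk': "int (W k) = int i + f * int (lam i) - (f + 1) * int s"
    using arg_cong[OF Wk, of int] unfolding of_nat_add of_nat_mult int_e1 by (simp add: f_def)
  have "(f + 1) * 1 \<le> (f + 1) * int s" using s f2 by (intro mult_left_mono) auto
  then have "int (W k) < int (W K)" using f2 unfolding WK Wk' mult_1_right by linarith
  then have kK: "W k < W K" by simp
  have "s + 2 \<le> e" using s e3 by linarith
  then have "int s \<le> f - 1" unfolding f_def by linarith
  then have "(f + 1) * int s \<le> (f + 1) * (f - 1)" using f2 by (intro mult_left_mono) auto
  also have "\<dots> < f * f" by (simp add: algebra_simps)
  finally have K1k: "W K1 < W k" using WK1 Wk' by simp
  \<comment> \<open>No chain value lies from \<open>W K1\<close> up to \<open>W K\<close>, so k and
    K have the same chain values ahead of them.\<close>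
  have below: "W c' < W k" if c': "c' \<in> C" "W c' \<le> W K" for c'
  proof -
    have "c' \<le> K" using W_strict[OF c(1) cK(1), of c'] c' C_less by fastforce
    have "c' < K1"
    proof (rule ccontr)
      assume "\<not> c' < K1"
      then have "lam (Suc i) \<le> c'" "c' < lam i" "\<not> c' + e \<le> lam i"
        using K1K \<open>c' \<le> K\<close> gap e by (simp_all add: K1_def)
      then show False using C_iff[OF i] c'(1) by blast
    qed
    then have "W c' < W K1" using W_strict[OF c(1) C_ge[OF c'(1)]] K1K by simp
    then show ?thesis using K1k by simp
  qed
  have ahead: "ahead k = ahead K"
  proof (rule ccontr)
    assume "ahead k \<noteq> ahead K"
    moreover have "ahead K \<le> ahead k" using kK by (intro ahead_antimono) simp
    ultimately have lt: "ahead K < ahead k" by simp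
    then have an: "ahead K < n" using ahead_le[of k] by simp
    then have "q (ahead K) \<in> C" by (auto simp: C_def)
    then show False using below[of "q (ahead K)"] ahead_iff[OF an, of k] ahead_iff[OF an, of K] lt by simp
  qed
  have phK: "phi K = f" using shape[OF c(1) cK(1) K1K(4)] hK K1K e3 by (simp add: K_def f_def)
  have hk: "int (h k) = int i + f * (int (lam i) - int k) - (f + 1) * int s"
    using Wk' unfolding W_eq f_def[symmetric] by (simp add: algebra_simps)
  have "phi k = phi K + (int k - int K) + f * (int (h k) - int i)"
    unfolding phi_eq ahead hK f_def[symmetric] by (simp add: algebra_simps)
  also have "\<dots> = int e * (1 + (f - 1) * (int (lam i) - int k) - f * int s)"
    unfolding phK hk K1K(5) ef by (simp add: algebra_simps)
  finally have dvd: "int e dvd phi k" by simp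
  have kw: "k < w" using k cK K1K by simp
  have "W k < v (ahead k)"
  proof (cases "ahead k = 0")
    case True
    have "K < w - 1 \<or> K = w - 1" using K1K(4) by linarith
    then have "W K \<le> W (w - 1)" using W_strict[OF c(1) cK(1), of "w - 1"] K1K(4) by auto
    moreover have "int (W (w - 1)) = 1 + f * (int w - 1)"
      using last_column[OF c(1)] kw unfolding W_eq f_def[symmetric] by (simp add: of_nat_diff)
    moreover have "int (v 0) = f * int w" unfolding cval.simps(1) of_nat_mult int_e1 f_def ..
    moreover have "f * (int w - 1) = f * int w - f" by (simp add: algebra_simps)
    ultimately show ?thesis using kK f2 unfolding True by linarith
  qed (use less_v_ahead in blast)
  from chain_value[OF kw this dvd] have A: "ahead k < n" "W (q (ahead k)) = W k" by simp_all
  then have "q (ahead k) \<in> C" by (auto simp: C_def)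
  then show False using below[of "q (ahead k)"] A(2) kK by simp
qed

text \<open>Columns left of the corner all lose a node and rows up to p lose e - 1 nodes. The hook
  length changes by e, and shallowness is unaffected; only steepness can change.\<close>

lemma hook_shift:
  assumes i: "1 \<le> i" "i \<le> p" and k: "k < lam (Suc p)"
  shows "k < nu i" "k < lam i"
    and "arm lam i (Suc k) = arm nu i (Suc k) + (e - 1)" "leg lam i (Suc k) = Suc (leg nu i (Suc k))"
proof -
  note gap = lam_gap[OF i]
  have le: "lam (Suc p) \<le> lam (Suc i)" using corner_le[of "Suc i"] i by simp
  show "k < nu i" "k < lam i" using gap le k nu_low[OF i] by simp_all
  show "arm lam i (Suc k) = arm nu i (Suc k) + (e - 1)"
    using gap le k unfolding arm_def nu_low[OF i] by linarith
  have "k \<notin> C" using C_ge k by fastforce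
  moreover have "k < w" using k corner_le[of 1] by simp
  moreover have "Suc p \<le> h k" using h_ge_iff[of "Suc p" k] k by simp
  ultimately show "leg lam i (Suc k) = Suc (leg nu i (Suc k))"
    using i by (simp add: leg_def conjugate_nu)
qed

lemma hook_row_shift:
  assumes i: "p < i" and k: "k < nu i"
  shows "arm lam (Suc i) (Suc k) = arm nu i (Suc k)" "leg lam (Suc i) (Suc k) = leg nu i (Suc k)"
proof -
  have "lam (Suc i) \<le> lam (Suc p)" using partition_antimono[OF part, of "Suc p" "Suc i"] i by simp
  then have kc: "k < lam (Suc p)" using k nu_high[OF i] by simp
  then have "k \<notin> C" using C_ge by fastforce
  moreover have "k < w" using kc corner_le[of 1] by simp
  ultimately show "leg lam (Suc i) (Suc k) = leg nu i (Suc k)" by (simp add: leg_def conjugate_nu)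
  show "arm lam (Suc i) (Suc k) = arm nu i (Suc k)" by (simp add: arm_def nu_high[OF i])
qed

lemma shallow_shift:
  assumes i: "1 \<le> i" "i \<le> p" and k: "k < lam (Suc p)"
  shows "shallow e nu i (Suc k) \<longleftrightarrow> shallow e lam i (Suc k)"
  unfolding shallow_def hook_shift(3,4)[OF assms] by simp

lemma hooks_ok_nu:
  assumes ok: "hooks_ok e lam"
  shows "hooks_ok e nu"
  unfolding hooks_ok_def
proof (intro allI impI)
  fix i k assume i: "1 \<le> i" and k: "k < nu i" and d: "e dvd hook_length nu i (Suc k)"
  consider "p < i" | "i \<le> p" "lam (Suc p) \<le> k" | "i \<le> p" "k < lam (Suc p)" by linarith
  then show "shallow e nu i (Suc k) \<or> steep e nu i (Suc k)"
  proof cases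
    case 1
    note sh = hook_row_shift[OF 1 k]
    have "e dvd hook_length lam (Suc i) (Suc k)" using d by (simp add: hook_length_def sh)
    then have "shallow e lam (Suc i) (Suc k) \<or> steep e lam (Suc i) (Suc k)"
      using ok k nu_high[OF 1] by (simp add: hooks_ok_def)
    then show ?thesis by (simp add: shallow_def steep_def sh)
  next
    case 2
    have "shallow e nu i (Suc k)"
    proof (rule shallow_of_gaps[where e = e, OF is_partition_nu i k])
      fix j assume j: "i \<le> j" "j < conjugate nu (Suc k)"
      have "conjugate nu (Suc k) \<le> h k" by (simp add: conjugate_nu)
      then have jp: "Suc j \<le> p" using j h_le_p[OF 2(2)] by simp
      show "nu (Suc j) + (e - 1) \<le> nu j"
        using nu_low[of j] nu_low[of "Suc j"] lam_gap[of j] lam_gap[of "Suc j"] i j jp by simp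
    qed
    then show ?thesis ..
  next
    case 3
    note sh = hook_shift[OF i 3]
    have "hook_length lam i (Suc k) = hook_length nu i (Suc k) + e"
      using e by (simp add: hook_length_def sh)
    then have "e dvd hook_length lam i (Suc k)" using d by simp
    then have "shallow e lam i (Suc k) \<or> steep e lam i (Suc k)" using ok i sh(2) by (simp add: hooks_ok_def)
    then show ?thesis
    proof
      assume "steep e lam i (Suc k)"
      then have "(e - 1) * arm nu i (Suc k) + (e - 1) * (e - 1) \<le> Suc (leg nu i (Suc k))"
        unfolding steep_def sh add_mult_distrib2 .
      moreover have "1 * 1 \<le> (e - 1) * (e - 1)" using e by (intro mult_le_mono) auto
      ultimately have "steep e nu i (Suc k)" unfolding steep_def by linarith
      then show ?thesis ..
    qed (use shallow_shift[OF i 3] in simp)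
  qed
qed

text \<open>Below the deleted row hooks are copied, and right of the corner the row gaps make every
  hook shallow. A bad hook in the deleted row would continue the chain. The delicate case is a hook
  left of the corner that is steep in \<open>nu\<close> but not in \<open>lam\<close>;
  \<open>gap_value\<close> excludes it.\<close>

lemma hooks_ok_lam:
  assumes ok: "hooks_ok e nu"
  shows "hooks_ok e lam"
  unfolding hooks_ok_def
proof (intro allI impI, rule ccontr)
  fix i k assume i: "1 \<le> i" and k: "k < lam i" and d: "e dvd hook_length lam i (Suc k)"
    and no: "\<not> (shallow e lam i (Suc k) \<or> steep e lam i (Suc k))"
  define a l where "a = arm lam i (Suc k)" and "l = leg lam i (Suc k)"
  have ih: "i \<le> h k" using h_ge_iff[OF i, of k] k by simp
  have "l < (e - 1) * a" using no by (simp add: steep_def a_def l_def)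
  moreover have "e dvd a + l + 1" using d by (simp add: hook_length_def a_def l_def)
  ultimately obtain s where s: "s \<ge> 1" "l + e * s = (e - 1) * (a + 1)" using not_steep_dvdE[OF e] by blast
  have la: "lam i = Suc k + a" "h k = i + l" using k ih by (simp_all add: a_def l_def arm_def leg_def)
  have Wk: "W k + e * s = i + (e - 1) * lam i"
  proof -
    obtain f where f: "e = Suc f" using e by (cases e) auto
    show ?thesis unfolding colval_def la using s(2) by (simp add: f algebra_simps)
  qed
  consider (above) "Suc p < i" | (row) "i = Suc p" | (right) "i \<le> p" "lam (Suc p) \<le> k" | (left) "i \<le> p" "k < lam (Suc p)"
    by linarith
  then show False
  proof cases
    case above
    then obtain j where j: "i = Suc j" "p < j" by (cases i) auto
    have kj: "k < nu j" using k j nu_high by simp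
    note sh = hook_row_shift[OF j(2) kj]
    have "e dvd hook_length nu j (Suc k)" using d by (simp add: hook_length_def sh j)
    then have "shallow e nu j (Suc k) \<or> steep e nu j (Suc k)" using ok kj j by (simp add: hooks_ok_def)
    then show False using no by (simp add: shallow_def steep_def sh j)
  next
    case row
    \<comment> \<open>A bad hook in row \<open>Suc p\<close> makes its column a candidate after the
      last chain value, where none is left.\<close>
    have "v n + 1 = W k + e * s" using Wk row v_last by simp
    moreover have "e \<le> e * s" using s(1) by simp
    ultimately have "W k < v n" "v n + 1 - W k = e * s" using e by linarith+
    then have "W k < v n" "e dvd v n + 1 - W k" by simp_all
    moreover have "k < w" using k corner_le[of 1] row by simp
    ultimately have "k \<in> cand e lam (v n)" by (simp add: cand_def)
    then show False using cand_end by simp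
  next
    case right
    have "shallow e lam i (Suc k)"
    proof (rule shallow_of_gaps[where e = e, OF part i k])
      fix j assume j: "i \<le> j" "j < h k"
      then show "lam (Suc j) + (e - 1) \<le> lam j" using lam_gap[of j] i h_le_p[OF right(2)] by simp
    qed
    then show False using no by simp
  next
    case left
    note sh = hook_shift[OF i left]
    have "hook_length lam i (Suc k) = hook_length nu i (Suc k) + e"
      using e by (simp add: hook_length_def sh)
    then have "e dvd hook_length nu i (Suc k)" using d by simp
    then have "shallow e nu i (Suc k) \<or> steep e nu i (Suc k)" using ok i sh(1) by (simp add: hooks_ok_def)
    then have st: "steep e nu i (Suc k)" using no shallow_shift[OF i left] by blast
    obtain g where g: "e = Suc (Suc g)" using e by (metis add_2_eq_Suc le_Suc_ex)
    have "Suc g * arm nu i (Suc k) \<le> leg nu i (Suc k)" using st by (simp add: steep_def g)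
    \<comment> \<open>Steepness in \<open>nu\<close>, rewritten for \<open>lam\<close>, is weaker by
      (e - 1)^2 - 1; with the equation for s this gives exactly the range excluded by
      \<open>gap_value\<close>.\<close>
    then have "Suc g * a + 1 \<le> l + Suc g * Suc g"
      unfolding a_def l_def sh by (simp add: g add_mult_distrib2)
    then have "e * s < e * (e - 1)" using s(2) by (simp add: g algebra_simps)
    then have "s < e - 1" by (simp only: mult_less_cancel1)
    then show False using gap_value[OF i left Wk] s(1) by simp
  qed
qed

end

context column_chain
begin

lemma hooks_ok_iff: "hooks_ok e lam \<longleftrightarrow> tight \<and> hooks_ok e nu"
proof (cases "e = 2")
  case True
  then show ?thesis using tight_2 hooks_ok_2 by simp
next
  case False
  then have e3: "e \<ge> 3" using e by simp
  show ?thesis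
  proof (cases tight)
    case True
    then interpret tight_chain e lam n q by unfold_locales (rule e3)
    show ?thesis using True hooks_ok_nu hooks_ok_lam by blast
  next
    case False
    then show ?thesis using tight_of_hooks_ok by blast
  qed
qed

end

section \<open>Induction over successive peelings and conclusion\<close>

lemma conjugate_empty: "conjugate empty_partition = empty_partition"
  by (auto simp: conjugate_def empty_partition_def)

lemma regularisation_empty:
  assumes "e \<ge> 2"
  shows "regularisation e empty_partition = empty_partition"
proof -
  have p: "is_partition empty_partition" by (simp add: is_partition_def empty_partition_def)
  then have "e_regular e empty_partition" by (simp add: e_regular_def empty_partition_def)
  then show ?thesis by (rule regularisation_eqI[OF assms _ p refl])
qed

lemma toks_dcols:
  assumes e: "e \<ge> 2" and "is_partition lam"
  shows "(\<forall>j. (\<Sum>t<j. toks e lam t) \<le> (\<Sum>t<j. dcols e lam t)) \<and> (toks e lam = dcols e lam \<longleftrightarrow> hooks_ok e lam)"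
  using assms(2)
proof (induction "card (young lam)" arbitrary: lam rule: less_induct)
  case less
  show ?case
  proof (cases "lam = empty_partition")
    case True
    have z: "(peel e ^^ t) [] = []" for t by (induction t) auto
    have "toks e lam = (\<lambda>_. 0)" "dcols e lam = (\<lambda>_. 0)"
      unfolding True toks_def dcols_def regularisation_empty[OF e] conjugate_empty
      by (simp_all add: fun_eq_iff cols_def z empty_partition_def)
    moreover have "hooks_ok e lam" by (simp add: True hooks_ok_def empty_partition_def)
    ultimately show ?thesis by simp
  next
    case False
    obtain n q where "greedy_chain e lam n q" using greedy_chain_exists[OF e] .
    then interpret column_chain e lam n q using e less(2) by unfold_locales
    have IH: "(\<forall>j. (\<Sum>t<j. toks e nu t) \<le> (\<Sum>t<j. dcols e nu t)) \<and> (toks e nu = dcols e nu \<longleftrightarrow> hooks_ok e nu)"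
      by (rule less(1)[OF card_young_nu[OF False] is_partition_nu])
    then have le: "\<And>j. (\<Sum>t<j. toks e nu t) \<le> (\<Sum>t<j. dcols e nu t)" by blast
    show ?thesis
      using toks_dcols_step[OF le] IH hooks_ok_iff by blast
  qed
qed

theorem mainTheorem1:
  fixes e :: nat and lam :: parts
  assumes "e \<ge> 2" and "is_partition lam"
  shows "mullineux e (regularisation e lam) = regularisation e (conjugate lam) \<longleftrightarrow>
    (\<forall>(i, j) \<in> young lam. e dvd hook_length lam i j \<longrightarrow> shallow e lam i j \<or> steep e lam i j)"
  using mullineux_regularisation_iff[OF assms] toks_dcols[OF assms] hooks_ok_iff_young by blast

end
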